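(* Let $r$ be a positive integer, and consider the perturbed $r$-chain of integrators $$\dot z_i=z_{i+1}\ (1\le i\le r-1),\qquad \dot z_r=\varphi(t)+\gamma(t)u,$$ where $\varphi,\gamma$ are measurable and satisfy $|\varphi(t)|\le\bar\varphi$ and $0<\gamma_m\le\gamma(t)\le\gamma_M$ for a.e. $t\ge 0$, for some positive constants $\bar\varphi,\gamma_m,\gamma_M$ (unknown, i.e. the controller does not depend on them). Let $u_0:\mathbb{R}^r\to\mathbb{R}$ and $V:\mathbb{R}^r\to\mathbb{R}_+$ be a feedback law and a continuous positive definite function satisfying the Standing Assumption of the context. Let $g,k,\eta,\varepsilon,M,F_\xi,D(t),\hat\varphi$ be as in the context. For every $z_0\in\mathbb{R}^r$, consider any trajectory $z(\cdot)$, with $z(0)=z_0$, of the system closed by the feedback control law $$u=g(|u_0(z)|)\,u_0(z)+k\,\mathrm{sgn}(u_0(z))\,\hat\varphi .$$ Then $z(\cdot)$ is defined for all non-negative times, there exists a (finite) first time $\bar t(V(z_0))\ge 0$ at which $V(z(t))\le \eta(t)/2$, and $z(t)\in D(t)$ for all $t>\bar t(V(z_0))$.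
   Context: Notation. $\mathrm{sgn}$ is the multivalued function $\mathrm{sgn}(x)=x/|x|$ for $x\ne0$, $\mathrm{sgn}(0)=[-1,1]$. $J_r$ is the $r\times r$ matrix whose $(i,j)$ entry is $1$ if $i=j-1$ and $0$ otherwise, and $e_r=(0,\dots,0,1)^T\in\mathbb{R}^r$. $\mathbb{R}_+^*=(0,\infty)$. Solutions of (discontinuous) closed-loop systems are understood in Filippov's sense. Weights and homogeneity. Fix $\kappa<0$ and $p>0$ with $p+(r+1)\kappa\in[0,1)$, and set $p_i=p+(i-1)\kappa$ for $1\le i\le r+2$. For $\lambda>0$ let $\delta_\lambda(z)=(\lambda^{p_1}z_1,\dots,\lambda^{p_r}z_r)$. A function $f:\mathbb{R}^r\to\mathbb{R}^m$ is homogeneous of degree $q$ with respect to $(\delta_\lambda)_{\lambda>0}$ if $f(\delta_\lambda(z))=\lambda^q f(z)$ for all $\lambda>0$, $z\in\mathbb{R}^r$; a vector field (or differential inclusion) $F$ on $\mathbb{R}^r$ is homogeneous of degree $q$ if $F(\delta_\lambda(z))=\lambda^q\delta_\lambda(F(z))$. Standing Assumption on $(u_0,V)$. The feedback law $u_0:\mathbb{R}^r\to\mathbb{R}$ is homogeneous with respect to $(\delta_\lambda)_{\lambda>0}$, the closed-loop system $\dot z=J_rz+u_0(z)e_r$ is finite-time globally asymptotically stable with respect to the origin, and: (i) $z\mapsto J_rz+u_0(z)e_r$ is homogeneous of degree $\kappa$ with respect to $(\delta_\lambda)$; $V:\mathbb{R}^r\to\mathbb{R}_+$ is continuous, positive definite,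 $C^1$ except at the origin, homogeneous of positive degree with respect to $(\delta_\lambda)$, and there exist $c>0$ and $\alpha\in(0,1)$ such that, along non-trivial trajectories of $\dot z=J_rz+u_0(z)e_r$, $\dot V\le -cV^\alpha$; (ii) $z\mapsto u_0(z)\,\frac{\partial V}{\partial z_r}(z)$ is non-positive over $\mathbb{R}^r$, and for every non-zero $z$ with $u_0(z)=0$ one has $\frac{\partial V}{\partial z_r}(z)=0$. (Consequently $z\mapsto\mathrm{sgn}(u_0(z))\frac{\partial V}{\partial z_r}(z)$ is well defined and non-positive on $\mathbb{R}^r\setminus\{0\}$.) Controller data. $g:\mathbb{R}_+\to\mathbb{R}_+^*$ is an arbitrary increasing $C^1$ function with $g(x)\to\infty$ as $x\to\infty$; $k>0$ is a constant. $\eta:\mathbb{R}_+\to\mathbb{R}_+^*$ is a non-increasing $C^1$ function with $\eta(0)=\varepsilon>0$ and $-\dot\eta\le M\eta$, where $\varepsilon>0$ and $M\ge0$ are such that $M\varepsilon^{1-\alpha}<c$. For $\xi>0$, $F_\xi(x)=\frac{\xi}{\xi-x}$ for $x\in[0,\xi)$. For $t\ge0$, $D(t)=\{z\in\mathbb{R}^r : V(z)\le\eta(t)\}$. Time-varying gain $\hat\varphi$. Along a trajectory $z(\cdot)$ of the closed-loop system starting at $z_0$: if $V(z_0)\le\varepsilon/2$, put $\bar t(V(z_0))=0$; if $V(z_0)>\varepsilon/2$, let $\bar t(V(z_0))>0$ be the first time $t$ at which $V(z(t))=\eta(t)/2$, with $\bar t(V(z_0))=\infty$ if there is no such time. (This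 time may depend on the trajectory, not only on $V(z_0)$.) As long as $z(\cdot)$ is defined, the gain at time $t$ is $$\hat\varphi=t\ \text{ if }0\le t<\bar t(V(z_0)),\qquad \hat\varphi=F_{\eta(t)}(V(z(t)))\ \text{ if } t\ge\bar t(V(z_0)).$$ *)

theory Defs
  imports "HOL-Analysis.Analysis"
begin

text \<open>
  States live in \<^typ>\<open>real^'n\<close> with \<^typ>\<open>'n\<close> a finite linearly ordered index type, so that
  \<open>r = CARD('n)\<close> and \<open>pos\<close> numbers the coordinates \<open>1, \<dots>, r\<close> along the order.
\<close>

definition pos :: "'n::{finite,linorder} \<Rightarrow> nat"
  where "pos i = card {..i}"

definition shift_matrix :: "(real^'n::{finite,linorder})^'n::{finite,linorder}"
  where "shift_matrix = (\<chi> i j. if pos i + 1 = pos j then 1 else 0)"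

definition e_last :: "real^'n::{finite,linorder}"
  where "e_last = (\<chi> i. if pos i = CARD('n) then 1 else 0)"

definition chain_field :: "real \<Rightarrow> real^'n::{finite,linorder} \<Rightarrow> real^'n::{finite,linorder}"
  where "chain_field w z = shift_matrix *v z + w *\<^sub>R e_last"

definition msgn :: "real \<Rightarrow> real set"
  where "msgn x = (if x = 0 then {-1..1} else {x / \<bar>x\<bar>})"


subsection \<open>Weighted homogeneity\<close>

definition weight :: "real \<Rightarrow> real \<Rightarrow> nat \<Rightarrow> real"
  where "weight p \<kappa> i = p + (real i - 1) * \<kappa>"

definition dilation :: "real \<Rightarrow> real \<Rightarrow> real \<Rightarrow> real^'n::{finite,linorder} \<Rightarrow> real^'n::{finite,linorder}"
  where "dilation p \<kappa> \<rho> z = (\<chi> i. \<rho> powr weight p \<kappa> (pos i) * z $ i)"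

definition homogeneous_fun ::
    "real \<Rightarrow> real \<Rightarrow> real \<Rightarrow> (real^'n::{finite,linorder} \<Rightarrow> real) \<Rightarrow> bool"
  where "homogeneous_fun p \<kappa> q f \<longleftrightarrow>
    (\<forall>\<rho>>0. \<forall>z. f (dilation p \<kappa> \<rho> z) = \<rho> powr q * f z)"

definition homogeneous_field ::
    "real \<Rightarrow> real \<Rightarrow> real \<Rightarrow> (real^'n::{finite,linorder} \<Rightarrow> real^'n::{finite,linorder}) \<Rightarrow> bool"
  where "homogeneous_field p \<kappa> q F \<longleftrightarrow>
    (\<forall>\<rho>>0. \<forall>z. F (dilation p \<kappa> \<rho> z) = \<rho> powr q *\<^sub>R dilation p \<kappa> \<rho> (F z))"


subsection \<open>Filippov solutions\<close>

definition filippov :: "('a::euclidean_space \<Rightarrow> 'a set) \<Rightarrow> 'a \<Rightarrow> 'a set"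
  where "filippov F x =
    (\<Inter>\<delta>\<in>{0<..}. \<Inter>N\<in>{N. negligible N}. closure (convex hull (\<Union>y\<in>ball x \<delta> - N. F y)))"

text \<open>
  \<open>filippov_solution R I z\<close>: on the time interval \<open>I\<close>, which starts at \<open>0\<close> and may be open or closed
  on the right, \<open>z\<close> is locally absolutely continuous (the indefinite integral of a locally
  Lebesgue integrable \<open>v\<close>) and its derivative \<open>v\<close> satisfies the regularised inclusion almost
  everywhere. The regularisation of \<open>R\<close> is in the state, at fixed time.
\<close>

definition filippov_solution ::
    "(real \<Rightarrow> 'a::euclidean_space \<Rightarrow> 'a set) \<Rightarrow> real set \<Rightarrow> (real \<Rightarrow> 'a) \<Rightarrow> bool"
  where "filippov_solution R I z \<longleftrightarrow>
    is_interval I \<and> 0 \<in> I \<and> I \<subseteq> {0..} \<and>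
    (\<exists>v. (\<forall>T\<in>I. v absolutely_integrable_on {0..T} \<and> z T = z 0 + integral {0..T} v) \<and>
         (AE t in lebesgue_on I. v t \<in> filippov (R t) (z t)))"

definition maximal_solution ::
    "(real set \<Rightarrow> (real \<Rightarrow> 'a) \<Rightarrow> bool) \<Rightarrow> real set \<Rightarrow> (real \<Rightarrow> 'a) \<Rightarrow> bool"
  where "maximal_solution P I z \<longleftrightarrow>
    P I z \<and> (\<forall>I' z'. P I' z' \<and> I \<subseteq> I' \<and> (\<forall>t\<in>I. z' t = z t) \<longrightarrow> I' = I)"

definition finite_time_GAS :: "('a::euclidean_space \<Rightarrow> 'a set) \<Rightarrow> bool"
  where "finite_time_GAS F \<longleftrightarrow>
    (\<forall>e>0. \<exists>d>0. \<forall>I z. filippov_solution (\<lambda>t. F) I z \<and> norm (z 0) < d \<longrightarrow>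
        (\<forall>t\<in>I. norm (z t) < e)) \<and>
    (\<forall>I z. maximal_solution (filippov_solution (\<lambda>t. F)) I z \<longrightarrow>
        I = {0..} \<and> (\<exists>T\<ge>0. \<forall>t\<ge>T. z t = 0))"

text \<open>
  Filippov's theory presupposes a locally essentially bounded right-hand side; no continuity of a
  feedback is required.
\<close>

definition locally_ess_bounded :: "('a::euclidean_space \<Rightarrow> real) \<Rightarrow> bool"
  where "locally_ess_bounded f \<longleftrightarrow>
    (\<forall>x. \<exists>\<delta>>0. \<exists>B. AE y in lebesgue. y \<in> ball x \<delta> \<longrightarrow> \<bar>f y\<bar> \<le> B)"


subsection \<open>The unperturbed feedback and its Lyapunov function\<close>

definition nominal_field ::
    "(real^'n::{finite,linorder} \<Rightarrow> real) \<Rightarrow> real^'n::{finite,linorder} \<Rightarrow> real^'n::{finite,linorder}"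
  where "nominal_field u\<^sub>0 z = chain_field (u\<^sub>0 z) z"

definition d_last :: "(real^'n::{finite,linorder} \<Rightarrow> real) \<Rightarrow> real^'n::{finite,linorder} \<Rightarrow> real"
  where "d_last V z = frechet_derivative V (at z) e_last"

text \<open>
  In the decay condition, the derivative of \<open>V\<close> along trajectories at a state \<open>z \<noteq> 0\<close> is
  \<open>DV(z) v\<close>, with \<open>v\<close> ranging over all velocities that the Filippov inclusion admits at \<open>z\<close>; when
  \<open>u\<^sub>0\<close> is continuous the only one is \<open>nominal_field u\<^sub>0 z\<close>.
  The sign conditions are stated off the origin, where \<open>V\<close> need not be differentiable;
  homogeneity forces \<open>u\<^sub>0 0 = 0\<close>.
\<close>

definition standing_assumption ::
    "real \<Rightarrow> real \<Rightarrow> (real^'n::{finite,linorder} \<Rightarrow> real) \<Rightarrow> (real^'n::{finite,linorder} \<Rightarrow> real) \<Rightarrow> real \<Rightarrow> real \<Rightarrow> bool"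
  where "standing_assumption p \<kappa> u\<^sub>0 V c \<alpha> \<longleftrightarrow>
    locally_ess_bounded u\<^sub>0 \<and>
    (\<exists>q. homogeneous_fun p \<kappa> q u\<^sub>0) \<and>
    finite_time_GAS (\<lambda>z. {nominal_field u\<^sub>0 z}) \<and>
    homogeneous_field p \<kappa> \<kappa> (nominal_field u\<^sub>0) \<and>
    continuous_on UNIV V \<and> V 0 = 0 \<and> (\<forall>z. z \<noteq> 0 \<longrightarrow> 0 < V z) \<and>
    (\<forall>z. z \<noteq> 0 \<longrightarrow> V differentiable (at z)) \<and>
    (\<forall>h. continuous_on (- {0}) (\<lambda>z. frechet_derivative V (at z) h)) \<and>
    (\<exists>d>0. homogeneous_fun p \<kappa> d V) \<and>
    0 < c \<and> 0 < \<alpha> \<and> \<alpha> < 1 \<and>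
    (\<forall>z. z \<noteq> 0 \<longrightarrow> (\<forall>v\<in>filippov (\<lambda>y. {nominal_field u\<^sub>0 y}) z.
        frechet_derivative V (at z) v \<le> - c * V z powr \<alpha>)) \<and>
    (\<forall>z. z \<noteq> 0 \<longrightarrow> u\<^sub>0 z * d_last V z \<le> 0) \<and>
    (\<forall>z. z \<noteq> 0 \<and> u\<^sub>0 z = 0 \<longrightarrow> d_last V z = 0)"


subsection \<open>Controller\<close>

definition amplitude :: "(real \<Rightarrow> real) \<Rightarrow> bool"
  where "amplitude g \<longleftrightarrow>
    (\<forall>x\<ge>0. 0 < g x) \<and> mono_on {0..} g \<and> filterlim g at_top at_top \<and>
    (\<exists>g'. continuous_on {0..} g' \<and>
       (\<forall>x\<ge>0. (g has_real_derivative g' x) (at x within {0..})))"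

definition envelope :: "real \<Rightarrow> real \<Rightarrow> (real \<Rightarrow> real) \<Rightarrow> bool"
  where "envelope \<epsilon> M \<eta> \<longleftrightarrow>
    (\<forall>t\<ge>0. 0 < \<eta> t) \<and> antimono_on {0..} \<eta> \<and> \<eta> 0 = \<epsilon> \<and>
    (\<exists>\<eta>'. continuous_on {0..} \<eta>' \<and>
       (\<forall>t\<ge>0. (\<eta> has_real_derivative \<eta>' t) (at t within {0..}) \<and> - \<eta>' t \<le> M * \<eta> t))"

text \<open>
  The barrier is only meaningful for \<open>0 \<le> x < \<xi>\<close>. Membership in this range is deliberately not
  part of the notion of trajectory below, so that it is not assumed that trajectories stay in
  the sets \<open>safe_set\<close>.
\<close>

definition barrier :: "real \<Rightarrow> real \<Rightarrow> real"
  where "barrier \<xi> x = \<xi> / (\<xi> - x)"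

definition safe_set :: "(real \<Rightarrow> real) \<Rightarrow> ('a \<Rightarrow> real) \<Rightarrow> real \<Rightarrow> 'a set"
  where "safe_set \<eta> V t = {z. V z \<le> \<eta> t}"

text \<open>The infimum over the empty set is \<open>\<infinity>\<close>; otherwise it is attained, \<open>V \<circ> z\<close> being continuous.\<close>

definition switch_time ::
    "(real \<Rightarrow> real) \<Rightarrow> ('a \<Rightarrow> real) \<Rightarrow> real set \<Rightarrow> (real \<Rightarrow> 'a) \<Rightarrow> ereal"
  where "switch_time \<eta> V I z =
    (if V (z 0) \<le> \<eta> 0 / 2 then 0 else Inf (ereal ` {t \<in> I. V (z t) = \<eta> t / 2}))"

text \<open>\<open>\<tau>\<close> stands for the switching time of the trajectory under consideration.\<close>

definition gain :: "(real \<Rightarrow> real) \<Rightarrow> ('a \<Rightarrow> real) \<Rightarrow> ereal \<Rightarrow> real \<Rightarrow> 'a \<Rightarrow> real"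
  where "gain \<eta> V \<tau> t y = (if ereal t < \<tau> then t else barrier (\<eta> t) (V y))"

definition feedback ::
    "('a \<Rightarrow> real) \<Rightarrow> ('a \<Rightarrow> real) \<Rightarrow> (real \<Rightarrow> real) \<Rightarrow> real \<Rightarrow> (real \<Rightarrow> real) \<Rightarrow> ereal \<Rightarrow> real \<Rightarrow> 'a \<Rightarrow> real set"
  where "feedback u\<^sub>0 V g k \<eta> \<tau> t y =
    {g \<bar>u\<^sub>0 y\<bar> * u\<^sub>0 y + k * s * gain \<eta> V \<tau> t y | s. s \<in> msgn (u\<^sub>0 y)}"

definition closed_loop_trajectory ::
    "(real \<Rightarrow> real) \<Rightarrow> (real \<Rightarrow> real) \<Rightarrow> (real^'n::{finite,linorder} \<Rightarrow> real) \<Rightarrow> (real^'n::{finite,linorder} \<Rightarrow> real) \<Rightarrow>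
     (real \<Rightarrow> real) \<Rightarrow> real \<Rightarrow> (real \<Rightarrow> real) \<Rightarrow> real set \<Rightarrow> (real \<Rightarrow> real^'n::{finite,linorder}) \<Rightarrow> bool"
  where "closed_loop_trajectory \<phi> \<gamma> u\<^sub>0 V g k \<eta> I z \<longleftrightarrow>
    filippov_solution
      (\<lambda>t y. {chain_field (\<phi> t + \<gamma> t * u) y | u. u \<in> feedback u\<^sub>0 V g k \<eta> (switch_time \<eta> V I z) t y})
      I z"

end

theory Submission
  imports Defs "HOL-Complex_Analysis.Great_Picard"
begin

text \<open>
  The theorem is a Lyapunov argument for \<open>V\<close>, combined with a continuation argument which shows that
  trajectories do not stop.

  \<^bold>\<open>Decay.\<close> Compare a velocity of the closed loop at \<open>z \<noteq> 0\<close> with the nominal velocity. They differ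
  only in the last coordinate, by \<open>\<phi> + \<gamma> u - u\<^sub>0\<close>. The sign condition makes the part of the control
  that has the sign of \<open>u\<^sub>0\<close> push \<open>V\<close> down. Because \<open>g\<close> tends to infinity, \<open>x - \<gamma>\<^sub>m g(x) x\<close> is bounded
  by some \<open>C\<close> on \<open>x \<ge> 0\<close>, so as soon as \<open>\<gamma>\<^sub>m k\<close> times the gain exceeds \<open>C + \<phi>\<^sub>b\<close> the difference is
  harmless and the nominal decay \<open>- c V\<^sup>\<alpha>\<close> survives (\<open>perturbed_decay\<close>).

  \<^bold>\<open>Before the switch\<close> the gain is \<open>t\<close>. It eventually passes this threshold, after which \<open>V\<^sup>1\<^sup>-\<^sup>\<alpha>\<close>
  decreases at least at a constant rate; hence \<open>V\<close> reaches \<open>\<eta>/2\<close> in finite time (\<open>switch_time_finite\<close>). Until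
  then homogeneity bounds \<open>\<partial>V/\<partial>z\<^sub>r\<close> by a multiple of \<open>V\<close> away from the origin, so \<open>V\<close> grows at most
  exponentially (\<open>bounded_before_switch\<close>).

  \<^bold>\<open>After the switch\<close> the gain is the barrier, which is at least \<open>1/(1-\<theta>)\<close> where \<open>V \<ge> \<theta> \<eta>\<close>. For
  \<open>\<theta> < 1\<close> close to 1 this passes the threshold, and \<open>M \<epsilon>\<^sup>1\<^sup>-\<^sup>\<alpha> < c\<close> lets the decay of \<open>V\<close> outrun that of
  \<open>\<theta> \<eta>\<close>. So \<open>V \<le> \<theta> \<eta>\<close> persists (\<open>V_below_after_switch\<close>), and the gain stays bounded.

  \<^bold>\<open>Continuation.\<close> Velocities are therefore bounded on bounded time intervals, and a trajectory on
  \<open>[0,T)\<close> extends to \<open>[0,T]\<close>. Past \<open>T\<close> it is continued by a local existence theorem for Filippov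
  inclusions whose right-hand side is only measurable in time (\<open>filippov_local_existence\<close>), obtained
  from Euler polygons.

  Two devices keep the measure theory elementary. \<open>V\<close> is followed along trajectories through an
  integrated chain rule (\<open>integral_curve_comparison\<close>), which does not differentiate absolutely
  continuous functions. Weak limits of velocities are replaced by almost everywhere limits of convex
  combinations (\<open>bounded_sequence_weak_limit\<close>), which is all that closed convex sets require.
\<close>

section \<open>Filippov regularisation\<close>

abbreviation ess_hull ::
    "('a::euclidean_space \<Rightarrow> 'b::euclidean_space set) \<Rightarrow> 'a \<Rightarrow> real \<Rightarrow> 'a set \<Rightarrow> 'b set"
  where "ess_hull F x \<delta> N \<equiv> closure (convex hull (\<Union>y\<in>ball x \<delta> - N. F y))"

text \<open>
  The Filippov construction for maps into an arbitrary Euclidean space. It is also applied to the pair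
  (amplitude part of the control, selected sign), which does not live in the state space.
\<close>

definition essential_limits :: "('a::euclidean_space \<Rightarrow> 'b::euclidean_space set) \<Rightarrow> 'a \<Rightarrow> 'b set"
  where "essential_limits F x = (\<Inter>\<delta>\<in>{0<..}. \<Inter>N\<in>{N. negligible N}. ess_hull F x \<delta> N)"

lemma filippov_eq_essential_limits: "filippov F = essential_limits F"
  unfolding filippov_def essential_limits_def by blast

lemma filippov_subset_hull:
  assumes "0 < \<delta>" "negligible N"
  shows "filippov F x \<subseteq> ess_hull F x \<delta> N"
  using assms unfolding filippov_def by blast

lemma filippov_memI:
  assumes "\<And>\<delta> N. 0 < \<delta> \<Longrightarrow> negligible N \<Longrightarrow> v \<in> ess_hull F x \<delta> N"
  shows "v \<in> filippov F x"
  using assms unfolding filippov_def by blast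

lemma filippov_subset_convex:
  assumes "0 < \<delta>" "negligible N" "closed C" "convex C"
    and "\<And>y v. y \<in> ball x \<delta> - N \<Longrightarrow> v \<in> F y \<Longrightarrow> v \<in> C"
  shows "filippov F x \<subseteq> C"
proof -
  have "ess_hull F x \<delta> N \<subseteq> C"
    using assms(3-5) by (intro closure_minimal hull_minimal) auto
  then show ?thesis using filippov_subset_hull[OF assms(1,2)] by blast
qed

text \<open>
  This is the form in which upper semicontinuity is used: velocities at points that converge to \<open>x\<close>
  end up in every closed convex set of the family whose intersection defines the regularisation at \<open>x\<close>.
\<close>

lemma filippov_nearby_subset_hull:
  assumes "y \<in> ball x \<delta>" "negligible N"
  shows "filippov F y \<subseteq> ess_hull F x \<delta> N"
proof -
  have sub: "ball y (\<delta> - dist x y) \<subseteq> ball x \<delta>"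
    using assms(1) by (simp add: ball_subset_ball_iff dist_commute)
  have "ess_hull F y (\<delta> - dist x y) N \<subseteq> ess_hull F x \<delta> N"
    by (intro closure_mono hull_mono UN_mono) (use sub in auto)
  moreover have "0 < \<delta> - dist x y" using assms(1) by simp
  ultimately show ?thesis using filippov_subset_hull[OF _ assms(2)] by blast
qed

text \<open>
  The sets \<open>ess_hull F x \<delta> N\<close> form a directed family, and local boundedness makes them compact. So if
  the intersection lies in the open set \<open>U\<close>, one member already does. With this, an estimate that is
  known only on the regularised set transfers, with an arbitrarily small loss, to almost all nearby
  points; and \<open>U = {}\<close> shows that the regularisation is nonempty.
\<close>

lemma essential_limits_neighbourhood:
  fixes F :: "'a::euclidean_space \<Rightarrow> 'b::euclidean_space set"
  assumes "0 < \<delta>\<^sub>0" "negligible N\<^sub>0"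
    and bdd: "\<And>y v. y \<in> ball x \<delta>\<^sub>0 - N\<^sub>0 \<Longrightarrow> v \<in> F y \<Longrightarrow> norm v \<le> B"
    and U: "open U" "essential_limits F x \<subseteq> U"
  obtains \<delta> N where "0 < \<delta>" "negligible N" "\<And>y. y \<in> ball x \<delta> - N \<Longrightarrow> F y \<subseteq> U"
proof -
  define D where "D = {0::real<..} \<times> {N::'a set. negligible N}"
  define h where "h = (\<lambda>(\<delta>, N). ess_hull F x \<delta> N)"
  have fil: "essential_limits F x = (\<Inter>d\<in>D. h d)"
    unfolding essential_limits_def D_def h_def by auto
  let ?K = "cball 0 B - U"
  have K: "compact ?K" by (simp add: compact_diff U(1))
  have inter: "?K \<inter> (\<Inter>d\<in>D. h d) = {}" using U(2) fil by auto
  have "\<exists>E\<subseteq>D. finite E \<and> ?K \<inter> (\<Inter>d\<in>E. h d) = {}"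
  proof (rule ccontr)
    assume "\<not> ?thesis"
    then have "?K \<inter> \<Inter>E \<noteq> {}" if "finite E" "E \<subseteq> h ` D" for E
      using finite_subset_image[OF that] by metis
    moreover have "closed C" if "C \<in> h ` D" for C
      using that by (auto simp: h_def)
    ultimately have "?K \<inter> (\<Inter>d\<in>D. h d) \<noteq> {}"
      using compact_imp_fip[OF K, of "h ` D"] by blast
    with inter show False by simp
  qed
  then obtain E where E: "E \<subseteq> D" "finite E" "?K \<inter> (\<Inter>d\<in>E. h d) = {}" by blast
  define \<delta> where "\<delta> = Min (insert \<delta>\<^sub>0 (fst ` E))"
  define N where "N = N\<^sub>0 \<union> \<Union>(snd ` E)"
  have "0 < \<delta>" unfolding \<delta>_def using E(1,2) assms(1) by (auto simp: D_def)
  moreover have "negligible N"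
    unfolding N_def using E(1,2) assms(2) by (auto simp: D_def intro!: negligible_Union)
  moreover have "F y \<subseteq> U" if y: "y \<in> ball x \<delta> - N" for y
  proof
    fix v assume v: "v \<in> F y"
    have le: "\<delta> \<le> \<delta>\<^sub>0" "\<And>d. d \<in> E \<Longrightarrow> \<delta> \<le> fst d"
      unfolding \<delta>_def using E(2) by auto
    have "norm v \<le> B" using y le(1) v by (intro bdd[of y]) (auto simp: N_def)
    moreover have "v \<in> h d" if "d \<in> E" for d
    proof -
      have "y \<in> ball x (fst d) - snd d" using y le(2)[OF that] that by (auto simp: N_def)
      then have "v \<in> (\<Union>y\<in>ball x (fst d) - snd d. F y)" using v by blast
      then have "v \<in> ess_hull F x (fst d) (snd d)"
        by (meson closure_subset hull_subset subsetD)
      then show ?thesis by (simp add: h_def case_prod_beta)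
    qed
    ultimately show "v \<in> U" using E(3) by auto
  qed
  ultimately show ?thesis by (rule that)
qed

lemma ball_minus_negligible_nonempty:
  fixes x :: "'a::euclidean_space"
  assumes "0 < \<delta>" "negligible N"
  shows "ball x \<delta> - N \<noteq> {}"
proof
  assume "ball x \<delta> - N = {}"
  then have "negligible (ball x \<delta>)" using negligible_subset[OF assms(2)] by blast
  then show False using open_not_negligible[of "ball x \<delta>"] assms(1) by simp
qed

lemma essential_limits_nonempty:
  fixes F :: "'a::euclidean_space \<Rightarrow> 'b::euclidean_space set"
  assumes "0 < \<delta>\<^sub>0" "negligible N\<^sub>0"
    and "\<And>y v. y \<in> ball x \<delta>\<^sub>0 - N\<^sub>0 \<Longrightarrow> v \<in> F y \<Longrightarrow> norm v \<le> B"
    and ne: "\<And>y. F y \<noteq> {}"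
  shows "essential_limits F x \<noteq> {}"
proof
  assume "essential_limits F x = {}"
  then obtain \<delta> N where "0 < \<delta>" "negligible N" "\<And>y. y \<in> ball x \<delta> - N \<Longrightarrow> F y \<subseteq> {}"
    using essential_limits_neighbourhood[OF assms(1,2) _ open_empty, of x F B] assms(3) by (metis subset_refl)
  then show False using ball_minus_negligible_nonempty[of \<delta> N x] ne by blast
qed

lemma convex_hull_near:
  fixes S D :: "'a::real_normed_vector set"
  assumes "\<And>a. a \<in> S \<Longrightarrow> \<exists>b\<in>D. dist a b \<le> \<epsilon>" and "a \<in> convex hull S"
  shows "\<exists>b\<in>convex hull D. dist a b \<le> \<epsilon>"
proof -
  let ?C = "{x + y | x y. x \<in> convex hull D \<and> y \<in> cball 0 \<epsilon>}"
  have "?C = (\<Union>x\<in>convex hull D. \<Union>y\<in>cball 0 \<epsilon>. {x + y})" by blast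
  then have "convex ?C"
    using convex_sums[OF convex_convex_hull[of D] convex_cball[of 0 \<epsilon>]] by simp
  have "S \<subseteq> ?C"
  proof
    fix a assume "a \<in> S"
    then obtain b where "b \<in> D" "dist a b \<le> \<epsilon>" using assms(1) by blast
    then have "a = b + (a - b)" "b \<in> convex hull D" "a - b \<in> cball 0 \<epsilon>"
      by (auto simp: hull_inc dist_norm norm_minus_commute)
    then show "a \<in> ?C" by blast
  qed
  with \<open>convex ?C\<close> have "convex hull S \<subseteq> ?C" by (rule hull_minimal[rotated])
  with assms(2) show ?thesis by (force simp: dist_norm)
qed

text \<open>
  A factor of the right-hand side that is continuous in the state can be frozen at \<open>x\<close> before
  regularising: the error is uniformly small on small balls, and convex hulls do not enlarge it.
\<close>

lemma filippov_affine_image: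
  fixes F :: "'a::euclidean_space \<Rightarrow> 'b::euclidean_space set" and L :: "'b \<Rightarrow> 'a"
  assumes w: "w \<in> essential_limits F x"
    and L: "bounded_linear L"
    and near: "\<And>e. 0 < e \<Longrightarrow> \<exists>\<delta>>0. \<forall>y\<in>ball x \<delta>. \<forall>v\<in>F y. \<exists>r\<in>R y. dist (c + L v) r \<le> e"
  shows "c + L w \<in> filippov R x"
proof (rule filippov_memI)
  fix \<delta> :: real and N :: "'a set" assume dN: "0 < \<delta>" "negligible N"
  let ?D = "\<Union>y\<in>ball x \<delta> - N. R y"
  show "c + L w \<in> ess_hull R x \<delta> N"
    unfolding closure_approachable
  proof (intro allI impI)
    fix e :: real assume "0 < e"
    obtain d where d: "0 < d" "\<And>y v. y \<in> ball x d \<Longrightarrow> v \<in> F y \<Longrightarrow> \<exists>r\<in>R y. dist (c + L v) r \<le> e/2"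
      using near[OF half_gt_zero[OF \<open>0 < e\<close>]] by blast
    let ?S = "\<Union>y\<in>ball x (min d \<delta>) - N. F y"
    let ?A = "\<lambda>v. c + L v"
    have "continuous_on UNIV ?A"
      using L by (intro continuous_intros linear_continuous_on)
    then have "?A ` closure (convex hull ?S) \<subseteq> closure (?A ` (convex hull ?S))"
      by (intro image_closure_subset[OF _ closed_closure closure_subset]) (rule continuous_on_subset, auto)
    moreover have "w \<in> closure (convex hull ?S)" using w d(1) dN unfolding essential_limits_def by simp
    ultimately have "?A w \<in> closure (?A ` (convex hull ?S))" by blast
    also have "?A ` (convex hull ?S) = convex hull (?A ` ?S)"
    proof -
      have A: "?A ` X = (+) c ` (L ` X)" for X by auto
      show ?thesis
        unfolding A convex_hull_translation convex_hull_linear_image[OF bounded_linear.linear[OF L]] ..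
    qed
    finally obtain a where a: "a \<in> convex hull (?A ` ?S)" "dist a (?A w) < e/2"
      using half_gt_zero[OF \<open>0 < e\<close>] unfolding closure_approachable by blast
    have "\<exists>b\<in>?D. dist a b \<le> e/2" if "a \<in> ?A ` ?S" for a
      using that d(2) by fastforce
    from convex_hull_near[OF this a(1)]
    obtain b where "b \<in> convex hull ?D" "dist a b \<le> e/2" by blast
    moreover have "dist b (?A w) \<le> dist a b + dist a (?A w)" by (rule dist_triangle3)
    ultimately have "b \<in> convex hull ?D" "dist b (?A w) < e" using a(2) by auto
    then show "\<exists>b\<in>convex hull ?D. dist b (?A w) < e" by blast
  qed
qed

section \<open>Limits of bounded sequences of velocities\<close>

text \<open>
  Midpoints suffice for the minimisation argument below, and spare the bookkeeping of general convex
  combinations of functions.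
\<close>

inductive midpoint_combination :: "(nat \<Rightarrow> real \<Rightarrow> 'a::real_vector) \<Rightarrow> nat \<Rightarrow> (real \<Rightarrow> 'a) \<Rightarrow> bool"
  for v n where
    base: "n \<le> k \<Longrightarrow> midpoint_combination v n (v k)"
  | midpoint: "midpoint_combination v n f \<Longrightarrow> midpoint_combination v n g \<Longrightarrow>
      midpoint_combination v n (\<lambda>t. (1/2) *\<^sub>R (f t + g t))"

lemma midpoint_combination_antimono:
  assumes "midpoint_combination v n f" "m \<le> n" shows "midpoint_combination v m f"
  using assms by induction (auto intro: midpoint_combination.intros)

lemma midpoint_combination_in_convex:
  assumes "midpoint_combination v n f" "convex C" "\<And>k. n \<le> k \<Longrightarrow> v k t \<in> C"
  shows "f t \<in> C"
  using assms(1)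
proof induction
  case (midpoint f g)
  then show ?case using convexD[OF assms(2), of "f t" "g t" "1/2" "1/2"] by (simp add: scaleR_add_right)
qed (use assms in auto)

lemma bounded_measurable_integrable:
  fixes f :: "real \<Rightarrow> 'a::euclidean_space"
  assumes "f \<in> borel_measurable (lebesgue_on {a..b})" "\<And>t. norm (f t) \<le> L"
  shows "integrable (lebesgue_on {a..b}) f"
  using assms
  by (intro finite_measure.integrable_const_bound[where B=L] finite_measure_lebesgue_on) (auto simp: lmeasurable_compact)

lemma bounded_measurable_abs_integrable:
  fixes f :: "real \<Rightarrow> 'a::euclidean_space"
  assumes "f \<in> borel_measurable (lebesgue_on {a..b})" "\<And>t. norm (f t) \<le> L" "a \<le> s" "t \<le> b"
  shows "f absolutely_integrable_on {s..t}"
proof -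
  have "f absolutely_integrable_on {a..b}"
    using bounded_measurable_integrable[OF assms(1,2)]
    by (simp add: absolutely_integrable_on_def integrable_on_lebesgue_on absolutely_integrable_measurable assms)
  then show ?thesis
    by (rule absolutely_integrable_on_subinterval) (use assms in auto)
qed

lemma midpoint_combination_measurable:
  fixes v :: "nat \<Rightarrow> real \<Rightarrow> 'a::euclidean_space"
  assumes "midpoint_combination v n f" "\<And>n. v n \<in> borel_measurable M"
  shows "f \<in> borel_measurable M"
  using assms(1) by induction (use assms(2) in measurable)

lemma midpoint_combination_bounded:
  fixes v :: "nat \<Rightarrow> real \<Rightarrow> 'a::euclidean_space"
  assumes "midpoint_combination v n f" "\<And>n t. norm (v n t) \<le> L"
  shows "norm (f t) \<le> L"
  using midpoint_combination_in_convex[OF assms(1), of "cball 0 L" t] assms(2) by simp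

lemma midpoint_combination_integral_in_convex:
  fixes v :: "nat \<Rightarrow> real \<Rightarrow> 'a::euclidean_space"
  assumes f: "midpoint_combination v n f"
    and meas: "\<And>n. v n \<in> borel_measurable (lebesgue_on {a..b})"
    and bdd: "\<And>n t. norm (v n t) \<le> L"
    and t: "t \<le> b"
    and C: "convex C" "\<And>k. n \<le> k \<Longrightarrow> integral {a..t} (v k) \<in> C"
  shows "integral {a..t} f \<in> C"
  using f
proof induction
  case (midpoint f g)
  have int: "h integrable_on {a..t}" if "midpoint_combination v n h" for h
    using bounded_measurable_abs_integrable[OF midpoint_combination_measurable[OF that meas]
        midpoint_combination_bounded[OF that bdd], where s=a and t=t] t set_lebesgue_integral_eq_integral(1) by simp
  have "integral {a..t} (\<lambda>t. (1/2) *\<^sub>R (f t + g t)) = (1/2) *\<^sub>R integral {a..t} f + (1/2) *\<^sub>R integral {a..t} g"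
    using int[OF midpoint(1)] int[OF midpoint(2)] by (simp add: integral_add scaleR_add_right)
  then show ?case using convexD[OF C(1) midpoint.IH, of "1/2" "1/2"] by simp
qed (use C in auto)

text \<open>
  Nearly minimise the \<open>L\<^sup>2\<close> norm among the combinations of the \<open>n\<close>-th tail. The infima increase with \<open>n\<close>
  and are bounded, hence converge; the midpoint of two near-minimisers is again a competitor, so the
  parallelogram identity forces the near-minimisers to be close to each other.
\<close>

lemma L2_Cauchy_midpoints:
  fixes v :: "nat \<Rightarrow> real \<Rightarrow> 'a::euclidean_space"
  assumes meas: "\<And>n. v n \<in> borel_measurable (lebesgue_on {a..b})"
    and bdd: "\<And>n t. norm (v n t) \<le> L"
  obtains w where "\<And>n. midpoint_combination v n (w n)"
    and "\<And>e. 0 < e \<Longrightarrow> \<exists>N. \<forall>n\<ge>N. \<forall>m\<ge>n. (\<integral>t. (norm (w n t - w m t))\<^sup>2 \<partial>lebesgue_on {a..b}) \<le> e"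
proof -
  let ?M = "lebesgue_on {a..b}"
  define Q where "Q f = (\<integral>t. (norm (f t))\<^sup>2 \<partial>?M)" for f :: "real \<Rightarrow> 'a"
  define d where "d n = Inf (Q ` Collect (midpoint_combination v n))" for n
  have L: "0 \<le> L" using bdd[of 0 0] norm_ge_zero order_trans by blast
  have intQ: "integrable ?M (\<lambda>t. (norm (f t))\<^sup>2)"
    if "f \<in> borel_measurable ?M" "\<And>t. norm (f t) \<le> B" for f :: "real \<Rightarrow> 'a" and B
    using that by (intro bounded_measurable_integrable[where L="B\<^sup>2"]) (auto intro: power_mono)
  note mm = midpoint_combination_measurable[OF _ meas] and mb = midpoint_combination_bounded[OF _ bdd]
  have Q0: "0 \<le> Q f" for f unfolding Q_def by (rule integral_nonneg_AE) simp
  have bd: "bdd_below (Q ` X)" for X using Q0 by (auto intro!: bdd_belowI[of _ 0])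
  have ne: "Q ` Collect (midpoint_combination v n) \<noteq> {}" for n
    using midpoint_combination.base[of n n v] by auto
  have dle: "d n \<le> Q f" if "midpoint_combination v n f" for n f
    unfolding d_def using that by (intro cInf_lower bd) auto
  have dmono: "d n \<le> d m" if "n \<le> m" for n m
    unfolding d_def
    by (rule cInf_superset_mono[OF ne bd]) (use midpoint_combination_antimono that in blast)
  have "d n \<le> measure ?M (space ?M) * L\<^sup>2" for n
  proof -
    have "d n \<le> Q (v n)" by (intro dle midpoint_combination.base) simp
    also have "\<dots> \<le> (\<integral>t. L\<^sup>2 \<partial>?M)" unfolding Q_def
      by (intro integral_mono intQ meas bdd) (auto intro!: bdd power_mono finite_measure.integrable_const finite_measure_lebesgue_on)
    finally show ?thesis by simp
  qed
  then have "bdd_above (range d)"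
    by (intro bdd_aboveI) auto
  then have lim: "d \<longlonglongrightarrow> Sup (range d)" and dS: "\<And>n. d n \<le> Sup (range d)"
    by (auto intro!: LIMSEQ_incseq_SUP cSUP_upper simp: incseq_def dmono)
  let ?D = "Sup (range d)"
  have "\<exists>f. midpoint_combination v n f \<and> Q f < d n + 1 / (real n + 1)" for n
    using cInf_lessD[OF ne, of n "d n + 1 / (real n + 1)"] unfolding d_def by auto
  then obtain w where w: "\<And>n. midpoint_combination v n (w n)" "\<And>n. Q (w n) < d n + 1 / (real n + 1)"
    by metis
  \<comment> \<open>the parallelogram identity, with the midpoint bounded below by the infimum \<open>d n\<close>\<close>
  have gap: "Q (\<lambda>t. w n t - w m t) \<le> 2 * (?D - d n) + 4 / (real n + 1)" if "n \<le> m" for n m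
  proof -
    let ?h = "\<lambda>t. (1/2) *\<^sub>R (w n t + w m t)"
    have h: "midpoint_combination v n ?h"
      by (intro midpoint_combination.midpoint w midpoint_combination_antimono[OF w(1) that])
    have eq: "(norm (w n t - w m t))\<^sup>2 = 2 * (norm (w n t))\<^sup>2 + 2 * (norm (w m t))\<^sup>2 - 4 * (norm (?h t))\<^sup>2" for t
      by (simp add: power2_norm_eq_inner inner_add_left inner_add_right inner_diff_left inner_diff_right
          inner_commute algebra_simps)
    have "Q (\<lambda>t. w n t - w m t) = 2 * Q (w n) + 2 * Q (w m) - 4 * Q ?h"
      unfolding Q_def eq using intQ[OF mm[OF w(1)] mb[OF w(1)]] intQ[OF mm[OF h] mb[OF h]]
      by simp
    also have "\<dots> \<le> 2 * (d n + 1 / (real n + 1)) + 2 * (d m + 1 / (real m + 1)) - 4 * d n"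
      using w(2)[of n] w(2)[of m] dle[OF h] by (intro diff_mono add_mono mult_left_mono) auto
    also have "\<dots> \<le> 2 * (?D - d n) + 4 / (real n + 1)"
    proof -
      have "1 / (real m + 1) \<le> 1 / (real n + 1)" using that by (intro divide_left_mono) auto
      then show ?thesis using dS[of m] by simp
    qed
    finally show ?thesis .
  qed
  have "(\<lambda>n. 2 * (?D - d n) + 4 / (real n + 1)) \<longlonglongrightarrow> 2 * (?D - ?D) + 0"
    using LIMSEQ_Suc[OF lim_const_over_n[of "4::real"]] by (intro tendsto_intros lim) (simp add: add.commute)
  then have "\<exists>N. \<forall>n\<ge>N. \<forall>m\<ge>n. Q (\<lambda>t. w n t - w m t) \<le> e" if "0 < e" for e
    using gap that order_tendstoD(2)[of _ 0 sequentially e] 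
    by (auto simp: eventually_sequentially) (meson less_imp_le order_trans)
  then show ?thesis using that[OF w(1)] unfolding Q_def by blast
qed

text \<open>
  Along a subsequence the squared \<open>L\<^sup>2\<close> increments are below \<open>4\<^sup>-\<^sup>j\<close>; then the \<open>L\<^sup>1\<close> increments are
  summable, so the increments are absolutely summable almost everywhere.
\<close>

lemma L2_Cauchy_AE_subsequence:
  fixes w :: "nat \<Rightarrow> real \<Rightarrow> 'a::euclidean_space"
  assumes meas: "\<And>n. w n \<in> borel_measurable (lebesgue_on {a..b})"
    and bdd: "\<And>n t. norm (w n t) \<le> L"
    and Cauchy: "\<And>e. 0 < e \<Longrightarrow> \<exists>N. \<forall>n\<ge>N. \<forall>m\<ge>n. (\<integral>t. (norm (w n t - w m t))\<^sup>2 \<partial>lebesgue_on {a..b}) \<le> e"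
  obtains r :: "nat \<Rightarrow> nat" where "strict_mono r"
    and "AE t in lebesgue_on {a..b}. convergent (\<lambda>j. w (r j) t)"
proof -
  let ?M = "lebesgue_on {a..b}"
  interpret finite_measure ?M by (intro finite_measure_lebesgue_on) (auto simp: lmeasurable_compact)
  have "\<forall>j. \<exists>N. \<forall>n\<ge>N. \<forall>m\<ge>n. (\<integral>t. (norm (w n t - w m t))\<^sup>2 \<partial>?M) \<le> (1/4)^j"
    using Cauchy by simp
  then obtain N where N: "\<And>j n m. N j \<le> n \<Longrightarrow> n \<le> m \<Longrightarrow> (\<integral>t. (norm (w n t - w m t))\<^sup>2 \<partial>?M) \<le> (1/4)^j"
    by metis
  define r where "r j = j + (\<Sum>i\<le>j. N i)" for j
  have r: "strict_mono r" by (auto simp: strict_mono_Suc_iff r_def)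
  have Nr: "N j \<le> r j" for j
  proof -
    have "N j \<le> (\<Sum>i\<le>j. N i)" by (rule member_le_sum) auto
    then show ?thesis by (simp add: r_def)
  qed
  define u where "u j t = w (r j) t - w (r (Suc j)) t" for j t
  have um: "u j \<in> borel_measurable ?M" for j unfolding u_def using meas by measurable
  have ub: "norm (u j t) \<le> 2 * L" for j t
    unfolding u_def using norm_triangle_ineq4[of "w (r j) t" "w (r (Suc j)) t"] bdd[of "r j" t] bdd[of "r (Suc j)" t] by linarith
  let ?c = "measure ?M (space ?M) + 1"
  have nn: "(\<integral>\<^sup>+t. ennreal (norm (u j t)) \<partial>?M) \<le> ennreal (?c * (1/2)^j)" for j
  proof -
    have i1: "integrable ?M (\<lambda>t. norm (u j t))"
      using um ub by (intro bounded_measurable_integrable[where L="2*L"]) auto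
    have "norm ((norm (u j t))\<^sup>2) \<le> (2 * L)\<^sup>2" for t
      using power_mono[OF ub[of j t] norm_ge_zero, of 2] by simp
    then have i2: "integrable ?M (\<lambda>t. (norm (u j t))\<^sup>2)"
      using um by (intro bounded_measurable_integrable[where L="(2*L)\<^sup>2"]) auto
    \<comment> \<open>the arithmetic-geometric mean inequality, weighted so that both terms integrate to order \<open>2\<^sup>-\<^sup>j\<close>\<close>
    have pt: "norm (u j t) \<le> (1/2)^j + 2^j * (norm (u j t))\<^sup>2" for t
    proof -
      have "0 \<le> ((1/2)^j - norm (u j t))\<^sup>2 * 2^j" by simp
      also have "\<dots> = (1/2)^j - 2 * norm (u j t) + 2^j * (norm (u j t))\<^sup>2"
        by (simp add: power2_eq_square algebra_simps power_divide)
      finally show ?thesis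
        by (smt (verit) norm_ge_zero)
    qed
    have "(\<integral>t. norm (u j t) \<partial>?M) \<le> (\<integral>t. (1/2)^j + 2^j * (norm (u j t))\<^sup>2 \<partial>?M)"
      by (intro integral_mono i1 Bochner_Integration.integrable_add integrable_const integrable_mult_right i2 pt)
    also have "\<dots> = (1/2)^j * measure ?M (space ?M) + 2^j * (\<integral>t. (norm (u j t))\<^sup>2 \<partial>?M)"
      using i2 by (subst Bochner_Integration.integral_add) auto
    also have "\<dots> \<le> (1/2)^j * measure ?M (space ?M) + 2^j * (1/4)^j"
      using N[OF Nr, of j "r (Suc j)"] strict_mono_less_eq[OF r, of j "Suc j"] unfolding u_def
      by (intro add_left_mono mult_left_mono) auto
    also have "2^j * (1/4)^j = ((1/2)^j :: real)" by (simp flip: power_mult_distrib)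
    finally have "(\<integral>t. norm (u j t) \<partial>?M) \<le> ?c * (1/2)^j" by (simp add: algebra_simps)
    then show ?thesis using nn_integral_eq_integral[OF i1] by (simp add: ennreal_leI)
  qed
  have "(\<integral>\<^sup>+t. (\<Sum>j. ennreal (norm (u j t))) \<partial>?M) = (\<Sum>j. \<integral>\<^sup>+t. ennreal (norm (u j t)) \<partial>?M)"
    using um by (intro nn_integral_suminf) measurable
  also have "\<dots> \<le> (\<Sum>j. ennreal (?c * (1/2)^j))"
    by (intro suminf_le nn summableI)
  also have "\<dots> < \<infinity>"
  proof -
    have "summable (\<lambda>j. ?c * (1/2::real)^j)" by (intro summable_mult summable_geometric) simp
    then have "(\<Sum>j. ennreal (?c * (1/2)^j)) \<noteq> top"
      by (intro ennreal_suminf_neq_top) auto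
    then show ?thesis by (simp add: top.not_eq_extremum)
  qed
  finally have "(\<integral>\<^sup>+t. (\<Sum>j. ennreal (norm (u j t))) \<partial>?M) \<noteq> \<infinity>" by simp
  moreover have "(\<lambda>t. \<Sum>j. ennreal (norm (u j t))) \<in> borel_measurable ?M"
    using um by measurable
  ultimately have "AE t in ?M. (\<Sum>j. ennreal (norm (u j t))) \<noteq> \<infinity>"
    by (intro nn_integral_PInf_AE)
  then have "AE t in ?M. convergent (\<lambda>j. w (r j) t)"
  proof eventually_elim
    case (elim t)
    then have "summable (\<lambda>j. norm (u j t))" by (intro summable_suminf_not_top) auto
    then have "summable (\<lambda>j. u j t)" by (rule summable_norm_cancel)
    then have "convergent (\<lambda>n. \<Sum>j<n. u j t)" by (simp add: summable_iff_convergent)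
    moreover have "(\<Sum>j<n. u j t) = w (r 0) t - w (r n) t" for n
      unfolding u_def by (rule sum_lessThan_telescope')
    ultimately have "convergent (\<lambda>n. w (r 0) t - w (r n) t)" by simp
    from convergent_diff[OF convergent_const[of "w (r 0) t"] this] show ?case by simp
  qed
  with r show ?thesis by (rule that)
qed

text \<open>
  A substitute for weak sequential compactness that directly gives what an inclusion with closed convex
  values needs: the limit lies, almost everywhere, in the closed convex hull of every tail, and it has
  the right primitive.
\<close>

lemma bounded_sequence_weak_limit:
  fixes v :: "nat \<Rightarrow> real \<Rightarrow> 'a::euclidean_space"
  assumes meas: "\<And>n. v n \<in> borel_measurable (lebesgue_on {a..b})"
    and bdd: "\<And>n t. norm (v n t) \<le> L"
  obtains u N where "u \<in> borel_measurable (lebesgue_on {a..b})" "\<And>t. norm (u t) \<le> L"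
    and "negligible N"
    and "\<And>t n. t \<in> {a..b} - N \<Longrightarrow> u t \<in> closure (convex hull {v k t | k. n \<le> k})"
    and "\<And>t l. t \<le> b \<Longrightarrow> (\<lambda>n. integral {a..t} (v n)) \<longlonglongrightarrow> l \<Longrightarrow> integral {a..t} u = l"
proof -
  let ?M = "lebesgue_on {a..b}"
  obtain w where w: "\<And>n. midpoint_combination v n (w n)"
    and C: "\<And>e. 0 < e \<Longrightarrow> \<exists>N. \<forall>n\<ge>N. \<forall>m\<ge>n. (\<integral>t. (norm (w n t - w m t))\<^sup>2 \<partial>?M) \<le> e"
    using L2_Cauchy_midpoints[of v a b L] meas bdd by metis
  note wm = midpoint_combination_measurable[OF w meas] and wb = midpoint_combination_bounded[OF w bdd]
  obtain r :: "nat \<Rightarrow> nat" where r: "strict_mono r" and conv: "AE t in ?M. convergent (\<lambda>j. w (r j) t)"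
    using L2_Cauchy_AE_subsequence[OF wm wb C] by metis
  have "AE t in lebesgue. t \<in> {a..b} \<longrightarrow> convergent (\<lambda>j. w (r j) t)"
    using conv by (simp add: AE_restrict_space_iff)
  then obtain N where N: "negligible N" "\<And>t. t \<in> {a..b} - N \<Longrightarrow> convergent (\<lambda>j. w (r j) t)"
    unfolding eventually_ae_filter_negligible by auto
  define u where "u t = (if convergent (\<lambda>j. w (r j) t) then lim (\<lambda>j. w (r j) t) else 0)" for t
  have um: "u \<in> borel_measurable ?M"
    unfolding u_def
    by (intro measurable_If borel_measurable_lim_metric wm borel_measurable_const)
       (simp only: Cauchy_convergent_iff[symmetric], rule sets_Collect_Cauchy[OF wm])
  have L: "0 \<le> L" using bdd[of 0 0] norm_ge_zero order_trans by blast
  have lim: "(\<lambda>j. w (r j) t) \<longlonglongrightarrow> u t" if "t \<in> {a..b} - N" for t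
    using N(2)[OF that] by (simp add: u_def convergent_LIMSEQ_iff)
  have ub: "norm (u t) \<le> L" for t
  proof (cases "convergent (\<lambda>j. w (r j) t)")
    case True
    then have "(\<lambda>j. w (r j) t) \<longlonglongrightarrow> u t" by (simp add: u_def convergent_LIMSEQ_iff)
    then show ?thesis by (intro LIMSEQ_le_const2[OF tendsto_norm]) (auto intro: wb)
  qed (simp add: u_def L)
  have hull: "u t \<in> closure (convex hull {v k t | k. n \<le> k})" if "t \<in> {a..b} - N" for t n
  proof (rule Lim_in_closed_set[OF closed_closure _ _ lim[OF that]])
    have "w (r j) t \<in> convex hull {v k t | k. n \<le> k}" if "n \<le> j" for j
      using seq_suble[OF r, of j] that
      by (intro midpoint_combination_in_convex[OF w]) (auto intro!: hull_inc exI intro: order_trans)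
    then show "\<forall>\<^sub>F j in sequentially. w (r j) t \<in> closure (convex hull {v k t | k. n \<le> k})"
      unfolding eventually_sequentially using closure_subset by blast
  qed simp
  have int: "integral {a..t} u = l" if t: "t \<le> b" and l: "(\<lambda>n. integral {a..t} (v n)) \<longlonglongrightarrow> l" for t l
  proof -
    have sub: "{a..t} \<subseteq> {a..b}" using t by auto
    let ?w = "\<lambda>j s. if s \<in> N then 0 else w (r j) s" and ?u = "\<lambda>s. if s \<in> N then 0 else u s"
    have wi: "w j integrable_on {a..t}" for j
      using bounded_measurable_abs_integrable[OF wm wb, where s=a and t=t] t set_lebesgue_integral_eq_integral(1) by auto
    have "(\<lambda>j. integral {a..t} (?w j)) \<longlonglongrightarrow> integral {a..t} ?u"
    proof (rule dominated_convergence(2)[where h="\<lambda>_. L"])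
      show "?w j integrable_on {a..t}" for j
        by (rule integrable_spike[OF wi[of "r j"] N(1)]) auto
      show "(\<lambda>j. ?w j s) \<longlonglongrightarrow> ?u s" if "s \<in> {a..t}" for s
        using lim[of s] that sub by auto
    qed (auto simp: L wb)
    moreover have "integral {a..t} (?w j) = integral {a..t} (w (r j))" for j
      by (rule integral_spike[OF N(1)]) auto
    moreover have "integral {a..t} ?u = integral {a..t} u"
      by (rule integral_spike[OF N(1)]) auto
    ultimately have "(\<lambda>j. integral {a..t} (w (r j))) \<longlonglongrightarrow> integral {a..t} u" by simp
    moreover have "(\<lambda>j. integral {a..t} (w (r j))) \<longlonglongrightarrow> l"
    proof (rule LIMSEQ_I)
      fix e :: real assume "0 < e"
      then obtain n where n: "\<And>k. n \<le> k \<Longrightarrow> norm (integral {a..t} (v k) - l) < e"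
        using LIMSEQ_D[OF l] by blast
      have "integral {a..t} (w (r j)) \<in> ball l e" if "n \<le> j" for j
        using n that seq_suble[OF r, of j]
        by (intro midpoint_combination_integral_in_convex[OF w meas bdd t])
           (auto simp: dist_norm norm_minus_commute intro!: n)
      then show "\<exists>n. \<forall>j\<ge>n. norm (integral {a..t} (w (r j)) - l) < e"
        by (auto simp: dist_norm norm_minus_commute)
    qed
    ultimately show ?thesis by (rule LIMSEQ_unique)
  qed
  show ?thesis by (rule that[OF um ub N(1) hull int])
qed

section \<open>Local existence for Filippov inclusions\<close>

lemma norm_integral_le_bound:
  fixes f :: "real \<Rightarrow> 'a::euclidean_space"
  assumes "f absolutely_integrable_on {s..t}" "\<And>x. norm (f x) \<le> L" "s \<le> t"
  shows "norm (integral {s..t} f) \<le> L * (t - s)"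
proof -
  have "norm (integral {s..t} f) \<le> integral {s..t} (\<lambda>x. L)"
    using assms by (intro integral_norm_bound_integral) (auto simp: set_lebesgue_integral_eq_integral(1))
  then show ?thesis using assms(3) by (simp add: mult.commute)
qed

text \<open>
  On each step the velocity is a measurable selection at the state reached at the start of the step;
  this state is the integral at some \<open>\<tau>\<close> with \<open>t - s \<le> \<tau> \<le> t\<close>. The condition \<open>L * (b - a) \<le> \<rho>\<close> keeps
  the polygon in the ball where selections are available.
\<close>

lemma delayed_euler_polygon:
  fixes \<Phi> :: "real \<Rightarrow> 'a::euclidean_space \<Rightarrow> 'a set"
  assumes ab: "a \<le> b" "L * (b - a) \<le> \<rho>" and L: "0 \<le> L"
    and sel: "\<And>x. x \<in> cball x\<^sub>0 \<rho> \<Longrightarrow> \<exists>f N. f \<in> borel_measurable (lebesgue_on {a..b}) \<and>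
        (\<forall>t. norm (f t) \<le> L) \<and> negligible N \<and> (\<forall>t\<in>{a..b} - N. f t \<in> \<Phi> t x)"
    and s: "0 < s"
  shows "a + real n * s \<le> b \<Longrightarrow> \<exists>v N. v \<in> borel_measurable (lebesgue_on {a..b}) \<and>
      (\<forall>t. norm (v t) \<le> L) \<and> negligible N \<and>
      (\<forall>t\<in>{a..a + real n * s} - N. \<exists>\<tau>\<in>{a..t}. t - s \<le> \<tau> \<and> v t \<in> \<Phi> t (x\<^sub>0 + integral {a..\<tau>} v))"
proof (induction n)
  case 0
  have "0 \<le> L * (b - a)" using ab L by simp
  then have "x\<^sub>0 \<in> cball x\<^sub>0 \<rho>" using ab(2) by simp
  from sel[OF this] obtain f :: "real \<Rightarrow> 'a"
    where f: "f \<in> borel_measurable (lebesgue_on {a..b})" "\<forall>t. norm (f t) \<le> L" by blast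
  show ?case
    by (rule exI[of _ f], rule exI[of _ "{a}"]) (use f in auto)
next
  case (Suc n)
  define c where "c = a + real n * s"
  have c: "a \<le> c" "c \<le> b" "a + real (Suc n) * s = c + s" "c + s \<le> b"
    using Suc.prems s by (auto simp: c_def algebra_simps)
  then obtain v N where v: "v \<in> borel_measurable (lebesgue_on {a..b})" "\<And>t. norm (v t) \<le> L"
    and N: "negligible N"
    and vN: "\<And>t. t \<in> {a..c} - N \<Longrightarrow> \<exists>\<tau>\<in>{a..t}. t - s \<le> \<tau> \<and> v t \<in> \<Phi> t (x\<^sub>0 + integral {a..\<tau>} v)"
    using Suc.IH s unfolding c_def by auto
  define x where "x = x\<^sub>0 + integral {a..c} v"
  have "norm (integral {a..c} v) \<le> L * (c - a)"
    by (rule norm_integral_le_bound[OF bounded_measurable_abs_integrable[OF v]]) (use c v in auto)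
  also have "\<dots> \<le> L * (b - a)"
    using c L by (intro mult_left_mono) auto
  finally have "x \<in> cball x\<^sub>0 \<rho>" using ab by (simp add: x_def dist_norm)
  from sel[OF this] obtain f N' where f: "f \<in> borel_measurable (lebesgue_on {a..b})" "\<And>t. norm (f t) \<le> L"
    and N': "negligible N'" and fN: "\<And>t. t \<in> {a..b} - N' \<Longrightarrow> f t \<in> \<Phi> t x" by blast
  define v' where "v' t = (if t \<le> c then v t else f t)" for t
  have int: "integral {a..\<tau>} v' = integral {a..\<tau>} v" if "\<tau> \<le> c" for \<tau>
    using that by (intro integral_cong) (auto simp: v'_def)
  have "v' \<in> borel_measurable (lebesgue_on {a..b})"
  proof -
    have [measurable]: "(\<lambda>t. t) \<in> borel_measurable (lebesgue_on {a..b})"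
      by (intro continuous_imp_measurable_on_sets_lebesgue continuous_on_id) auto
    show ?thesis unfolding v'_def using v(1) f(1) by measurable
  qed
  moreover have "norm (v' t) \<le> L" for t using v(2) f(2) by (simp add: v'_def)
  moreover have "negligible (N \<union> N')" using N N' by simp
  moreover have "\<exists>\<tau>\<in>{a..t}. t - s \<le> \<tau> \<and> v' t \<in> \<Phi> t (x\<^sub>0 + integral {a..\<tau>} v')"
    if t: "t \<in> {a..c + s} - (N \<union> N')" for t
  proof (cases "t \<le> c")
    case True
    then obtain \<tau> where "\<tau> \<in> {a..t}" "t - s \<le> \<tau>" "v t \<in> \<Phi> t (x\<^sub>0 + integral {a..\<tau>} v)"
      using vN[of t] t by auto
    then show ?thesis using True int[of \<tau>] by (intro bexI[of _ \<tau>]) (auto simp: v'_def)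
  next
    case False
    then show ?thesis using t fN[of t] c int[of c]
      by (intro bexI[of _ c]) (auto simp: v'_def x_def)
  qed
  ultimately show ?case unfolding c(3) by blast
qed

text \<open>
  Euler polygons with step tending to \<open>0\<close> are equi-Lipschitz, so a subsequence converges uniformly. At
  almost every \<open>t\<close> their velocities are Filippov velocities at delayed states that converge to the limit
  state. The closed convex hulls defining the regularisation there contain a tail of them, hence also
  the velocity of the limit. Time is a parameter throughout, so measurable selections suffice.
\<close>

theorem filippov_local_existence:
  fixes R :: "real \<Rightarrow> 'a::euclidean_space \<Rightarrow> 'a set"
  assumes ab: "a < b" "L * (b - a) \<le> \<rho>" and L: "0 \<le> L"
    and sel: "\<And>x. x \<in> cball x\<^sub>0 \<rho> \<Longrightarrow> \<exists>f N. f \<in> borel_measurable (lebesgue_on {a..b}) \<and>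
        (\<forall>t. norm (f t) \<le> L) \<and> negligible N \<and> (\<forall>t\<in>{a..b} - N. f t \<in> filippov (R t) x)"
  obtains v N where "v \<in> borel_measurable (lebesgue_on {a..b})" "\<And>t. norm (v t) \<le> L" "negligible N"
    and "\<And>t. t \<in> {a..b} - N \<Longrightarrow> v t \<in> filippov (R t) (x\<^sub>0 + integral {a..t} v)"
proof -
  define s where "s n = (b - a) / real (Suc n)" for n
  have s: "0 < s n" "a + real (Suc n) * s n = b" for n using ab by (auto simp: s_def)
  have "\<forall>n. \<exists>v N. v \<in> borel_measurable (lebesgue_on {a..b}) \<and>
      (\<forall>t. norm (v t) \<le> L) \<and> negligible N \<and>
      (\<forall>t\<in>{a..b} - N. \<exists>\<tau>\<in>{a..t}. t - s n \<le> \<tau> \<and> v t \<in> filippov (R t) (x\<^sub>0 + integral {a..\<tau>} v))"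
    using delayed_euler_polygon[where \<Phi>="\<lambda>t. filippov (R t)" and a=a and b=b and L=L and \<rho>=\<rho> and x\<^sub>0=x\<^sub>0
        and s="s n" and n="Suc n" for n, OF less_imp_le[OF ab(1)] ab(2) L sel s(1)] s(2)
    by (metis (no_types, lifting) order_refl)
  then obtain v N where v: "\<And>n. v n \<in> borel_measurable (lebesgue_on {a..b})" "\<And>n t. norm (v n t) \<le> L"
    and N: "\<And>n. negligible (N n)"
    and vN: "\<And>n t. t \<in> {a..b} - N n \<Longrightarrow>
      \<exists>\<tau>\<in>{a..t}. t - s n \<le> \<tau> \<and> v n t \<in> filippov (R t) (x\<^sub>0 + integral {a..\<tau>} (v n))"
    by metis
  define z where "z n t = x\<^sub>0 + integral {a..t} (v n)" for n t
  have lip: "norm (z n t - z n r) \<le> L * \<bar>t - r\<bar>" if "t \<in> {a..b}" "r \<in> {a..b}" for n t r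
  proof -
    have *: "norm (z n t - z n r) \<le> L * (t - r)" if "a \<le> r" "r \<le> t" "t \<le> b" for t r
    proof -
      have ai: "v n absolutely_integrable_on {u..w}" if "a \<le> u" "w \<le> b" for u w
        using bounded_measurable_abs_integrable[OF v] that by blast
      have "integral {a..r} (v n) + integral {r..t} (v n) = integral {a..t} (v n)"
        using that ai by (intro Henstock_Kurzweil_Integration.integral_combine) (auto simp: set_lebesgue_integral_eq_integral(1))
      then have "z n t - z n r = integral {r..t} (v n)" by (simp add: z_def algebra_simps)
      then show ?thesis
        using norm_integral_le_bound[OF ai[of r t] v(2)] that by simp
    qed
    show ?thesis using *[of r t] *[of t r] that by (cases "r \<le> t") (auto simp: norm_minus_commute abs_if)
  qed
  obtain g k where g: "continuous_on {a..b} g" "strict_mono (k :: nat \<Rightarrow> nat)"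
    and k: "\<And>e. 0 < e \<Longrightarrow> \<exists>N. \<forall>n x. n \<ge> N \<and> x \<in> {a..b} \<longrightarrow> norm (z (k n) x - g x) < e"
  proof (rule Arzela_Ascoli[of "{a..b}" z "norm x\<^sub>0 + L * (b - a)"])
    show "norm (z n x) \<le> norm x\<^sub>0 + L * (b - a)" if "x \<in> {a..b}" for n x
    proof -
      have "norm (z n x) \<le> norm (z n a) + norm (z n x - z n a)" by norm
      moreover have "L * \<bar>x - a\<bar> \<le> L * (b - a)" using that L by (intro mult_left_mono) auto
      ultimately show ?thesis using lip[of x a n] that ab by (simp add: z_def)
    qed
    show "\<exists>d>0. \<forall>n y. y \<in> {a..b} \<and> norm (x - y) < d \<longrightarrow> norm (z n x - z n y) < e"
      if x: "x \<in> {a..b}" "0 < e" for x e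
    proof (intro exI[of _ "e / (L + 1)"] conjI allI impI)
      show "0 < e / (L + 1)" using x L by simp
      fix n y assume y: "y \<in> {a..b} \<and> norm (x - y) < e / (L + 1)"
      then have "norm (z n x - z n y) \<le> L * \<bar>x - y\<bar>" using lip x by simp
      also have "\<dots> \<le> (L + 1) * \<bar>x - y\<bar>" by (simp add: mult_right_mono)
      also have "\<dots> < e" using y L by (simp add: pos_less_divide_eq mult.commute)
      finally show "norm (z n x - z n y) < e" .
    qed
  qed auto
  have vk: "\<And>n. v (k n) \<in> borel_measurable (lebesgue_on {a..b})" "\<And>n t. norm (v (k n) t) \<le> L" using v by auto
  obtain u N' where u: "u \<in> borel_measurable (lebesgue_on {a..b})" "\<And>t. norm (u t) \<le> L" "negligible N'"
    and hull: "\<And>t n. t \<in> {a..b} - N' \<Longrightarrow> u t \<in> closure (convex hull {v (k j) t | j. n \<le> j})"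
    and int: "\<And>t l. t \<le> b \<Longrightarrow> (\<lambda>n. integral {a..t} (v (k n))) \<longlonglongrightarrow> l \<Longrightarrow> integral {a..t} u = l"
  proof (rule bounded_sequence_weak_limit[where v="\<lambda>n. v (k n)", OF vk], goal_cases)
    case (1 u N')
    show ?case by (rule 1(1)[of u N']) (fact 1)+
  qed
  have ulim: "x\<^sub>0 + integral {a..t} u = g t" if "t \<in> {a..b}" for t
  proof -
    have "(\<lambda>n. z (k n) t) \<longlonglongrightarrow> g t"
      by (rule LIMSEQ_I) (use k that in blast)
    then have "(\<lambda>n. z (k n) t - x\<^sub>0) \<longlonglongrightarrow> g t - x\<^sub>0" by (intro tendsto_intros)
    then have "integral {a..t} u = g t - x\<^sub>0"
      using that by (intro int) (auto simp: z_def)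
    then show ?thesis by simp
  qed
  have "negligible (N' \<union> (\<Union>n. N n))" using u(3) N by (intro negligible_Un negligible_countable_Union) auto
  moreover have "u t \<in> filippov (R t) (x\<^sub>0 + integral {a..t} u)" if t: "t \<in> {a..b} - (N' \<union> (\<Union>n. N n))" for t
  proof (rule filippov_memI)
    fix \<delta> :: real and Z :: "'a set" assume dZ: "0 < \<delta>" "negligible Z"
    have tab: "t \<in> {a..b}" using t by blast
    obtain n1 where n1: "\<And>n x. n1 \<le> n \<Longrightarrow> x \<in> {a..b} \<Longrightarrow> norm (z (k n) x - g x) < \<delta>/2"
      using k[of "\<delta>/2"] dZ by auto
    obtain n2 :: nat where n2: "L * (b - a) / real (Suc n2) < \<delta>/2"
    proof -
      have "(\<lambda>n. L * (b - a) / real (Suc n)) \<longlonglongrightarrow> 0" by (rule LIMSEQ_Suc[OF lim_const_over_n])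
      from order_tendstoD(2)[OF this, of "\<delta>/2"] dZ that show ?thesis
        by (auto simp: eventually_sequentially)
    qed
    let ?n = "max n1 n2"
    have "v (k j) t \<in> ess_hull (R t) (x\<^sub>0 + integral {a..t} u) \<delta> Z" if j: "?n \<le> j" for j
    proof -
      obtain \<tau> where \<tau>: "\<tau> \<in> {a..t}" "t - s (k j) \<le> \<tau>" "v (k j) t \<in> filippov (R t) (z (k j) \<tau>)"
        using vN[of t "k j"] t unfolding z_def by blast
      have "norm (z (k j) t - z (k j) \<tau>) \<le> L * \<bar>t - \<tau>\<bar>" using \<tau>(1) tab by (intro lip) auto
      also have "\<dots> \<le> L * s (k j)" using \<tau> L by (intro mult_left_mono) auto
      also have "\<dots> \<le> L * (b - a) / real (Suc n2)"
      proof -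
        have "n2 \<le> k j" using j seq_suble[OF g(2), of j] by simp
        then have "s (k j) \<le> (b - a) / real (Suc n2)" unfolding s_def using ab by (intro divide_left_mono) auto
        from mult_left_mono[OF this L] show ?thesis by simp
      qed
      finally have "norm (z (k j) t - z (k j) \<tau>) < \<delta>/2" using n2 by (rule order_le_less_trans)
      moreover have "norm (z (k j) t - g t) < \<delta>/2" using n1[OF _ tab] j by simp
      ultimately have "dist (g t) (z (k j) \<tau>) < \<delta>" unfolding dist_norm by norm
      then show ?thesis
        using filippov_nearby_subset_hull[OF _ dZ(2), of "z (k j) \<tau>" "g t" \<delta> "R t"] \<tau>(3) ulim[OF tab] by auto
    qed
    then have "closure (convex hull {v (k j) t | j. ?n \<le> j}) \<subseteq> ess_hull (R t) (x\<^sub>0 + integral {a..t} u) \<delta> Z"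
      by (intro closure_minimal hull_minimal convex_closure convex_convex_hull closed_closure) blast
    then show "u t \<in> ess_hull (R t) (x\<^sub>0 + integral {a..t} u) \<delta> Z" using hull[of t ?n] t by blast
  qed
  ultimately show ?thesis using that[OF u(1,2)] by blast
qed

section \<open>Integrated chain rule\<close>

lemma integral_mono_negligible:
  fixes f h :: "real \<Rightarrow> real"
  assumes "f integrable_on S" "h integrable_on S" "negligible N" "\<And>t. t \<in> S - N \<Longrightarrow> f t \<le> h t"
  shows "integral S f \<le> integral S h"
proof -
  let ?f = "\<lambda>t. if t \<in> N then h t else f t"
  have "?f integrable_on S" by (rule integrable_spike[OF assms(1,3)]) auto
  moreover have "integral S ?f = integral S f" by (rule integral_spike[OF assms(3)]) auto
  moreover have "?f t \<le> h t" if "t \<in> S" for t using that assms(4) by auto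
  ultimately show ?thesis using integral_le[of ?f S h] assms(2) by simp
qed

text \<open>
  On a short interval the mean value theorem writes the increment of \<open>W\<close> as \<open>G \<xi> \<bullet> \<integral> v = \<integral> G \<xi> \<bullet> v\<close>, and
  continuity of \<open>G\<close> replaces \<open>\<xi>\<close> by \<open>z \<tau>\<close> at the cost of \<open>\<epsilon> |v|\<close>. The estimate adds up over adjacent
  intervals, so bisection makes it global. Only \<open>\<beta>\<close> is integrated, hence the integrand
  \<open>G (z t) \<bullet> v t\<close> may be compared pointwise.
\<close>

lemma integral_curve_comparison:
  fixes W :: "'a::euclidean_space \<Rightarrow> real" and G :: "'a \<Rightarrow> 'a" and v z :: "real \<Rightarrow> 'a"
    and \<beta> :: "real \<Rightarrow> real"
  assumes ab: "a \<le> b" and v: "v absolutely_integrable_on {a..b}"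
    and z: "\<And>t. t \<in> {a..b} \<Longrightarrow> z t = z a + integral {a..t} v"
    and S: "open S" "\<And>t. t \<in> {a..b} \<Longrightarrow> z t \<in> S"
    and W: "\<And>x. x \<in> S \<Longrightarrow> (W has_derivative (\<lambda>h. G x \<bullet> h)) (at x)"
    and G: "continuous_on S G"
    and \<beta>: "\<beta> integrable_on {a..b}" and N: "negligible N"
    and le: "\<And>t. t \<in> {a..b} - N \<Longrightarrow> G (z t) \<bullet> v t \<le> \<beta> t"
  shows "W (z b) - W (z a) \<le> integral {a..b} \<beta>"
proof -
  have vi: "v integrable_on {s..t}" and nvi: "(\<lambda>t. norm (v t)) integrable_on {s..t}" and \<beta>i: "\<beta> integrable_on {s..t}"
    if "a \<le> s" "t \<le> b" for s t
  proof -
    have "v absolutely_integrable_on {s..t}"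
      by (rule absolutely_integrable_on_subinterval[OF v]) (use that in auto)
    then show "v integrable_on {s..t}" "(\<lambda>t. norm (v t)) integrable_on {s..t}"
      by (auto simp: absolutely_integrable_on_def)
    show "\<beta> integrable_on {s..t}"
      by (rule integrable_on_subinterval[OF \<beta>]) (use that in auto)
  qed
  have incr: "z t - z s = integral {s..t} v" if "a \<le> s" "s \<le> t" "t \<le> b" for s t
    using Henstock_Kurzweil_Integration.integral_combine[OF that(1,2) vi[of a t]] z[of s] z[of t] that by (simp add: diff_eq_eq add.commute)
  have cont: "continuous_on {a..b} z"
  proof -
    have "continuous_on {a..b} (\<lambda>t. z a + integral {a..t} v)"
      using vi[of a b] by (intro continuous_intros indefinite_integral_continuous_1) auto
    then show ?thesis by (rule continuous_on_eq) (metis z)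
  qed
  have main: "W (z b) - W (z a) \<le> integral {a..b} (\<lambda>t. \<beta> t + \<epsilon> * norm (v t))" if \<epsilon>: "0 < \<epsilon>" for \<epsilon>
  proof -
    let ?f = "\<lambda>t. \<beta> t + \<epsilon> * norm (v t)"
    have fi: "?f integrable_on {s..t}" if "a \<le> s" "t \<le> b" for s t
      using nvi[OF that] \<beta>i[OF that] by (intro integrable_add integrable_on_mult_right)
    define P where "P s t \<longleftrightarrow> (a \<le> s \<and> t \<le> b \<longrightarrow> W (z t) - W (z s) \<le> integral {s..t} ?f)" for s t
    have "P a b"
      using ab
    proof (induction rule: Bolzano)
      case (trans s m t)
      then show ?case
        unfolding P_def using Henstock_Kurzweil_Integration.integral_combine[OF trans(3,4) fi[of s t]] by auto
    next
      case (local x)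
      have zx: "z x \<in> S" using S(2) local by simp
      have "continuous (at (z x)) G" using G S(1) zx by (simp add: continuous_on_eq_continuous_at)
      then obtain r1 where r1: "0 < r1" "\<And>y. dist y (z x) < r1 \<Longrightarrow> dist (G y) (G (z x)) < \<epsilon>/2"
        using \<epsilon> unfolding continuous_at_eps_delta by (metis half_gt_zero)
      obtain r2 where r2: "0 < r2" "ball (z x) r2 \<subseteq> S" using S(1) zx openE by blast
      define r where "r = min r1 r2"
      have r: "0 < r" "\<And>y. y \<in> ball (z x) r \<Longrightarrow> y \<in> S \<and> norm (G y - G (z x)) < \<epsilon>/2"
        using r1 r2 by (auto simp: r_def dist_norm norm_minus_commute)
      obtain d where d: "0 < d" "\<And>t. t \<in> {a..b} \<Longrightarrow> dist t x < d \<Longrightarrow> z t \<in> ball (z x) r"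
        using cont[unfolded continuous_on_iff] r(1) local by (metis atLeastAtMost_iff dist_commute mem_ball)
      have "P s t" if st: "s \<le> x \<and> x \<le> t \<and> t - s < d" for s t
        unfolding P_def
      proof
        assume "a \<le> s \<and> t \<le> b"
        then have in_ball: "z \<tau> \<in> ball (z x) r" if "\<tau> \<in> {s..t}" for \<tau>
          using d(2)[of \<tau>] st that by (auto simp: dist_real_def)
        let ?p = "\<lambda>\<theta>. z s + \<theta> *\<^sub>R (z t - z s)"
        have p: "?p \<theta> \<in> ball (z x) r" if "\<theta> \<in> {0..1}" for \<theta>
        proof -
          have "(1 - \<theta>) *\<^sub>R z s + \<theta> *\<^sub>R z t \<in> ball (z x) r"
            using that st in_ball[of s] in_ball[of t] by (intro convexD[OF convex_ball]) auto
          then show ?thesis by (simp add: algebra_simps)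
        qed
        have "((\<lambda>\<theta>. W (?p \<theta>)) has_derivative (\<lambda>h. G (?p \<theta>) \<bullet> (h *\<^sub>R (z t - z s)))) (at \<theta> within {0..1})"
          if "\<theta> \<in> {0..1}" for \<theta>
          by (rule has_derivative_compose[of ?p])
            (use that p r(2) W in \<open>auto intro!: derivative_eq_intros\<close>)
        then obtain \<theta> where \<theta>: "\<theta> \<in> {0<..<1}" "W (?p 1) - W (?p 0) = G (?p \<theta>) \<bullet> ((1 - 0) *\<^sub>R (z t - z s))"
          using mvt_simple[of 0 1 "\<lambda>\<theta>. W (?p \<theta>)" "\<lambda>\<theta> h. G (?p \<theta>) \<bullet> (h *\<^sub>R (z t - z s))"] by auto
        define \<xi> where "\<xi> = ?p \<theta>"
        have \<xi>: "\<xi> \<in> ball (z x) r" using p \<theta>(1) by (simp add: \<xi>_def)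
        have "W (z t) - W (z s) = \<xi>' \<bullet> (z t - z s)" if "\<xi>' = G \<xi>" for \<xi>'
          using \<theta>(2) that by (simp add: \<xi>_def)
        then have "W (z t) - W (z s) = G \<xi> \<bullet> integral {s..t} v"
          using incr[of s t] \<open>a \<le> s \<and> t \<le> b\<close> st by simp
        also have "\<dots> = integral {s..t} (\<lambda>\<tau>. G \<xi> \<bullet> v \<tau>)"
          using integral_linear[OF vi[of s t] bounded_linear_inner_right[of "G \<xi>"]] \<open>a \<le> s \<and> t \<le> b\<close>
          by (simp add: o_def)
        also have "\<dots> \<le> integral {s..t} ?f"
        proof (rule integral_mono_negligible[OF _ fi N])
          show "(\<lambda>\<tau>. G \<xi> \<bullet> v \<tau>) integrable_on {s..t}"
            using integrable_linear[OF vi[of s t] bounded_linear_inner_right[of "G \<xi>"]] \<open>a \<le> s \<and> t \<le> b\<close>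
            by (simp add: o_def)
          fix \<tau> assume \<tau>: "\<tau> \<in> {s..t} - N"
          have "norm (G \<xi> - G (z \<tau>)) \<le> norm (G \<xi> - G (z x)) + norm (G (z \<tau>) - G (z x))" by norm
          then have "norm (G \<xi> - G (z \<tau>)) \<le> \<epsilon>"
            using r(2)[OF \<xi>] r(2)[OF in_ball, of \<tau>] \<tau> by simp
          then have "(G \<xi> - G (z \<tau>)) \<bullet> v \<tau> \<le> \<epsilon> * norm (v \<tau>)"
            by (meson mult_right_mono norm_cauchy_schwarz norm_ge_zero order_trans)
          moreover have "G (z \<tau>) \<bullet> v \<tau> \<le> \<beta> \<tau>" using \<tau> \<open>a \<le> s \<and> t \<le> b\<close> by (intro le) auto
          ultimately show "G \<xi> \<bullet> v \<tau> \<le> ?f \<tau>" by (simp add: inner_diff_left)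
        qed (use \<open>a \<le> s \<and> t \<le> b\<close> in auto)
        finally show "W (z t) - W (z s) \<le> integral {s..t} ?f" .
      qed
      then show ?case using d(1) by blast
    qed
    then show ?thesis by (simp add: P_def)
  qed
  let ?I = "integral {a..b} (\<lambda>t. norm (v t))"
  have I: "0 \<le> ?I" using nvi by (intro integral_nonneg) auto
  show ?thesis
  proof (rule field_le_epsilon)
    fix e :: real assume e: "0 < e"
    define \<epsilon> where "\<epsilon> = e / (?I + 1)"
    have \<epsilon>: "0 < \<epsilon>" "\<epsilon> * ?I \<le> e" using e I by (auto simp: \<epsilon>_def field_simps)
    have "W (z b) - W (z a) \<le> integral {a..b} \<beta> + \<epsilon> * ?I"
      using main[OF \<epsilon>(1)] \<beta> nvi[of a b] by (simp add: Henstock_Kurzweil_Integration.integral_add integrable_on_mult_right)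
    then show "W (z b) - W (z a) \<le> integral {a..b} \<beta> + e" using \<epsilon>(2) by simp
  qed
qed

section \<open>The integrator chain and its dilations\<close>

lemma pos_bounds: "1 \<le> pos (i::'n::{finite,linorder})" "pos i \<le> CARD('n)"
proof -
  have "card {i} \<le> pos i" unfolding pos_def by (intro card_mono) auto
  then show "1 \<le> pos i" by simp
  show "pos i \<le> CARD('n)" unfolding pos_def by (intro card_mono) auto
qed

lemma weight_pos:
  fixes i :: "'n::{finite,linorder}"
  assumes "\<kappa> < 0" "0 \<le> p + (real CARD('n) + 1) * \<kappa>"
  shows "0 < weight p \<kappa> (pos i)" and "0 < weight p \<kappa> CARD('n)"
proof -
  have *: "0 < weight p \<kappa> j" if "j \<le> CARD('n)" for j
  proof -
    have "(real CARD('n) + 1) * \<kappa> < (real j - 1) * \<kappa>"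
      using that assms(1) by (intro mult_strict_right_mono_neg) auto
    then show ?thesis using assms(2) by (simp add: weight_def)
  qed
  show "0 < weight p \<kappa> (pos i)" "0 < weight p \<kappa> CARD('n)" using * pos_bounds by auto
qed

lemma linear_dilation: "linear (dilation p \<kappa> \<rho> :: real^'n::{finite,linorder} \<Rightarrow> _)"
  by (rule linearI) (auto simp: dilation_def vec_eq_iff algebra_simps)

lemma bounded_linear_dilation: "bounded_linear (dilation p \<kappa> \<rho> :: real^'n::{finite,linorder} \<Rightarrow> _)"
  using linear_dilation linear_conv_bounded_linear by blast

lemma dilation_dilation:
  "0 < \<rho> \<Longrightarrow> 0 < \<sigma> \<Longrightarrow> dilation p \<kappa> \<rho> (dilation p \<kappa> \<sigma> z) = dilation p \<kappa> (\<rho> * \<sigma>) z"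
  by (simp add: dilation_def vec_eq_iff powr_mult)

lemma dilation_one [simp]: "dilation p \<kappa> 1 z = z"
  by (simp add: dilation_def vec_eq_iff)

lemma dilation_inverse: "0 < \<rho> \<Longrightarrow> dilation p \<kappa> (1 / \<rho>) (dilation p \<kappa> \<rho> z) = z"
  by (simp add: dilation_dilation)

lemma dilation_e_last:
  "dilation p \<kappa> \<rho> (e_last :: real^'n::{finite,linorder}) = \<rho> powr weight p \<kappa> CARD('n) *\<^sub>R e_last"
  by (simp add: dilation_def e_last_def vec_eq_iff)

lemma dilation_eq_0_iff: "0 < \<rho> \<Longrightarrow> dilation p \<kappa> \<rho> z = 0 \<longleftrightarrow> z = 0"
  by (auto simp: dilation_def vec_eq_iff)

lemma chain_field_linear: "bounded_linear (\<lambda>z. shift_matrix *v (z :: real^'n::{finite,linorder}))"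
  by (simp add: linear_conv_bounded_linear[symmetric])

lemma chain_field_add: "chain_field (w + w') z = chain_field w z + w' *\<^sub>R e_last"
  by (simp add: chain_field_def algebra_simps)

lemma norm_chain_field_le:
  obtains C where "0 < C" "\<And>w (z :: real^'n::{finite,linorder}). norm (chain_field w z) \<le> C * (norm z + \<bar>w\<bar>)"
proof -
  obtain B where B: "0 < B" "\<And>z :: real^'n::{finite,linorder}. norm (shift_matrix *v z) \<le> norm z * B"
    using bounded_linear.pos_bounded[OF chain_field_linear] by blast
  let ?C = "max B (norm (e_last :: real^'n::{finite,linorder}))"
  have "norm (chain_field w z) \<le> ?C * (norm z + \<bar>w\<bar>)" for w and z :: "real^'n::{finite,linorder}"
  proof -
    have "norm (chain_field w z) \<le> norm z * B + \<bar>w\<bar> * norm (e_last :: real^'n::{finite,linorder})"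
      unfolding chain_field_def using norm_triangle_ineq[of "shift_matrix *v z" "w *\<^sub>R e_last"] B(2)[of z] by simp
    also have "\<dots> \<le> norm z * ?C + \<bar>w\<bar> * ?C" by (intro add_mono mult_left_mono) auto
    finally show ?thesis by (simp add: algebra_simps)
  qed
  then show ?thesis using B(1) by (intro that[of ?C]) (auto simp: less_max_iff_disj)
qed

section \<open>Homogeneous Lyapunov functions\<close>

locale homogeneous_lyapunov =
  fixes V :: "real^'n::{finite,linorder} \<Rightarrow> real" and p \<kappa> d :: real
  assumes weights: "\<kappa> < 0" "0 \<le> p + (real CARD('n) + 1) * \<kappa>"
    and V_cont: "continuous_on UNIV V" and V_0: "V 0 = 0" and V_pos: "z \<noteq> 0 \<Longrightarrow> 0 < V z"
    and V_diff: "z \<noteq> 0 \<Longrightarrow> V differentiable (at z)"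
    and V_C1: "continuous_on (- {0}) (\<lambda>z. frechet_derivative V (at z) h)"
    and d_pos: "0 < d" and V_hom: "homogeneous_fun p \<kappa> d V"
begin

definition grad :: "real^'n::{finite,linorder} \<Rightarrow> real^'n::{finite,linorder}"
  where "grad z = (\<Sum>b\<in>Basis. frechet_derivative V (at z) b *\<^sub>R b)"

lemma V_dilation: "0 < \<rho> \<Longrightarrow> V (dilation p \<kappa> \<rho> z) = \<rho> powr d * V z"
  using V_hom by (simp add: homogeneous_fun_def)

lemma V_nonneg: "0 \<le> V z" using V_pos[of z] V_0 by (cases "z = 0") auto

lemma V_isCont: "isCont V z" using V_cont by (simp add: continuous_on_eq_continuous_at)

lemma frechet_derivative_V: "z \<noteq> 0 \<Longrightarrow> frechet_derivative V (at z) h = grad z \<bullet> h"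
proof -
  assume "z \<noteq> 0"
  then have lin: "linear (frechet_derivative V (at z))"
    using V_diff by (simp add: linear_frechet_derivative)
  have "frechet_derivative V (at z) h = frechet_derivative V (at z) (\<Sum>b\<in>Basis. (h \<bullet> b) *\<^sub>R b)"
    by (simp add: euclidean_representation)
  also have "\<dots> = (\<Sum>b\<in>Basis. (h \<bullet> b) * frechet_derivative V (at z) b)"
    using lin by (simp add: linear_sum linear_scale)
  also have "\<dots> = grad z \<bullet> h" unfolding grad_def inner_sum_left by (simp add: mult.commute inner_commute)
  finally show ?thesis .
qed

lemma V_has_derivative: "z \<noteq> 0 \<Longrightarrow> (V has_derivative (\<lambda>h. grad z \<bullet> h)) (at z)"
proof -
  assume "z \<noteq> 0"
  moreover from this have "frechet_derivative V (at z) = (\<lambda>h. grad z \<bullet> h)"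
    using frechet_derivative_V by blast
  ultimately show ?thesis using V_diff[of z] frechet_derivative_works[of V "at z"] by simp
qed

lemma grad_continuous: "continuous_on (- {0}) grad"
  unfolding grad_def by (intro continuous_intros V_C1)

text \<open>
  A point outside the unit ball is contracted by some \<open>dilation p \<kappa> \<rho>\<close> with \<open>\<rho> \<le> 1\<close> to a point of the unit
  sphere, where \<open>V\<close> has a positive minimum; the dilation does not increase \<open>V\<close>.
\<close>

lemma V_outside_unit_ball:
  obtains \<mu> where "0 < \<mu>" "\<And>z. 1 \<le> norm z \<Longrightarrow> \<mu> \<le> V z"
proof -
  have "sphere (0::real^'n::{finite,linorder}) 1 \<noteq> {}" by simp
  then obtain y where y: "y \<in> sphere 0 1" "\<And>x. x \<in> sphere 0 1 \<Longrightarrow> V y \<le> V x"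
    using continuous_attains_inf[of "sphere 0 1" V] continuous_on_subset[OF V_cont] by auto
  have "y \<noteq> 0" using y(1) by auto
  have "V y \<le> V z" if z: "1 \<le> norm z" for z
  proof -
    let ?f = "\<lambda>\<rho>. norm (dilation p \<kappa> \<rho> z)"
    have "continuous_on {0..1} ?f"
      unfolding dilation_def
      by (intro continuous_intros continuous_on_powr') (use weight_pos[OF weights] in auto)
    moreover have "?f 0 \<le> 1" "1 \<le> ?f 1" using z by (simp_all add: dilation_def zero_vec_def[symmetric])
    ultimately obtain \<rho> where \<rho>: "0 \<le> \<rho>" "\<rho> \<le> 1" "?f \<rho> = 1"
      using IVT'[of ?f 0 1 1] by auto
    then have "\<rho> \<noteq> 0" by (auto simp: dilation_def zero_vec_def[symmetric])
    then have \<rho>0: "0 < \<rho>" using \<rho> by simp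
    have "V y \<le> V (dilation p \<kappa> \<rho> z)" using y(2) \<rho>(3) by simp
    also have "\<dots> = \<rho> powr d * V z" by (rule V_dilation[OF \<rho>0])
    also have "\<dots> \<le> 1 * V z" using \<rho> d_pos \<rho>0 V_nonneg by (intro mult_right_mono) (auto simp: powr_le1)
    finally show ?thesis by simp
  qed
  then show ?thesis using that V_pos[OF \<open>y \<noteq> 0\<close>] by blast
qed

text \<open>
  A dilation with small \<open>\<rho>\<close> pushes the sublevel set below the minimum of \<open>V\<close> outside the unit ball, hence
  into the ball.
\<close>

lemma compact_sublevel: "compact {z. V z \<le> K}"
proof -
  obtain \<mu> where \<mu>: "0 < \<mu>" "\<And>z. 1 \<le> norm z \<Longrightarrow> \<mu> \<le> V z" using V_outside_unit_ball by blast
  define \<rho> where "\<rho> = (\<mu> / (2 * (\<bar>K\<bar> + 1))) powr (1 / d)"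
  have \<rho>: "0 < \<rho>" "\<rho> powr d = \<mu> / (2 * (\<bar>K\<bar> + 1))"
    using \<mu>(1) d_pos by (auto simp: \<rho>_def powr_powr)
  have "{z. V z \<le> K} \<subseteq> dilation p \<kappa> (1 / \<rho>) ` cball 0 1"
  proof
    fix z assume "z \<in> {z. V z \<le> K}"
    then have "\<rho> powr d * V z \<le> \<rho> powr d * (\<bar>K\<bar> + 1)" by (intro mult_left_mono) auto
    also have "\<dots> = \<mu> / 2" unfolding \<rho>(2) by (simp add: field_simps)
    also have "\<dots> < \<mu>" using \<mu>(1) by simp
    finally have "V (dilation p \<kappa> \<rho> z) < \<mu>" using V_dilation[OF \<rho>(1)] by simp
    then have "dilation p \<kappa> \<rho> z \<in> cball 0 1" using \<mu>(2)[of "dilation p \<kappa> \<rho> z"] by (simp, linarith)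
    from imageI[OF this, of "dilation p \<kappa> (1 / \<rho>)"]
    show "z \<in> dilation p \<kappa> (1 / \<rho>) ` cball 0 1" unfolding dilation_inverse[OF \<rho>(1)] .
  qed
  moreover have "bounded (dilation p \<kappa> (1 / \<rho>) ` cball (0::real^'n::{finite,linorder}) 1)"
    by (intro bounded_linear_image bounded_cball bounded_linear_dilation)
  ultimately have "bounded {z. V z \<le> K}" by (rule bounded_subset[rotated])
  moreover have "closed {z. V z \<le> K}" using V_cont by (intro closed_Collect_le continuous_intros)
  ultimately show ?thesis by (simp add: compact_eq_bounded_closed)
qed

text \<open>
  Differentiate \<open>V (dilation p \<kappa> \<rho> z) = \<rho> powr d * V z\<close> in the last coordinate direction, an eigenvector
  of the dilation.
\<close>

lemma grad_e_last_dilation: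
  assumes "z \<noteq> 0" "0 < \<rho>"
  shows "\<rho> powr weight p \<kappa> CARD('n) * (grad (dilation p \<kappa> \<rho> z) \<bullet> e_last) = \<rho> powr d * (grad z \<bullet> e_last)"
proof -
  let ?D = "dilation p \<kappa> \<rho> :: real^'n::{finite,linorder} \<Rightarrow> _"
  have "?D z \<noteq> 0" using assms dilation_eq_0_iff by blast
  have "(?D has_derivative ?D) (at z)"
    by (rule bounded_linear_imp_has_derivative[OF bounded_linear_dilation])
  from has_derivative_compose[OF this V_has_derivative[OF \<open>?D z \<noteq> 0\<close>]]
  have 1: "((\<lambda>z. V (?D z)) has_derivative (\<lambda>h. grad (?D z) \<bullet> ?D h)) (at z)" .
  have 2: "((\<lambda>z. V (?D z)) has_derivative (\<lambda>h. \<rho> powr d * (grad z \<bullet> h))) (at z)"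
    unfolding V_dilation[OF assms(2)] by (intro has_derivative_mult_right V_has_derivative assms)
  from has_derivative_unique[OF 1 2]
  have "grad (?D z) \<bullet> ?D e_last = \<rho> powr d * (grad z \<bullet> e_last)" by (rule fun_cong)
  then show ?thesis by (simp add: dilation_e_last)
qed

text \<open>
  By homogeneity the quotient of \<open>\<partial>V/\<partial>z\<^sub>r\<close> and \<open>V\<close> at \<open>z\<close> is its value on the compact set \<open>V = 1\<close>
  times \<open>V z powr (- weight / d)\<close>, a negative power of \<open>V z\<close>. This linear bound is what rules out a blow-up
  in finite time.
\<close>

lemma grad_e_last_le:
  assumes "0 < v\<^sub>0"
  obtains C where "0 \<le> C" "\<And>z. v\<^sub>0 \<le> V z \<Longrightarrow> \<bar>grad z \<bullet> e_last\<bar> \<le> C * V z"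
proof -
  let ?S = "{z. V z = 1}" and ?w = "weight p \<kappa> CARD('n)"
  have "closed ?S" using V_cont by (intro closed_Collect_eq continuous_intros)
  moreover have "?S = ?S \<inter> {z. V z \<le> 1}" by auto
  ultimately have "compact ?S" using closed_Int_compact[OF _ compact_sublevel] by metis
  moreover have "continuous_on ?S (\<lambda>z. grad z \<bullet> e_last)"
    by (intro continuous_intros continuous_on_subset[OF grad_continuous]) (use V_0 in auto)
  ultimately have "bounded ((\<lambda>z. grad z \<bullet> e_last) ` ?S)"
    by (intro compact_imp_bounded compact_continuous_image)
  then obtain C where C: "0 < C" "\<And>z. V z = 1 \<Longrightarrow> \<bar>grad z \<bullet> e_last\<bar> \<le> C"
    unfolding bounded_pos by auto
  let ?C = "C * v\<^sub>0 powr (- ?w / d)"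
  have "\<bar>grad z \<bullet> e_last\<bar> \<le> ?C * V z" if z: "v\<^sub>0 \<le> V z" for z
  proof -
    define \<rho> where "\<rho> = V z powr (- 1 / d)"
    have Vz: "0 < V z" using z assms by simp
    then have z0: "z \<noteq> 0" using V_0 by auto
    have "\<rho> powr d = V z powr (- 1)" using d_pos by (simp add: \<rho>_def powr_powr)
    moreover have "\<rho> powr ?w = V z powr (- ?w / d)" by (simp add: \<rho>_def powr_powr)
    ultimately have \<rho>: "0 < \<rho>" "\<rho> powr d = 1 / V z" "\<rho> powr ?w = V z powr (- ?w / d)"
      using Vz by (simp_all add: \<rho>_def powr_minus_divide)
    have "V (dilation p \<kappa> \<rho> z) = 1" using V_dilation[OF \<rho>(1)] \<rho>(2) Vz by simp
    then have "\<rho> powr ?w * \<bar>grad (dilation p \<kappa> \<rho> z) \<bullet> e_last\<bar> \<le> \<rho> powr ?w * C"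
      by (intro mult_left_mono C(2)) auto
    also have "\<rho> powr ?w \<le> v\<^sub>0 powr (- ?w / d)"
      unfolding \<rho>(3) using z assms weight_pos(2)[OF weights] d_pos
      by (intro powr_mono2') auto
    finally have "\<rho> powr ?w * \<bar>grad (dilation p \<kappa> \<rho> z) \<bullet> e_last\<bar> \<le> ?C" using C(1) by (simp add: mult.commute)
    moreover have "\<rho> powr ?w * \<bar>grad (dilation p \<kappa> \<rho> z) \<bullet> e_last\<bar> = \<bar>\<rho> powr ?w * (grad (dilation p \<kappa> \<rho> z) \<bullet> e_last)\<bar>"
      by (simp add: abs_mult)
    moreover have "\<dots> = \<bar>grad z \<bullet> e_last\<bar> / V z"
      unfolding grad_e_last_dilation[OF z0 \<rho>(1)] \<rho>(2) using Vz by (simp add: abs_mult)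
    ultimately show ?thesis using Vz by (simp add: field_simps)
  qed
  then show ?thesis using that[of ?C] C(1) by simp
qed

end

lemma locally_ess_boundedE:
  fixes u\<^sub>0 :: "'a::euclidean_space \<Rightarrow> real"
  assumes "locally_ess_bounded u\<^sub>0"
  obtains \<delta> B N where "0 < \<delta>" "0 \<le> B" "negligible N" "\<And>y. y \<in> ball x \<delta> - N \<Longrightarrow> \<bar>u\<^sub>0 y\<bar> \<le> B"
proof -
  obtain \<delta> B where d: "0 < \<delta>" and "AE y in lebesgue. y \<in> ball x \<delta> \<longrightarrow> \<bar>u\<^sub>0 y\<bar> \<le> B"
    using assms unfolding locally_ess_bounded_def by blast
  then obtain N where N: "negligible N" "{y. \<not> (y \<in> ball x \<delta> \<longrightarrow> \<bar>u\<^sub>0 y\<bar> \<le> B)} \<subseteq> N"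
    unfolding eventually_ae_filter_negligible by blast
  have "\<bar>u\<^sub>0 y\<bar> \<le> \<bar>B\<bar>" if "y \<in> ball x \<delta> - N" for y
    using N(2) that by (intro order_trans[OF _ abs_ge_self]) blast
  then show ?thesis using d N(1) by (intro that[of \<delta> "\<bar>B\<bar>" N]) auto
qed

lemma ess_bounded_on_compact:
  fixes u\<^sub>0 :: "'a::euclidean_space \<Rightarrow> real"
  assumes u: "locally_ess_bounded u\<^sub>0" and K: "compact K"
  obtains B where "0 \<le> B"
    "\<And>x. x \<in> K \<Longrightarrow> \<exists>\<delta>>0. \<exists>N. negligible N \<and> (\<forall>y\<in>ball x \<delta> - N. \<bar>u\<^sub>0 y\<bar> \<le> B)"
proof -
  have "\<exists>\<delta> B N. 0 < \<delta> \<and> 0 \<le> B \<and> negligible N \<and> (\<forall>y\<in>ball x \<delta> - N. \<bar>u\<^sub>0 y\<bar> \<le> B)" for x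
    by (rule locally_ess_boundedE[OF u, of x]) blast
  then have "\<forall>x. \<exists>\<delta> B N. 0 < \<delta> \<and> 0 \<le> B \<and> negligible N \<and> (\<forall>y\<in>ball x \<delta> - N. \<bar>u\<^sub>0 y\<bar> \<le> B)"
    by blast
  then obtain \<delta> B N where "\<forall>x. 0 < \<delta> x \<and> 0 \<le> B x \<and> negligible (N x) \<and>
      (\<forall>y\<in>ball x (\<delta> x) - N x. \<bar>u\<^sub>0 y\<bar> \<le> B x)"
    unfolding choice_iff by (elim exE) (rule that)
  then have *: "0 < \<delta> x" "0 \<le> B x" "negligible (N x)"
    "y \<in> ball x (\<delta> x) - N x \<Longrightarrow> \<bar>u\<^sub>0 y\<bar> \<le> B x" for x y by simp_all
  have "K \<subseteq> (\<Union>c\<in>K. ball c (\<delta> c))" using *(1) by force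
  then obtain C where C: "C \<subseteq> K" "finite C" "K \<subseteq> (\<Union>c\<in>C. ball c (\<delta> c))"
    by (rule compactE_image[OF K open_ball]) (rule that)
  show ?thesis
  proof (rule that[of "\<Sum>c\<in>C. B c"])
    show "0 \<le> (\<Sum>c\<in>C. B c)" using *(2) by (intro sum_nonneg)
    fix x assume "x \<in> K"
    then obtain c where c: "c \<in> C" "x \<in> ball c (\<delta> c)" using C(3) by blast
    have sub: "ball x (\<delta> c - dist c x) \<subseteq> ball c (\<delta> c)"
      using c(2) by (simp add: ball_subset_ball_iff dist_commute)
    have le: "B c \<le> (\<Sum>c\<in>C. B c)" using c(1) C(2) *(2) by (intro member_le_sum) auto
    have "\<bar>u\<^sub>0 y\<bar> \<le> (\<Sum>c\<in>C. B c)" if "y \<in> ball x (\<delta> c - dist c x) - N c" for y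
      using *(4)[of y c] sub that le by fastforce
    then show "\<exists>\<delta>>0. \<exists>N. negligible N \<and> (\<forall>y\<in>ball x \<delta> - N. \<bar>u\<^sub>0 y\<bar> \<le> (\<Sum>c\<in>C. B c))"
      using *(3)[of c] c(2) by (intro exI[of _ "\<delta> c - dist c x"] conjI exI[of _ "N c"]) auto
  qed
qed

section \<open>The closed loop at a fixed time\<close>

definition feedback_value :: "('a \<Rightarrow> real) \<Rightarrow> (real \<Rightarrow> real) \<Rightarrow> real \<Rightarrow> ('a \<Rightarrow> real) \<Rightarrow> 'a \<Rightarrow> real \<Rightarrow> real"
  where "feedback_value u\<^sub>0 g k G y s = g \<bar>u\<^sub>0 y\<bar> * u\<^sub>0 y + k * s * G y"

text \<open>
  \<open>a\<close> and \<open>b\<close> stand for the values of \<open>\<phi>\<close> and \<open>\<gamma>\<close> at a fixed time, and \<open>G\<close> for the gain at that time as a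
  function of the state.
\<close>

definition loop_field ::
    "(real^'n::{finite,linorder} \<Rightarrow> real) \<Rightarrow> (real \<Rightarrow> real) \<Rightarrow> real \<Rightarrow> real \<Rightarrow> real \<Rightarrow>
     (real^'n::{finite,linorder} \<Rightarrow> real) \<Rightarrow> real^'n::{finite,linorder} \<Rightarrow> (real^'n::{finite,linorder}) set"
  where "loop_field u\<^sub>0 g k a b G y =
    (\<lambda>s. chain_field (a + b * feedback_value u\<^sub>0 g k G y s) y) ` msgn (u\<^sub>0 y)"

lemma loop_field_eq_feedback:
  "{chain_field (a + b * u) y | u. u \<in> feedback u\<^sub>0 V g k \<eta> \<tau> t y} = loop_field u\<^sub>0 g k a b (gain \<eta> V \<tau> t) y"
  by (auto simp: feedback_def loop_field_def feedback_value_def image_iff)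

lemma msgn_bounded: "s \<in> msgn x \<Longrightarrow> \<bar>s\<bar> \<le> 1"
  by (auto simp: msgn_def split: if_splits)

lemma msgn_nonempty: "msgn x \<noteq> {}"
  by (auto simp: msgn_def)

lemma msgn_pos: "0 < x \<Longrightarrow> msgn x = {1}" and msgn_neg: "x < 0 \<Longrightarrow> msgn x = {-1}"
  by (auto simp: msgn_def)

locale variable_gain =
  fixes g :: "real \<Rightarrow> real" and k :: real
  assumes g_pos: "0 \<le> x \<Longrightarrow> 0 < g x" and g_mono: "mono_on {0..} g"
    and g_top: "filterlim g at_top at_top" and k_pos: "0 < k"
begin

lemma abs_feedback_value_le:
  assumes "\<bar>u\<^sub>0 y\<bar> \<le> B" "\<bar>G y\<bar> \<le> \<Gamma>" "s \<in> msgn (u\<^sub>0 y)"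
  shows "\<bar>feedback_value u\<^sub>0 g k G y s\<bar> \<le> g B * B + k * \<Gamma>"
proof -
  have B: "0 \<le> B" using assms(1) by linarith
  have "\<bar>g \<bar>u\<^sub>0 y\<bar> * u\<^sub>0 y\<bar> \<le> g B * B"
    unfolding abs_mult using assms(1) B g_pos[of "\<bar>u\<^sub>0 y\<bar>"] g_pos[of B] mono_onD[OF g_mono, of "\<bar>u\<^sub>0 y\<bar>" B]
    by (intro mult_mono) auto
  moreover have "\<bar>k * s * G y\<bar> \<le> k * 1 * \<Gamma>"
    unfolding abs_mult using assms(2) msgn_bounded[OF assms(3)] k_pos by (intro mult_mono) auto
  ultimately show ?thesis unfolding feedback_value_def by linarith
qed

text \<open>
  The bound depends on the state only through a compact set, and on the time only through bounds on
  \<open>a\<close>, \<open>b\<close> and the gain; so it serves at all times of a bounded interval at once.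
\<close>

lemma velocity_bound:
  fixes u\<^sub>0 :: "real^'n::{finite,linorder} \<Rightarrow> real"
  assumes u: "locally_ess_bounded u\<^sub>0" and K: "compact K" and A: "0 \<le> A" "0 \<le> A'" "0 \<le> \<Gamma>"
  obtains B where "0 \<le> B"
    "\<And>x a b G v. x \<in> K \<Longrightarrow> \<bar>a\<bar> \<le> A \<Longrightarrow> \<bar>b\<bar> \<le> A' \<Longrightarrow> \<forall>\<^sub>F y in nhds x. \<bar>G y\<bar> \<le> \<Gamma> \<Longrightarrow>
      v \<in> filippov (loop_field u\<^sub>0 g k a b G) x \<Longrightarrow> norm v \<le> B"
proof -
  obtain B\<^sub>0 where B0: "0 \<le> B\<^sub>0"
    "\<And>x. x \<in> K \<Longrightarrow> \<exists>\<delta>>0. \<exists>N. negligible N \<and> (\<forall>y\<in>ball x \<delta> - N. \<bar>u\<^sub>0 y\<bar> \<le> B\<^sub>0)"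
    using ess_bounded_on_compact[OF u K] by blast
  obtain C where C: "0 < C" "\<And>w (z :: real^'n::{finite,linorder}). norm (chain_field w z) \<le> C * (norm z + \<bar>w\<bar>)"
    using norm_chain_field_le by blast
  obtain \<rho> where \<rho>: "\<And>x. x \<in> K \<Longrightarrow> norm x \<le> \<rho>" "0 \<le> \<rho>"
    using compact_imp_bounded[OF K] unfolding bounded_pos by (metis less_imp_le)
  let ?U = "g B\<^sub>0 * B\<^sub>0 + k * \<Gamma>"
  have U: "0 \<le> ?U" using B0(1) A(3) k_pos g_pos[OF B0(1)] by simp
  let ?B = "C * (\<rho> + 1 + (A + A' * ?U))"
  show ?thesis
  proof (rule that[of ?B])
    show "0 \<le> ?B" using C(1) \<rho>(2) A U by simp
    fix x a b G v
    assume x: "x \<in> K" and ab: "\<bar>a\<bar> \<le> A" "\<bar>b\<bar> \<le> A'" and G: "\<forall>\<^sub>F y in nhds x. \<bar>G y\<bar> \<le> \<Gamma>"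
      and v: "v \<in> filippov (loop_field u\<^sub>0 g k a b G) x"
    obtain \<delta>1 N where d1: "0 < \<delta>1" "negligible N" "\<And>y. y \<in> ball x \<delta>1 - N \<Longrightarrow> \<bar>u\<^sub>0 y\<bar> \<le> B\<^sub>0"
      using B0(2)[OF x] by blast
    obtain \<delta>2 where d2: "0 < \<delta>2" "\<And>y. y \<in> ball x \<delta>2 \<Longrightarrow> \<bar>G y\<bar> \<le> \<Gamma>"
      using G unfolding eventually_nhds_metric by (auto simp: dist_commute)
    let ?\<delta> = "min 1 (min \<delta>1 \<delta>2)"
    have "filippov (loop_field u\<^sub>0 g k a b G) x \<subseteq> cball 0 ?B"
    proof (rule filippov_subset_convex[of ?\<delta> N])
      fix y w assume y: "y \<in> ball x ?\<delta> - N" and w: "w \<in> loop_field u\<^sub>0 g k a b G y"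
      obtain s where s: "s \<in> msgn (u\<^sub>0 y)" "w = chain_field (a + b * feedback_value u\<^sub>0 g k G y s) y"
        using w unfolding loop_field_def by blast
      have "norm y \<le> norm x + dist x y" unfolding dist_norm by norm
      then have "norm y \<le> \<rho> + 1" using \<rho>(1)[OF x] y by simp
      moreover have "\<bar>feedback_value u\<^sub>0 g k G y s\<bar> \<le> ?U"
        using d1(3)[of y] d2(2)[of y] y s(1) by (intro abs_feedback_value_le) auto
      then have "\<bar>b * feedback_value u\<^sub>0 g k G y s\<bar> \<le> A' * ?U"
        unfolding abs_mult using ab(2) A(2) by (intro mult_mono) auto
      ultimately have "norm y + \<bar>a + b * feedback_value u\<^sub>0 g k G y s\<bar> \<le> \<rho> + 1 + (A + A' * ?U)"
        using ab(1) by linarith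
      then show "w \<in> cball 0 ?B"
        using C(2)[of "a + b * feedback_value u\<^sub>0 g k G y s" y] C(1) unfolding s(2)
        by (auto intro: order_trans mult_left_mono)
    qed (use d1 d2 in auto)
    then show "norm v \<le> ?B" using v by auto
  qed
qed

text \<open>
  The pair \<open>(P, s)\<close> is an essential limit of the time-independent pair (amplitude part, sign). It is
  chosen once for the state \<open>x\<close>; inserting the perturbations and the gain of time \<open>t\<close> then gives a
  selection that depends measurably on \<open>t\<close>.
\<close>

lemma filippov_selection:
  fixes u\<^sub>0 :: "real^'n::{finite,linorder} \<Rightarrow> real"
  assumes u: "locally_ess_bounded u\<^sub>0"
  obtains P s :: real where
    "\<And>a b G. isCont G x \<Longrightarrow> chain_field (a + b * (P + k * s * G x)) x \<in> filippov (loop_field u\<^sub>0 g k a b G) x"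
proof -
  define F where "F y = (\<lambda>s. (g \<bar>u\<^sub>0 y\<bar> * u\<^sub>0 y, s)) ` msgn (u\<^sub>0 y)" for y
  obtain \<delta> B N where d: "0 < \<delta>" "0 \<le> B" "negligible N" "\<And>y. y \<in> ball x \<delta> - N \<Longrightarrow> \<bar>u\<^sub>0 y\<bar> \<le> B"
    by (rule locally_ess_boundedE[OF u, of x]) blast
  have "essential_limits F x \<noteq> {}"
  proof (rule essential_limits_nonempty[OF d(1,3)])
    fix y v assume y: "y \<in> ball x \<delta> - N" and "v \<in> F y"
    then obtain s where s: "s \<in> msgn (u\<^sub>0 y)" "v = (g \<bar>u\<^sub>0 y\<bar> * u\<^sub>0 y, s)" by (auto simp: F_def)
    have "\<bar>g \<bar>u\<^sub>0 y\<bar> * u\<^sub>0 y\<bar> \<le> g B * B + k * 0"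
      using abs_feedback_value_le[where G="\<lambda>_. 0" and u\<^sub>0=u\<^sub>0 and \<Gamma>=0, OF d(4)[OF y] _ s(1)] by (simp add: feedback_value_def)
    then show "norm v \<le> g B * B + 1"
      using norm_Pair_le[of "g \<bar>u\<^sub>0 y\<bar> * u\<^sub>0 y" s] msgn_bounded[OF s(1)] s(2) by simp
  qed (simp add: F_def msgn_nonempty)
  then obtain P s where Ps: "(P, s) \<in> essential_limits F x" by auto
  show ?thesis
  proof (rule that[of P s])
    fix a b and G :: "real^'n::{finite,linorder} \<Rightarrow> real" assume G: "isCont G x"
    define L where "L w = (b * (fst w + k * snd w * G x)) *\<^sub>R (e_last :: real^'n::{finite,linorder})" for w
    have "chain_field a x + L (P, s) \<in> filippov (loop_field u\<^sub>0 g k a b G) x"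
    proof (rule filippov_affine_image[OF Ps])
      show "bounded_linear L" unfolding L_def
        by (simp add: linear_conv_bounded_linear[symmetric], rule linearI) (auto simp: algebra_simps)
      fix e :: real assume e: "0 < e"
      define h where "h y = norm (shift_matrix *v (x - y)) +
          \<bar>b * k\<bar> * \<bar>G x - G y\<bar> * norm (e_last :: real^'n::{finite,linorder})" for y
      have "isCont (\<lambda>y. shift_matrix *v (x - y)) x"
        by (rule bounded_linear.isCont[OF chain_field_linear]) (intro continuous_intros)
      then have "isCont h x" unfolding h_def using G by (intro continuous_intros)
      moreover have "h x = 0" by (simp add: h_def)
      ultimately have "(h \<longlongrightarrow> 0) (at x)" by (simp add: isCont_def)
      then have "\<forall>\<^sub>F y in at x. h y < e" using e by (rule order_tendstoD)
      then obtain \<delta> where \<delta>: "0 < \<delta>" "\<And>y. y \<noteq> x \<Longrightarrow> dist y x < \<delta> \<Longrightarrow> h y < e"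
        unfolding eventually_at by auto
      have h: "h y \<le> e" if "y \<in> ball x \<delta>" for y
        using \<delta>(2)[of y] that e \<open>h x = 0\<close> by (cases "y = x") (auto simp: dist_commute)
      show "\<exists>\<delta>>0. \<forall>y\<in>ball x \<delta>. \<forall>v\<in>F y. \<exists>r\<in>loop_field u\<^sub>0 g k a b G y. dist (chain_field a x + L v) r \<le> e"
      proof (intro exI[of _ \<delta>] conjI ballI \<delta>(1))
        fix y v assume y: "y \<in> ball x \<delta>" and "v \<in> F y"
        then obtain s where s: "s \<in> msgn (u\<^sub>0 y)" "v = (g \<bar>u\<^sub>0 y\<bar> * u\<^sub>0 y, s)" by (auto simp: F_def)
        let ?r = "chain_field (a + b * feedback_value u\<^sub>0 g k G y s) y"
        have "chain_field a x + L v - ?r = shift_matrix *v (x - y) + (b * k * s * (G x - G y)) *\<^sub>R e_last"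
          unfolding s(2) L_def chain_field_def feedback_value_def
          by (simp add: matrix_vector_mult_diff_distrib algebra_simps)
        then have "dist (chain_field a x + L v) ?r \<le> norm (shift_matrix *v (x - y)) + \<bar>b * k * s * (G x - G y)\<bar> * norm (e_last :: real^'n::{finite,linorder})"
          unfolding dist_norm by (metis norm_scaleR norm_triangle_ineq)
        also have "\<bar>b * k * s * (G x - G y)\<bar> \<le> \<bar>b * k\<bar> * 1 * \<bar>G x - G y\<bar>"
          unfolding abs_mult using msgn_bounded[OF s(1)] by (intro mult_right_mono mult_left_mono) auto
        finally have "dist (chain_field a x + L v) ?r \<le> h y" by (simp add: h_def mult_right_mono)
        then show "\<exists>r\<in>loop_field u\<^sub>0 g k a b G y. dist (chain_field a x + L v) r \<le> e"
          using h[OF y] s(1) by (intro bexI[of _ ?r]) (auto simp: loop_field_def)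
      qed
    qed
    then show "chain_field (a + b * (P + k * s * G x)) x \<in> filippov (loop_field u\<^sub>0 g k a b G) x"
      by (simp add: L_def chain_field_add)
  qed
qed

lemma domination_constant:
  assumes "0 < \<gamma>\<^sub>m"
  obtains C where "0 \<le> C" "\<And>x. 0 \<le> x \<Longrightarrow> x - \<gamma>\<^sub>m * (g x * x) \<le> C"
proof -
  obtain X where X: "\<And>x. X \<le> x \<Longrightarrow> 1 / \<gamma>\<^sub>m \<le> g x"
    using g_top unfolding filterlim_at_top eventually_at_top_linorder by metis
  have "x - \<gamma>\<^sub>m * (g x * x) \<le> \<bar>X\<bar>" if x: "0 \<le> x" for x
  proof (cases "X \<le> x")
    case True
    then have "1 \<le> \<gamma>\<^sub>m * g x" using X[of x] assms by (simp add: field_simps)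
    then have "1 * x \<le> \<gamma>\<^sub>m * g x * x" using x by (rule mult_right_mono)
    then show ?thesis by (simp add: mult.assoc)
  next
    case False
    have "0 \<le> \<gamma>\<^sub>m * (g x * x)" using assms g_pos[OF x] x by simp
    then show ?thesis using False by linarith
  qed
  then show ?thesis using that[of "\<bar>X\<bar>"] by simp
qed

end

locale nominal_lyapunov = homogeneous_lyapunov V p \<kappa> d + variable_gain g k
  for V :: "real^'n::{finite,linorder} \<Rightarrow> real" and p \<kappa> d g k +
  fixes u\<^sub>0 :: "real^'n::{finite,linorder} \<Rightarrow> real" and c \<alpha> :: real
  assumes u0_bdd: "locally_ess_bounded u\<^sub>0"
    and nominal_decay: "z \<noteq> 0 \<Longrightarrow> v \<in> filippov (\<lambda>y. {nominal_field u\<^sub>0 y}) z \<Longrightarrow> grad z \<bullet> v \<le> - c * V z powr \<alpha>"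
    and sign: "z \<noteq> 0 \<Longrightarrow> u\<^sub>0 z * (grad z \<bullet> e_last) \<le> 0"
    and sign_0: "z \<noteq> 0 \<Longrightarrow> u\<^sub>0 z = 0 \<Longrightarrow> grad z \<bullet> e_last = 0"
    and c_pos: "0 < c" and \<alpha>_bounds: "0 < \<alpha>" "\<alpha> < 1"
begin

text \<open>
  Where \<open>q = \<partial>V/\<partial>z\<^sub>r\<close> and \<open>u\<^sub>0\<close> have opposite signs, replacing the nominal control by the perturbed one
  changes the derivative of \<open>V\<close> by at most a term that vanishes once the gain passes the threshold
  \<open>(C + \<phi>\<^sub>b) / (\<gamma>\<^sub>m k)\<close>.
\<close>

lemma sign_domination:
  assumes q: "q < 0 \<and> 0 < u\<^sub>0 y \<or> 0 < q \<and> u\<^sub>0 y < 0" and s: "s \<in> msgn (u\<^sub>0 y)"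
    and C: "\<And>x. 0 \<le> x \<Longrightarrow> x - \<gamma>\<^sub>m * (g x * x) \<le> C"
    and ab: "\<bar>a\<bar> \<le> \<phi>\<^sub>b" "\<gamma>\<^sub>m \<le> b" "0 < \<gamma>\<^sub>m" and G: "0 \<le> G\<^sub>0" "G\<^sub>0 \<le> G y"
  shows "q * (a + b * feedback_value u\<^sub>0 g k G y s - u\<^sub>0 y) \<le> \<bar>q\<bar> * max 0 (C + \<phi>\<^sub>b - \<gamma>\<^sub>m * k * G\<^sub>0)"
proof -
  let ?x = "\<bar>u\<^sub>0 y\<bar>"
  have x: "0 \<le> g ?x * ?x" using g_pos[of ?x] by simp
  have kG: "k * G\<^sub>0 \<le> k * G y" "0 \<le> k * G\<^sub>0" using G k_pos by auto
  have "\<gamma>\<^sub>m * (g ?x * ?x + k * G\<^sub>0) \<le> b * (g ?x * ?x + k * G y)"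
    using ab x kG by (intro mult_mono) auto
  then have low: "\<gamma>\<^sub>m * k * G\<^sub>0 - (C + \<phi>\<^sub>b) \<le> b * (g ?x * ?x + k * G y) - ?x - \<phi>\<^sub>b"
    using C[of ?x] by (simp add: algebra_simps)
  show ?thesis
  proof (cases "q < 0")
    case True
    then have "0 < u\<^sub>0 y" "s = 1" using q s msgn_pos by auto
    then have "- (a + b * feedback_value u\<^sub>0 g k G y s - u\<^sub>0 y) \<le> max 0 (C + \<phi>\<^sub>b - \<gamma>\<^sub>m * k * G\<^sub>0)"
      using low ab(1) by (simp add: feedback_value_def)
    moreover have "q * f \<le> \<bar>q\<bar> * m" if "- f \<le> m" for f m
      using mult_left_mono[OF that, of "- q"] True by simp
    ultimately show ?thesis by blast
  next
    case False
    then have "u\<^sub>0 y < 0" "s = -1" "0 < q" using q s msgn_neg by auto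
    then have "a + b * feedback_value u\<^sub>0 g k G y s - u\<^sub>0 y \<le> max 0 (C + \<phi>\<^sub>b - \<gamma>\<^sub>m * k * G\<^sub>0)"
      using low ab(1) by (simp add: feedback_value_def algebra_simps)
    then have "\<bar>q\<bar> * (a + b * feedback_value u\<^sub>0 g k G y s - u\<^sub>0 y) \<le> \<bar>q\<bar> * max 0 (C + \<phi>\<^sub>b - \<gamma>\<^sub>m * k * G\<^sub>0)"
      by (rule mult_left_mono) simp
    then show ?thesis using \<open>0 < q\<close> by simp
  qed
qed

text \<open>
  If \<open>\<partial>V/\<partial>z\<^sub>r\<close> vanishes at \<open>z\<close>, the last coordinate of the velocity does not matter. Otherwise it keeps
  its sign near \<open>z\<close>, so \<open>u\<^sub>0\<close> has the opposite sign at all nearby points, the multivalued sign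
  is a single value there, and \<open>sign_domination\<close> applies pointwise. The nominal decay is assumed for the
  regularised field only; \<open>essential_limits_neighbourhood\<close> brings it to almost all nearby points, and
  the resulting half-space is closed and convex, hence contains the regularisation of the closed loop.
\<close>

lemma perturbed_decay:
  assumes z: "z \<noteq> 0" and v: "v \<in> filippov (loop_field u\<^sub>0 g k a b G) z"
    and C: "\<And>x. 0 \<le> x \<Longrightarrow> x - \<gamma>\<^sub>m * (g x * x) \<le> C"
    and ab: "\<bar>a\<bar> \<le> \<phi>\<^sub>b" "\<gamma>\<^sub>m \<le> b" "0 < \<gamma>\<^sub>m"
    and G: "0 \<le> G\<^sub>0" "\<forall>\<^sub>F y in nhds z. G\<^sub>0 \<le> G y"
  shows "grad z \<bullet> v \<le> - c * V z powr \<alpha> + \<bar>grad z \<bullet> e_last\<bar> * max 0 (C + \<phi>\<^sub>b - \<gamma>\<^sub>m * k * G\<^sub>0)"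
proof (rule field_le_epsilon)
  fix e :: real assume e: "0 < e"
  let ?d = "grad z \<bullet> e_last" and ?m = "max 0 (C + \<phi>\<^sub>b - \<gamma>\<^sub>m * k * G\<^sub>0)"
  let ?U = "{v. grad z \<bullet> v < - c * V z powr \<alpha> + e}"
  obtain \<delta>\<^sub>0 B N\<^sub>0 where d0: "0 < \<delta>\<^sub>0" "0 \<le> B" "negligible N\<^sub>0" "\<And>y. y \<in> ball z \<delta>\<^sub>0 - N\<^sub>0 \<Longrightarrow> \<bar>u\<^sub>0 y\<bar> \<le> B"
    by (rule locally_ess_boundedE[OF u0_bdd, of z]) blast
  obtain Cf where Cf: "0 < Cf" "\<And>w (z :: real^'n::{finite,linorder}). norm (chain_field w z) \<le> Cf * (norm z + \<bar>w\<bar>)"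
    using norm_chain_field_le by blast
  obtain \<delta>1 N where d1: "0 < \<delta>1" "negligible N"
    and nom: "\<And>y. y \<in> ball z \<delta>1 - N \<Longrightarrow> {nominal_field u\<^sub>0 y} \<subseteq> ?U"
  proof (rule essential_limits_neighbourhood[OF d0(1,3)])
    fix y v assume y: "y \<in> ball z \<delta>\<^sub>0 - N\<^sub>0" and "v \<in> {nominal_field u\<^sub>0 y}"
    then have v: "v = chain_field (u\<^sub>0 y) y" by (simp add: nominal_field_def)
    have "norm y \<le> norm z + dist z y" unfolding dist_norm by norm
    then have "norm y + \<bar>u\<^sub>0 y\<bar> \<le> norm z + \<delta>\<^sub>0 + B" using y d0(4)[OF y] by simp
    then show "norm v \<le> Cf * (norm z + \<delta>\<^sub>0 + B)"
      unfolding v using Cf(2)[of "u\<^sub>0 y" y] Cf(1) by (meson mult_left_mono less_imp_le order_trans)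
  next
    show "open ?U" by (intro open_Collect_less continuous_intros)
    show "essential_limits (\<lambda>y. {nominal_field u\<^sub>0 y}) z \<subseteq> ?U"
      using nominal_decay[OF z] e unfolding filippov_eq_essential_limits by fastforce
  qed blast
  obtain \<delta>2 where d2: "0 < \<delta>2" "\<And>y. y \<in> ball z \<delta>2 \<Longrightarrow> G\<^sub>0 \<le> G y"
    using G(2) unfolding eventually_nhds_metric by (auto simp: dist_commute)
  have "isCont grad z"
    using grad_continuous z by (simp add: continuous_on_eq_continuous_at open_Compl)
  then have "continuous (at z) (\<lambda>y. grad y \<bullet> e_last)" by (intro continuous_intros)
  then have lim: "((\<lambda>y. grad y \<bullet> e_last) \<longlongrightarrow> ?d) (nhds z)"
    using tendsto_at_iff_tendsto_nhds[of "\<lambda>y. grad y \<bullet> e_last" z] by (simp add: isCont_def)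
  have "\<forall>\<^sub>F y in nhds z. y \<noteq> 0 \<and> (?d < 0 \<longrightarrow> grad y \<bullet> e_last < 0) \<and> (0 < ?d \<longrightarrow> 0 < grad y \<bullet> e_last)"
  proof (intro eventually_conj)
    show "\<forall>\<^sub>F y in nhds z. ?d < 0 \<longrightarrow> grad y \<bullet> e_last < 0"
      using order_tendstoD(2)[OF lim] by (cases "?d < 0") auto
    show "\<forall>\<^sub>F y in nhds z. 0 < ?d \<longrightarrow> 0 < grad y \<bullet> e_last"
      using order_tendstoD(1)[OF lim] by (cases "0 < ?d") auto
  qed (use t1_space_nhds[OF z] in auto)
  then obtain \<delta>3 where d3: "0 < \<delta>3" "\<And>y. y \<in> ball z \<delta>3 \<Longrightarrow> y \<noteq> 0"
      "\<And>y. y \<in> ball z \<delta>3 \<Longrightarrow> ?d < 0 \<Longrightarrow> grad y \<bullet> e_last < 0"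
      "\<And>y. y \<in> ball z \<delta>3 \<Longrightarrow> 0 < ?d \<Longrightarrow> 0 < grad y \<bullet> e_last"
    unfolding eventually_nhds_metric by (auto simp: dist_commute)
  let ?\<delta> = "min \<delta>1 (min \<delta>2 \<delta>3)" and ?r = "- c * V z powr \<alpha> + \<bar>?d\<bar> * ?m + e"
  have "filippov (loop_field u\<^sub>0 g k a b G) z \<subseteq> {v. grad z \<bullet> v \<le> ?r}"
  proof (rule filippov_subset_convex[of ?\<delta> N])
    fix y w assume y: "y \<in> ball z ?\<delta> - N" and w: "w \<in> loop_field u\<^sub>0 g k a b G y"
    obtain s where s: "s \<in> msgn (u\<^sub>0 y)" "w = chain_field (a + b * feedback_value u\<^sub>0 g k G y s) y"
      using w unfolding loop_field_def by blast
    let ?f = "a + b * feedback_value u\<^sub>0 g k G y s - u\<^sub>0 y"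
    have "w = nominal_field u\<^sub>0 y + ?f *\<^sub>R e_last"
      unfolding s(2) nominal_field_def using chain_field_add[of "u\<^sub>0 y" ?f y] by simp
    then have eq: "grad z \<bullet> w = grad z \<bullet> nominal_field u\<^sub>0 y + ?d * ?f"
      by (simp add: inner_add_right)
    have "?d * ?f \<le> \<bar>?d\<bar> * ?m"
    proof (cases "?d = 0")
      case False
      have "y \<in> ball z \<delta>3" using y by simp
      note y3 = d3(2-4)[OF this]
      \<comment> \<open>\<open>u\<^sub>0 y\<close> cannot be \<open>0\<close>, since the derivative in the last coordinate does not vanish at \<open>y\<close>\<close>
      have "?d < 0 \<and> 0 < u\<^sub>0 y \<or> 0 < ?d \<and> u\<^sub>0 y < 0"
        using False y3 sign[OF y3(1)] sign_0[OF y3(1)]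
        by (smt (verit) mult_neg_neg mult_pos_pos)
      then show ?thesis using s(1) C ab G(1) d2(2)[of y] y by (intro sign_domination) auto
    qed simp
    then show "w \<in> {v. grad z \<bullet> v \<le> ?r}" using nom[of y] y eq by simp
  next
    show "closed {v. grad z \<bullet> v \<le> ?r}" by (intro closed_Collect_le continuous_intros)
    show "convex {v. grad z \<bullet> v \<le> ?r}" by (rule convex_halfspace_le)
  qed (use d1 d2 d3 in auto)
  then show "grad z \<bullet> v \<le> - c * V z powr \<alpha> + \<bar>?d\<bar> * ?m + e" using v by auto
qed

end

lemma AE_lebesgue_on_iff_negligible:
  assumes "S \<in> sets lebesgue"
  shows "(AE t in lebesgue_on S. P t) \<longleftrightarrow> (\<exists>N. negligible N \<and> (\<forall>t\<in>S - N. P t))"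
proof -
  have "(AE t in lebesgue_on S. P t) \<longleftrightarrow> (AE t in lebesgue. t \<in> S \<longrightarrow> P t)"
    using assms by (simp add: AE_restrict_space_iff)
  also have "\<dots> \<longleftrightarrow> (\<exists>N. negligible N \<and> {t. \<not> (t \<in> S \<longrightarrow> P t)} \<subseteq> N)"
    by (auto simp: eventually_ae_filter_negligible)
  also have "\<dots> \<longleftrightarrow> (\<exists>N. negligible N \<and> (\<forall>t\<in>S - N. P t))"
    by (intro iff_exI conj_cong refl) auto
  finally show ?thesis .
qed

lemma isCont_barrier:
  assumes "isCont V x" "V x < \<xi>" shows "isCont (\<lambda>y. barrier \<xi> (V y)) x"
  unfolding barrier_def using assms by (intro continuous_intros) auto

text \<open>
  Later crossings do not change a switching time that has already been fixed.
\<close>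

lemma switch_time_extend:
  assumes I: "0 \<in> I" "I \<subseteq> I'" "\<And>t. t \<in> I \<Longrightarrow> z' t = z t"
    and new: "\<And>t. t \<in> I' - I \<Longrightarrow> V (z' t) = \<eta> t / 2 \<Longrightarrow> switch_time \<eta> V I z \<le> ereal t"
  shows "switch_time \<eta> V I' z' = switch_time \<eta> V I z"
proof (cases "V (z 0) \<le> \<eta> 0 / 2")
  case True
  then show ?thesis using I by (simp add: switch_time_def)
next
  case False
  let ?S = "{t \<in> I. V (z t) = \<eta> t / 2}" and ?X = "{t \<in> I' - I. V (z' t) = \<eta> t / 2}"
  have "{t \<in> I'. V (z' t) = \<eta> t / 2} = ?S \<union> ?X" using I by auto
  then have "Inf (ereal ` {t \<in> I'. V (z' t) = \<eta> t / 2}) = inf (Inf (ereal ` ?S)) (Inf (ereal ` ?X))"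
    by (simp add: image_Un Inf_union_distrib)
  moreover have "Inf (ereal ` ?S) \<le> Inf (ereal ` ?X)"
    using new False by (intro Inf_greatest) (auto simp: switch_time_def)
  ultimately show ?thesis using False I by (simp add: switch_time_def inf_absorb1)
qed

text \<open>
  \<open>C\<close> is a bound for \<open>x - \<gamma>\<^sub>m * (g x * x)\<close>, and \<open>\<theta>\<close> is the fraction of the envelope that trajectories do
  not exceed after the switch. The last two conditions on \<open>\<theta>\<close> say that the barrier at \<open>V = \<theta> * \<eta>\<close> passes the
  threshold, and that the decay rate there beats the rate at which the envelope shrinks.
\<close>

locale perturbed_chain = nominal_lyapunov V p \<kappa> d g k u\<^sub>0 c \<alpha>
  for V :: "real^'n::{finite,linorder} \<Rightarrow> real" and p \<kappa> d g k and u\<^sub>0 :: "real^'n::{finite,linorder} \<Rightarrow> real" and c \<alpha> +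
  fixes \<phi> \<gamma> \<eta> \<eta>' :: "real \<Rightarrow> real" and \<phi>\<^sub>b \<gamma>\<^sub>m \<gamma>\<^sub>M M C \<theta> :: real
  assumes \<phi>_measurable: "\<phi> \<in> borel_measurable (lebesgue_on {0..})"
    and \<gamma>_measurable: "\<gamma> \<in> borel_measurable (lebesgue_on {0..})"
    and \<phi>\<^sub>b_pos: "0 < \<phi>\<^sub>b" and \<gamma>\<^sub>m_pos: "0 < \<gamma>\<^sub>m" and \<gamma>\<^sub>M_pos: "0 < \<gamma>\<^sub>M"
    and \<eta>_pos: "0 \<le> t \<Longrightarrow> 0 < \<eta> t"
    and \<eta>_antimono: "0 \<le> s \<Longrightarrow> s \<le> t \<Longrightarrow> \<eta> t \<le> \<eta> s"
    and \<eta>'_cont: "continuous_on {0..} \<eta>'"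
    and \<eta>_deriv: "0 \<le> t \<Longrightarrow> (\<eta> has_real_derivative \<eta>' t) (at t within {0..})"
    and \<eta>'_ge: "0 \<le> t \<Longrightarrow> - \<eta>' t \<le> M * \<eta> t"
    and M_nonneg: "0 \<le> M"
    and domination: "0 \<le> C" "0 \<le> x \<Longrightarrow> x - \<gamma>\<^sub>m * (g x * x) \<le> C"
    and \<theta>_bounds: "1 / 2 \<le> \<theta>" "\<theta> < 1"
    and \<theta>_gain: "C + \<phi>\<^sub>b \<le> \<gamma>\<^sub>m * k * (1 / (1 - \<theta>))"
    and \<theta>_rate: "M * \<eta> 0 powr (1 - \<alpha>) \<le> c * \<theta> powr \<alpha>"
begin

lemma \<eta>_cont: "continuous_on {0..} \<eta>"
  using \<eta>_deriv by (auto simp: continuous_on_eq_continuous_within intro: DERIV_continuous)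

text \<open>
  Since \<open>\<eta>\<close> is largest at \<open>0\<close> and \<open>1 - \<alpha> > 0\<close>, comparing the two rates at time \<open>0\<close>, as \<open>\<theta>_rate\<close> does, settles all
  later times.
\<close>

lemma decay_beats_envelope:
  assumes t: "0 \<le> t" and y: "\<theta> * \<eta> t \<le> y"
  shows "- c * y powr \<alpha> \<le> \<theta> * \<eta>' t"
proof -
  have \<eta>: "0 < \<eta> t" "\<eta> t \<le> \<eta> 0" using \<eta>_pos \<eta>_antimono t by auto
  have "\<theta> * (M * \<eta> t) \<le> 1 * (M * \<eta> t)"
    using \<theta>_bounds M_nonneg \<eta> by (intro mult_right_mono) auto
  also have "\<dots> = M * (\<eta> t powr (1 - \<alpha>) * \<eta> t powr \<alpha>)"
    using \<eta> by (simp flip: powr_add)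
  also have "\<dots> \<le> M * (\<eta> 0 powr (1 - \<alpha>) * \<eta> t powr \<alpha>)"
    using \<eta> M_nonneg \<alpha>_bounds by (intro mult_left_mono mult_right_mono powr_mono2) auto
  also have "\<dots> \<le> c * \<theta> powr \<alpha> * \<eta> t powr \<alpha>"
    using mult_right_mono[OF \<theta>_rate, of "\<eta> t powr \<alpha>"] by (simp add: mult.assoc)
  also have "\<dots> = c * (\<theta> * \<eta> t) powr \<alpha>" using \<theta>_bounds \<eta> by (simp add: powr_mult)
  also have "\<dots> \<le> c * y powr \<alpha>"
    using c_pos \<alpha>_bounds \<theta>_bounds \<eta> y by (intro mult_left_mono powr_mono2) auto
  finally have "- c * y powr \<alpha> \<le> \<theta> * - (M * \<eta> t)" by simp
  also have "\<dots> \<le> \<theta> * \<eta>' t" using \<eta>'_ge[OF t] \<theta>_bounds by (intro mult_left_mono) auto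
  finally show ?thesis .
qed

end

section \<open>Behaviour of trajectories\<close>

text \<open>
  A trajectory with its velocity \<open>v\<close>; outside the single negligible set \<open>N\<close> both the inclusion and the
  bounds on the perturbations hold. The bounds are stated on all of \<open>[0,\<infinity>)\<close> because they are also needed
  past the end of \<open>I\<close>, where the trajectory is continued.
\<close>

locale trajectory = perturbed_chain V p \<kappa> d g k u\<^sub>0 c \<alpha> \<phi> \<gamma> \<eta> \<eta>' \<phi>\<^sub>b \<gamma>\<^sub>m \<gamma>\<^sub>M M C \<theta>
  for V :: "real^'n::{finite,linorder} \<Rightarrow> real" and p \<kappa> d g k and u\<^sub>0 :: "real^'n::{finite,linorder} \<Rightarrow> real" and c \<alpha>
    and \<phi> \<gamma> \<eta> \<eta>' :: "real \<Rightarrow> real" and \<phi>\<^sub>b \<gamma>\<^sub>m \<gamma>\<^sub>M M C \<theta> :: real +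
  fixes I N :: "real set" and z v :: "real \<Rightarrow> real^'n::{finite,linorder}"
  assumes I: "is_interval I" "0 \<in> I" "I \<subseteq> {0..}"
    and v_int: "T \<in> I \<Longrightarrow> v absolutely_integrable_on {0..T}"
    and z_eq: "T \<in> I \<Longrightarrow> z T = z 0 + integral {0..T} v"
    and N: "negligible N"
    and inclusion: "t \<in> I - N \<Longrightarrow>
      v t \<in> filippov (loop_field u\<^sub>0 g k (\<phi> t) (\<gamma> t) (gain \<eta> V (switch_time \<eta> V I z) t)) (z t)"
    and bounds_ae: "0 \<le> t \<Longrightarrow> t \<notin> N \<Longrightarrow> \<bar>\<phi> t\<bar> \<le> \<phi>\<^sub>b \<and> \<gamma>\<^sub>m \<le> \<gamma> t \<and> \<gamma> t \<le> \<gamma>\<^sub>M"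
begin

abbreviation "\<tau> \<equiv> switch_time \<eta> V I z"

lemma I_nonneg: "t \<in> I \<Longrightarrow> 0 \<le> t" using I(3) by auto

lemma bounds:
  assumes "t \<in> I - N" shows "\<bar>\<phi> t\<bar> \<le> \<phi>\<^sub>b" "\<gamma>\<^sub>m \<le> \<gamma> t" "\<gamma> t \<le> \<gamma>\<^sub>M"
  using assms bounds_ae[of t] I_nonneg[of t] by auto

lemma Icc_subset: "0 \<le> a \<Longrightarrow> b \<in> I \<Longrightarrow> {a..b} \<subseteq> I"
proof
  fix t assume "0 \<le> a" "b \<in> I" "t \<in> {a..b}"
  then show "t \<in> I" using mem_is_interval_1_I[OF I(1,2), of b t] by auto
qed

lemma z_cont: assumes "T \<in> I" shows "continuous_on {0..T} z"
proof -
  have "v integrable_on {0..T}" using v_int[OF assms] by (simp add: absolutely_integrable_on_def)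
  then have "continuous_on {0..T} (\<lambda>t. z 0 + integral {0..t} v)"
    by (intro continuous_intros indefinite_integral_continuous_1)
  then show ?thesis
    by (rule continuous_on_eq) (use z_eq Icc_subset[of 0 T] assms in fastforce)
qed

lemma Vz_cont: "T \<in> I \<Longrightarrow> continuous_on {0..T} (\<lambda>t. V (z t))"
  by (rule continuous_on_compose2[OF V_cont z_cont]) auto

lemma \<eta>_cont': "continuous_on {0..T} \<eta>"
  by (rule continuous_on_subset[OF \<eta>_cont]) auto

text \<open>
  The function \<open>\<psi>\<close> is the identity, the logarithm or a power, according to whether \<open>V\<close> is compared with
  the envelope, with an exponential, or with a function that reaches \<open>0\<close> in finite time.
\<close>

lemma comparison:
  fixes \<psi> \<psi>' :: "real \<Rightarrow> real"
  assumes ab: "0 \<le> a" "a \<le> b" "b \<in> I"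
    and \<psi>: "\<And>y. 0 < y \<Longrightarrow> (\<psi> has_real_derivative \<psi>' y) (at y)" "continuous_on {0<..} \<psi>'"
    and z0: "\<And>t. t \<in> {a..b} \<Longrightarrow> z t \<noteq> 0"
    and \<beta>: "\<beta> integrable_on {a..b}"
    and le: "\<And>t. t \<in> {a<..<b} - N \<Longrightarrow> \<psi>' (V (z t)) * (grad (z t) \<bullet> v t) \<le> \<beta> t"
  shows "\<psi> (V (z b)) - \<psi> (V (z a)) \<le> integral {a..b} \<beta>"
proof (rule integral_curve_comparison[where S="- {0}" and G="\<lambda>x. \<psi>' (V x) *\<^sub>R grad x" and N="N \<union> {a, b}" and v=v])
  have sub: "{a..b} \<subseteq> {0..b}" using ab by auto
  show "v absolutely_integrable_on {a..b}"
    by (rule absolutely_integrable_on_subinterval[OF v_int[OF ab(3)] sub])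
  show "z t = z a + integral {a..t} v" if "t \<in> {a..b}" for t
  proof -
    have t: "t \<in> I" "a \<in> I" using that ab Icc_subset[of 0 b] by auto
    have "v integrable_on {0..t}" using v_int[OF t(1)] by (simp add: absolutely_integrable_on_def)
    then have "integral {0..a} v + integral {a..t} v = integral {0..t} v"
      using that ab by (intro Henstock_Kurzweil_Integration.integral_combine) auto
    then show ?thesis using z_eq[OF t(1)] z_eq[OF t(2)] by (simp add: algebra_simps)
  qed
  show "((\<lambda>x. \<psi> (V x)) has_derivative (\<lambda>h. (\<psi>' (V x) *\<^sub>R grad x) \<bullet> h)) (at x)" if "x \<in> - {0}" for x
  proof -
    have "x \<noteq> 0" using that by auto
    have "(\<psi> has_derivative (\<lambda>y. \<psi>' (V x) * y)) (at (V x))"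
      using \<psi>(1)[OF V_pos[OF \<open>x \<noteq> 0\<close>]] by (simp add: has_field_derivative_def)
    from has_derivative_compose[OF V_has_derivative[OF \<open>x \<noteq> 0\<close>] this]
    show ?thesis by simp
  qed
  show "continuous_on (- {0}) (\<lambda>x. \<psi>' (V x) *\<^sub>R grad x)"
    by (intro continuous_on_scaleR grad_continuous continuous_on_compose2[OF \<psi>(2) continuous_on_subset[OF V_cont]])
       (auto intro: V_pos)
qed (use assms N in auto)

lemma V_above_before_switch:
  assumes "t \<in> I" "ereal t < \<tau>"
  shows "\<eta> t / 2 < V (z t)"
proof (rule ccontr)
  assume "\<not> ?thesis"
  moreover have z0: "\<not> V (z 0) \<le> \<eta> 0 / 2"
    using assms I_nonneg[OF assms(1)] by (auto simp: switch_time_def)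
  moreover have "continuous_on {0..t} (\<lambda>s. V (z s) - \<eta> s / 2)"
    using Vz_cont[OF assms(1)] \<eta>_cont' by (intro continuous_intros) auto
  ultimately obtain s where s: "0 \<le> s" "s \<le> t" "V (z s) = \<eta> s / 2"
    using IVT2'[of "\<lambda>s. V (z s) - \<eta> s / 2" t 0 0] I_nonneg[OF assms(1)] by auto
  then have "s \<in> I" using Icc_subset[of 0 t] assms(1) by auto
  then have "\<tau> \<le> ereal s" using s z0 by (auto simp: switch_time_def intro!: Inf_lower)
  then show False using assms(2) s(2) by (meson ereal_less_eq(3) leD order_trans)
qed

text \<open>
  The infimum in the definition of the switching time is attained, the set of times being closed in every
  compact initial segment of \<open>I\<close>.
\<close>

lemma switch_time_cases:
  obtains (never) "\<tau> = \<infinity>" | (at) t\<^sub>b where "t\<^sub>b \<in> I" "\<tau> = ereal t\<^sub>b" "V (z t\<^sub>b) \<le> \<eta> t\<^sub>b / 2"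
proof (cases "V (z 0) \<le> \<eta> 0 / 2")
  case True
  then show ?thesis using I(2) by (intro at[of 0]) (auto simp: switch_time_def zero_ereal_def)
next
  case False
  let ?S = "{t \<in> I. V (z t) = \<eta> t / 2}"
  show ?thesis
  proof (cases "?S = {}")
    case True
    then have "\<tau> = Inf (ereal ` {})" using False unfolding switch_time_def by (simp only: if_False)
    then have "\<tau> = \<infinity>" by (simp add: top_ereal_def)
    then show ?thesis by (rule never)
  next
    case nonempty: False
    then obtain s where s: "s \<in> ?S" by blast
    let ?A = "{t \<in> {0..s}. V (z t) - \<eta> t / 2 = 0}"
    have "continuous_on {0..s} (\<lambda>t. V (z t) - \<eta> t / 2)"
      using s Vz_cont[of s] \<eta>_cont' by (intro continuous_intros) auto
    then have "closed ?A" by (intro continuous_closed_preimage_constant) auto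
    moreover have "bounded ?A" by (rule bounded_subset[of "{0..s}"]) auto
    ultimately have "compact ?A" by (simp only: compact_eq_bounded_closed)
    moreover have "s \<in> ?A" using s I_nonneg by auto
    ultimately obtain m where m: "m \<in> ?A" "\<And>t. t \<in> ?A \<Longrightarrow> m \<le> t"
      using compact_attains_inf[of ?A] by blast
    have mI: "m \<in> I" using m(1) s Icc_subset[of 0 s] by auto
    have "m \<le> t" if "t \<in> ?S" for t
      using m that I_nonneg[of t] by (cases "t \<le> s") auto
    then have "Inf (ereal ` ?S) = ereal m"
      using m(1) mI by (intro Inf_eqI) auto
    then show ?thesis using False m mI by (intro at[of m]) (auto simp: switch_time_def)
  qed
qed

lemma nonzero_before_switch: "t \<in> I \<Longrightarrow> ereal t < \<tau> \<Longrightarrow> z t \<noteq> 0"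
  using V_above_before_switch[of t] \<eta>_pos[of t] I_nonneg[of t] V_0 by fastforce

lemma decay_before_switch:
  assumes "t \<in> I - N" "ereal t < \<tau>"
  shows "grad (z t) \<bullet> v t \<le> - c * V (z t) powr \<alpha> + \<bar>grad (z t) \<bullet> e_last\<bar> * max 0 (C + \<phi>\<^sub>b - \<gamma>\<^sub>m * k * t)"
proof (rule perturbed_decay[OF _ inclusion[OF assms(1)] domination(2) bounds(1)[OF assms(1)] bounds(2)[OF assms(1)] \<gamma>\<^sub>m_pos])
  show "z t \<noteq> 0" using nonzero_before_switch assms by blast
  show "\<forall>\<^sub>F y in nhds (z t). t \<le> gain \<eta> V \<tau> t y" using assms(2) by (simp add: gain_def)
qed (use assms I_nonneg in auto)

text \<open>
  The inequality \<open>\<theta> * \<eta> t < V (z t)\<close> is strict so that the barrier exceeds \<open>1 / (1 - \<theta>)\<close> on a whole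
  neighbourhood of the state, which is what the regularisation sees.
\<close>

lemma decay_near_envelope:
  assumes "t \<in> I - N" "\<tau> \<le> ereal t" "\<theta> * \<eta> t < V (z t)" "V (z t) < \<eta> t"
  shows "grad (z t) \<bullet> v t \<le> - c * V (z t) powr \<alpha>"
proof -
  let ?G = "gain \<eta> V \<tau> t"
  have t: "0 \<le> t" using assms(1) I_nonneg by auto
  have G: "?G = (\<lambda>y. barrier (\<eta> t) (V y))" using assms(2) by (auto simp: gain_def fun_eq_iff)
  have "1 / (1 - \<theta>) < ?G (z t)"
    unfolding G barrier_def using assms(3,4) \<eta>_pos[OF t] \<theta>_bounds by (simp add: field_simps)
  moreover have "isCont ?G (z t)" unfolding G by (rule isCont_barrier[OF V_isCont assms(4)])
  then have "(?G \<longlongrightarrow> ?G (z t)) (nhds (z t))"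
    using tendsto_at_iff_tendsto_nhds[of ?G "z t"] by (simp add: isCont_def)
  ultimately have "\<forall>\<^sub>F y in nhds (z t). 1 / (1 - \<theta>) < ?G y" by (rule order_tendstoD(1)[rotated])
  then have ev: "\<forall>\<^sub>F y in nhds (z t). 1 / (1 - \<theta>) \<le> ?G y" by eventually_elim simp
  have "0 < \<theta> * \<eta> t" using \<eta>_pos[OF t] \<theta>_bounds by simp
  then have "z t \<noteq> 0" using assms(3) V_0 by auto
  from perturbed_decay[OF this inclusion[OF assms(1)] domination(2) bounds(1)[OF assms(1)] bounds(2)[OF assms(1)] \<gamma>\<^sub>m_pos _ ev]
  show ?thesis using \<theta>_gain \<theta>_bounds by simp
qed

text \<open>
  As \<open>V \<ge> \<eta> T / 2\<close> up to the switch, \<open>\<partial>V/\<partial>z\<^sub>r\<close> is bounded by a multiple of \<open>V\<close>, and \<open>ln V\<close> grows at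
  most linearly. The bound holds uniformly up to a time \<open>T\<close> that may be the missing right end of \<open>I\<close>, so it
  excludes a blow-up there.
\<close>

lemma bounded_before_switch:
  assumes "0 \<le> T"
  obtains K where "\<And>t. t \<in> I \<Longrightarrow> t \<le> T \<Longrightarrow> ereal t < \<tau> \<Longrightarrow> V (z t) \<le> K"
proof -
  obtain B where B: "0 \<le> B" "\<And>z. \<eta> T / 2 \<le> V z \<Longrightarrow> \<bar>grad z \<bullet> e_last\<bar> \<le> B * V z"
    using grad_e_last_le[of "\<eta> T / 2"] \<eta>_pos[OF assms] by auto
  let ?D = "B * (C + \<phi>\<^sub>b)"
  have D: "0 \<le> ?D" using B(1) domination(1) \<phi>\<^sub>b_pos by simp
  have "V (z t) \<le> V (z 0) * exp (?D * T)" if t: "t \<in> I" "t \<le> T" "ereal t < \<tau>" for t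
  proof -
    have t0: "0 \<le> t" using I_nonneg t(1) .
    have before: "s \<in> I" "ereal s < \<tau>" if "s \<in> {0..t}" for s
      using Icc_subset[of 0 t] that t by (auto intro: order_le_less_trans[of _ "ereal t"])
    have Vpos: "0 < V (z s)" if "s \<in> {0..t}" for s
      using V_pos nonzero_before_switch before[OF that] by blast
    have "ln (V (z t)) - ln (V (z 0)) \<le> integral {0..t} (\<lambda>_. ?D)"
    proof (rule comparison[where \<psi>'="\<lambda>y. 1 / y"])
      show "(ln has_real_derivative 1 / y) (at y)" if "0 < y" for y :: real
        using that by (auto intro!: derivative_eq_intros simp: divide_inverse)
      show "1 / V (z s) * (grad (z s) \<bullet> v s) \<le> ?D" if s: "s \<in> {0<..<t} - N" for s
      proof -
        have s': "s \<in> {0..t}" using s by auto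
        note b = before[OF s']
        have "\<eta> T / 2 \<le> \<eta> s / 2" using \<eta>_antimono[of s T] s t(2) by auto
        then have "\<bar>grad (z s) \<bullet> e_last\<bar> \<le> B * V (z s)"
          using B(2)[of "z s"] V_above_before_switch[OF b] by simp
        moreover have "max 0 (C + \<phi>\<^sub>b - \<gamma>\<^sub>m * k * s) \<le> C + \<phi>\<^sub>b"
          using domination(1) \<phi>\<^sub>b_pos \<gamma>\<^sub>m_pos k_pos s by simp
        ultimately have le: "\<bar>grad (z s) \<bullet> e_last\<bar> * max 0 (C + \<phi>\<^sub>b - \<gamma>\<^sub>m * k * s) \<le> (B * V (z s)) * (C + \<phi>\<^sub>b)"
          using B(1) Vpos[OF s'] by (intro mult_mono) auto
        then have "grad (z s) \<bullet> v s \<le> ?D * V (z s)"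
        proof -
          have "0 \<le> c * V (z s) powr \<alpha>" using c_pos by simp
          moreover have "grad (z s) \<bullet> v s \<le>
              - c * V (z s) powr \<alpha> + \<bar>grad (z s) \<bullet> e_last\<bar> * max 0 (C + \<phi>\<^sub>b - \<gamma>\<^sub>m * k * s)"
            using s b by (intro decay_before_switch) auto
          ultimately have "grad (z s) \<bullet> v s \<le> (B * V (z s)) * (C + \<phi>\<^sub>b)" using le by linarith
          then show ?thesis by (simp add: mult_ac)
        qed
        then show ?thesis using Vpos[OF s'] by (simp add: field_simps)
      qed
    qed (use t t0 before nonzero_before_switch in \<open>auto intro!: continuous_intros\<close>)
    then have "ln (V (z t)) \<le> ln (V (z 0)) + ?D * t" using t0 by (simp add: mult_ac)
    also have "\<dots> \<le> ln (V (z 0)) + ?D * T" using D t(2) by (intro add_left_mono mult_left_mono)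
    finally have "exp (ln (V (z t))) \<le> exp (ln (V (z 0)) + ?D * T)" by simp
    then show ?thesis using Vpos[of t] Vpos[of 0] t0 by (simp add: exp_add)
  qed
  then show ?thesis by (rule that)
qed

text \<open>
  Suppose \<open>V > \<theta> \<eta>\<close> at time \<open>t\<close>, and let \<open>s\<close> be the last time before \<open>t\<close> with \<open>V = \<theta> \<eta>\<close>. Shortly after
  \<open>s\<close> the state is in the zone \<open>\<theta> \<eta> < V < \<eta>\<close>, where \<open>V - \<theta> \<eta>\<close> does not increase, so it cannot have become
  positive. The restriction to a short time keeps \<open>V\<close> below \<open>\<eta>\<close>, where the barrier is meaningful.
\<close>

lemma V_below_after_switch:
  assumes tb: "t\<^sub>b \<in> I" "\<tau> = ereal t\<^sub>b" "V (z t\<^sub>b) \<le> \<eta> t\<^sub>b / 2" and t: "t \<in> I" "t\<^sub>b \<le> t"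
  shows "V (z t) \<le> \<theta> * \<eta> t"
proof (rule ccontr)
  assume above: "\<not> ?thesis"
  let ?h = "\<lambda>s. V (z s) - \<theta> * \<eta> s"
  have t0: "0 \<le> t\<^sub>b" "0 \<le> t" using I_nonneg tb t by auto
  have h_cont: "continuous_on {a..b} ?h" if "0 \<le> a" "b \<le> t" for a b
    by (rule continuous_on_subset[of "{0..t}"])
       (use Vz_cont[OF t(1)] \<eta>_cont' that in \<open>auto intro!: continuous_intros\<close>)
  have "?h t\<^sub>b \<le> 0"
    using tb(3) mult_right_mono[OF \<theta>_bounds(1) less_imp_le[OF \<eta>_pos[OF t0(1)]]] by linarith
  have cross: "\<exists>s\<in>{a..t}. ?h s = 0" if "t\<^sub>b \<le> a" "a \<le> t" "?h a \<le> 0" for a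
    using IVT'[of ?h a 0 t] h_cont[of a t] that above t0 by auto
  let ?A = "{s \<in> {t\<^sub>b..t}. ?h s = 0}"
  have "closed ?A"
    using h_cont[of t\<^sub>b t] t0 by (intro continuous_closed_preimage_constant) auto
  moreover have "bounded ?A" by (rule bounded_subset[of "{t\<^sub>b..t}"]) auto
  ultimately have "compact ?A" by (simp only: compact_eq_bounded_closed)
  moreover have "?A \<noteq> {}" using cross[of t\<^sub>b] \<open>?h t\<^sub>b \<le> 0\<close> t(2) by auto
  ultimately obtain s where s: "s \<in> ?A" "\<And>x. x \<in> ?A \<Longrightarrow> x \<le> s"
    using compact_attains_sup[of ?A] by blast
  have s0: "0 \<le> s" "t\<^sub>b \<le> s" "s < t" "?h s = 0"
    using s(1) above t0 by (auto simp: less_le)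
  have above_s: "0 < ?h x" if x: "x \<in> {s<..t}" for x
  proof (rule ccontr)
    assume "\<not> 0 < ?h x"
    then obtain y where "y \<in> {x..t}" "?h y = 0" using cross[of x] x s0 by auto
    then show False using s(2)[of y] x s0 by auto
  qed
  have "\<theta> * \<eta> s < \<eta> s" using \<theta>_bounds \<eta>_pos[OF s0(1)] by simp
  then have "V (z s) - \<eta> s < 0" using s0(4) by simp
  moreover have "continuous_on {s..t} (\<lambda>x. V (z x) - \<eta> x)"
    by (rule continuous_on_subset[of "{0..t}"])
       (use Vz_cont[OF t(1)] \<eta>_cont' s0 in \<open>auto intro!: continuous_intros\<close>)
  then have "((\<lambda>x. V (z x) - \<eta> x) \<longlongrightarrow> V (z s) - \<eta> s) (at s within {s..t})"
    using s0(3) by (simp add: continuous_on_def)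
  ultimately have "\<forall>\<^sub>F x in at s within {s..t}. V (z x) - \<eta> x < 0"
    by (intro order_tendstoD(2))
  then obtain \<delta> where \<delta>: "0 < \<delta>" "\<And>x. x \<in> {s..t} \<Longrightarrow> dist x s < \<delta> \<Longrightarrow> V (z x) - \<eta> x < 0"
    using \<open>V (z s) - \<eta> s < 0\<close> unfolding eventually_at by (metis)
  define b where "b = min t (s + \<delta> / 2)"
  have b: "s < b" "b \<le> t" "b \<in> I" using s0 \<delta>(1) Icc_subset[of 0 t] t by (auto simp: b_def)
  have below: "V (z x) < \<eta> x" if "x \<in> {s..b}" for x
    using \<delta>(2)[of x] that b \<delta>(1) by (auto simp: b_def dist_real_def)
  have sub: "{s..b} \<subseteq> {0..}" using s0 by auto
  have int: "((\<lambda>x. \<theta> * \<eta>' x) has_integral \<theta> * \<eta> b - \<theta> * \<eta> s) {s..b}"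
    using b(1) \<eta>_deriv s0(1)
    by (intro fundamental_theorem_of_calculus)
       (auto simp: has_real_derivative_iff_has_vector_derivative[symmetric]
         intro!: DERIV_cmult DERIV_subset[OF \<eta>_deriv sub])
  have "V (z b) - V (z s) \<le> integral {s..b} (\<lambda>x. \<theta> * \<eta>' x)"
  proof (rule comparison[where \<psi>="\<lambda>y. y" and \<psi>'="\<lambda>_. 1"])
    show "z x \<noteq> 0" if "x \<in> {s..b}" for x
    proof -
      have "0 \<le> ?h x" using above_s[of x] s0(4) that b by (cases "x = s") auto
      moreover have "0 < \<theta> * \<eta> x" using \<eta>_pos[of x] \<theta>_bounds that s0 by simp
      ultimately have "0 < V (z x)" by simp
      then show ?thesis using V_0 by auto
    qed
    show "1 * (grad (z x) \<bullet> v x) \<le> \<theta> * \<eta>' x" if x: "x \<in> {s<..<b} - N" for x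
    proof -
      have x0: "0 \<le> x" "x \<in> I" "t\<^sub>b \<le> x" using x s0 b Icc_subset[of 0 b] by auto
      have "\<theta> * \<eta> x < V (z x)" using above_s[of x] x b by auto
      then have "grad (z x) \<bullet> v x \<le> - c * V (z x) powr \<alpha>"
        using x x0 tb(2) below[of x] by (intro decay_near_envelope) auto
      also have "\<dots> \<le> \<theta> * \<eta>' x"
        using \<open>\<theta> * \<eta> x < V (z x)\<close> by (intro decay_beats_envelope x0) auto
      finally show ?thesis by simp
    qed
  qed (use s0 b int in auto)
  also have "\<dots> = \<theta> * \<eta> b - \<theta> * \<eta> s" using int by (rule integral_unique)
  finally show False using above_s[of b] b s0(4) by simp
qed

lemma velocity_bounded:
  assumes T: "0 \<le> T"
  obtains B where "0 \<le> B" "\<And>t. t \<in> I - N \<Longrightarrow> t \<le> T \<Longrightarrow> norm (v t) \<le> B"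
proof -
  obtain K where K: "\<And>t. t \<in> I \<Longrightarrow> t \<le> T \<Longrightarrow> ereal t < \<tau> \<Longrightarrow> V (z t) \<le> K"
    using bounded_before_switch[OF T] by blast
  let ?K = "{x. V x \<le> max K (\<eta> 0)}" and ?\<Gamma> = "T + (1 / (1 - \<theta>) + 1)"
  have \<Gamma>: "0 \<le> ?\<Gamma>" using T \<theta>_bounds by simp
  obtain B where B: "0 \<le> B"
    "\<And>x a b G v. x \<in> ?K \<Longrightarrow> \<bar>a\<bar> \<le> \<phi>\<^sub>b \<Longrightarrow> \<bar>b\<bar> \<le> \<gamma>\<^sub>M \<Longrightarrow> \<forall>\<^sub>F y in nhds x. \<bar>G y\<bar> \<le> ?\<Gamma> \<Longrightarrow>
      v \<in> filippov (loop_field u\<^sub>0 g k a b G) x \<Longrightarrow> norm v \<le> B"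
    by (rule velocity_bound[OF u0_bdd compact_sublevel[of "max K (\<eta> 0)"] less_imp_le[OF \<phi>\<^sub>b_pos] less_imp_le[OF \<gamma>\<^sub>M_pos] \<Gamma>]) blast
  have "norm (v t) \<le> B" if t: "t \<in> I - N" "t \<le> T" for t
  proof -
    have t0: "0 \<le> t" "t \<in> I" using t I_nonneg by auto
    have ab: "\<bar>\<phi> t\<bar> \<le> \<phi>\<^sub>b" "\<bar>\<gamma> t\<bar> \<le> \<gamma>\<^sub>M" using bounds[OF t(1)] \<gamma>\<^sub>m_pos by auto
    have "z t \<in> ?K \<and> (\<forall>\<^sub>F y in nhds (z t). \<bar>gain \<eta> V \<tau> t y\<bar> \<le> ?\<Gamma>)"
    proof (cases "ereal t < \<tau>")
      case True
      moreover have "0 \<le> 1 / (1 - \<theta>)" using \<theta>_bounds by simp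
      then have "\<bar>t\<bar> \<le> ?\<Gamma>" using t t0 by linarith
      ultimately show ?thesis using K[of t] t t0 by (simp add: gain_def le_max_iff_disj)
    next
      case False
      then obtain t\<^sub>b where tb: "t\<^sub>b \<in> I" "\<tau> = ereal t\<^sub>b" "V (z t\<^sub>b) \<le> \<eta> t\<^sub>b / 2"
        by (cases rule: switch_time_cases) auto
      have le: "V (z t) \<le> \<theta> * \<eta> t" using False tb t0 by (intro V_below_after_switch[OF tb]) auto
      have \<eta>: "0 < \<eta> t" "\<eta> t \<le> \<eta> 0" using \<eta>_pos \<eta>_antimono t0 by auto
      have lt: "V (z t) < \<eta> t" using le mult_strict_right_mono[OF \<theta>_bounds(2) \<eta>(1)] by simp
      let ?G = "\<lambda>y. barrier (\<eta> t) (V y)"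
      have G: "gain \<eta> V \<tau> t = ?G" using False by (auto simp: gain_def fun_eq_iff)
      have "0 < ?G (z t)" using lt \<eta> by (simp add: barrier_def)
      moreover have "?G (z t) \<le> 1 / (1 - \<theta>)"
        unfolding barrier_def using le lt \<eta> \<theta>_bounds by (simp add: field_simps)
      moreover have "isCont (\<lambda>y. \<bar>?G y\<bar>) (z t)" by (intro continuous_intros isCont_barrier[OF V_isCont lt])
      then have "((\<lambda>y. \<bar>?G y\<bar>) \<longlongrightarrow> \<bar>?G (z t)\<bar>) (nhds (z t))"
        using tendsto_at_iff_tendsto_nhds[of "\<lambda>y. \<bar>?G y\<bar>" "z t"] by (simp add: isCont_def)
      ultimately have "\<forall>\<^sub>F y in nhds (z t). \<bar>?G y\<bar> < ?\<Gamma>"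
        using T by (intro order_tendstoD(2)) auto
      then have "\<forall>\<^sub>F y in nhds (z t). \<bar>?G y\<bar> \<le> ?\<Gamma>" by eventually_elim simp
      then show ?thesis using lt \<eta> unfolding G by auto
    qed
    then show ?thesis using B(2) ab inclusion[OF t(1)] by blast
  qed
  then show ?thesis using B(1) that by blast
qed

text \<open>
  Once \<open>t \<ge> (C + \<phi>\<^sub>b) / (\<gamma>\<^sub>m k)\<close>, the power \<open>V\<^sup>1\<^sup>-\<^sup>\<alpha>\<close> decreases at least at the rate \<open>c (1 - \<alpha>)\<close>; were there
  no switch, it would become negative.
\<close>

lemma switch_time_finite:
  assumes "I = {0..}"
  shows "\<tau> \<noteq> \<infinity>"
proof
  assume never: "\<tau> = \<infinity>"
  define a where "a = (C + \<phi>\<^sub>b) / (\<gamma>\<^sub>m * k)"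
  have a: "0 \<le> a" "\<gamma>\<^sub>m * k * a = C + \<phi>\<^sub>b"
    using domination(1) \<phi>\<^sub>b_pos \<gamma>\<^sub>m_pos k_pos by (auto simp: a_def)
  define q where "q = c * (1 - \<alpha>)"
  have q: "0 < q" using c_pos \<alpha>_bounds by (simp add: q_def)
  \<comment> \<open>late enough for the bound on \<open>V\<^sup>1\<^sup>-\<^sup>\<alpha>\<close> to be \<open>-1\<close>\<close>
  define b where "b = a + (V (z a) powr (1 - \<alpha>) + 1) / q"
  have b: "a \<le> b" using q by (simp add: b_def)
  have pos: "0 < V (z t)" if "0 \<le> t" for t
    using nonzero_before_switch[of t] never that assms by (intro V_pos) simp
  have "V (z b) powr (1 - \<alpha>) - V (z a) powr (1 - \<alpha>) \<le> integral {a..b} (\<lambda>_. - q)"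
  proof (rule comparison[where \<psi>="\<lambda>y. y powr (1 - \<alpha>)" and \<psi>'="\<lambda>y. (1 - \<alpha>) * y powr (- \<alpha>)"])
    show "((\<lambda>y. y powr (1 - \<alpha>)) has_real_derivative (1 - \<alpha>) * y powr - \<alpha>) (at y)" if "0 < y" for y
      using that by (auto intro!: derivative_eq_intros)
    show "z t \<noteq> 0" if "t \<in> {a..b}" for t using nonzero_before_switch[of t] never that assms a by simp
    show "(1 - \<alpha>) * V (z t) powr - \<alpha> * (grad (z t) \<bullet> v t) \<le> - q" if t: "t \<in> {a<..<b} - N" for t
    proof -
      have "\<gamma>\<^sub>m * k * a \<le> \<gamma>\<^sub>m * k * t" using t \<gamma>\<^sub>m_pos k_pos by (intro mult_left_mono) auto
      then have "grad (z t) \<bullet> v t \<le> - c * V (z t) powr \<alpha>"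
        using decay_before_switch[of t] t a never assms by simp
      then have "(1 - \<alpha>) * V (z t) powr - \<alpha> * (grad (z t) \<bullet> v t) \<le> (1 - \<alpha>) * V (z t) powr - \<alpha> * (- c * V (z t) powr \<alpha>)"
        using \<alpha>_bounds by (intro mult_left_mono) auto
      also have "\<dots> = - q" using pos[of t] t a by (simp add: q_def powr_minus field_simps)
      finally show ?thesis .
    qed
  qed (use a b assms in \<open>auto intro!: continuous_intros\<close>)
  also have "\<dots> = - (V (z a) powr (1 - \<alpha>) + 1)" using b q by (simp add: b_def)
  finally have "V (z b) powr (1 - \<alpha>) \<le> -1" by simp
  then show False using powr_ge_zero[of "V (z b)" "1 - \<alpha>"] by linarith
qed

end

lemma closed_loop_trajectory_iff:
  "closed_loop_trajectory \<phi> \<gamma> u\<^sub>0 V g k \<eta> I z \<longleftrightarrow>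
    is_interval I \<and> 0 \<in> I \<and> I \<subseteq> {0..} \<and>
    (\<exists>v. (\<forall>T\<in>I. v absolutely_integrable_on {0..T} \<and> z T = z 0 + integral {0..T} v) \<and>
      (\<exists>N. negligible N \<and> (\<forall>t\<in>I - N.
        v t \<in> filippov (loop_field u\<^sub>0 g k (\<phi> t) (\<gamma> t) (gain \<eta> V (switch_time \<eta> V I z) t)) (z t))))"
proof (cases "is_interval I")
  case True
  then have "I \<in> sets lebesgue" by (intro sets_completionI_sets) (simp add: real_interval_borel_measurable)
  then show ?thesis
    unfolding closed_loop_trajectory_def filippov_solution_def loop_field_eq_feedback
    by (simp only: AE_lebesgue_on_iff_negligible)
qed (simp add: closed_loop_trajectory_def filippov_solution_def)

section \<open>Continuation of trajectories\<close>

lemma nonneg_interval_cases: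
  fixes I :: "real set"
  assumes "is_interval I" "0 \<in> I" "I \<subseteq> {0..}"
  obtains (all) "I = {0..}" | (half_open) T where "0 < T" "I = {0..<T}" | (closed) T where "0 \<le> T" "I = {0..T}"
proof (cases "bdd_above I")
  case False
  have "I = {0..}"
  proof (intro equalityI assms(3) subsetI)
    fix t :: real assume t: "t \<in> {0..}"
    obtain s where "s \<in> I" "t < s" using False unfolding bdd_above_def by (meson not_le)
    then show "t \<in> I" using mem_is_interval_1_I[OF assms(1,2), of s t] t by auto
  qed
  then show ?thesis by (rule all)
next
  case True
  let ?T = "Sup I"
  have le: "t \<le> ?T" if "t \<in> I" for t using that True by (rule cSup_upper)
  have lt: "t \<in> I" if t: "0 \<le> t" "t < ?T" for t
  proof -
    obtain s where "s \<in> I" "t < s" using less_cSup_iff[of I t] t assms(2) True by auto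
    then show ?thesis using mem_is_interval_1_I[OF assms(1,2), of s t] t by auto
  qed
  show ?thesis
  proof (cases "?T \<in> I")
    case True
    then have "I = {0..?T}" using le lt assms by (auto simp: le_less)
    then show ?thesis using closed[of ?T] le[OF assms(2)] by blast
  next
    case False
    have ne: "t \<noteq> ?T" if "t \<in> I" for t using that False by blast
    have "I = {0..<?T}"
    proof (intro equalityI subsetI)
      fix t assume "t \<in> I"
      then show "t \<in> {0..<?T}" using le[of t] ne[of t] assms(3) by auto
    qed (use lt in auto)
    moreover have "0 < ?T" using ne[OF assms(2)] le[OF assms(2)] by simp
    ultimately show ?thesis using half_open by blast
  qed
qed

text \<open>
  Apply dominated convergence to the truncations of \<open>v\<close> to \<open>[a, s n]\<close>, with \<open>s n\<close> tending to \<open>b\<close>.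
\<close>

lemma absolutely_integrable_up_to_endpoint:
  fixes v :: "real \<Rightarrow> 'a::euclidean_space"
  assumes int: "\<And>t. a \<le> t \<Longrightarrow> t < b \<Longrightarrow> v absolutely_integrable_on {a..t}" and N: "negligible N"
    and bdd: "\<And>t. t \<in> {a..<b} - N \<Longrightarrow> norm (v t) \<le> B" and B: "0 \<le> B" and ab: "a < b"
  shows "v absolutely_integrable_on {a..b}"
proof -
  define w where "w t = (if t \<in> N \<union> {b} then 0 else v t)" for t
  define s where "s n = b - (b - a) / (real n + 1)" for n :: nat
  have s: "a \<le> s n" "s n < b" for n :: nat
  proof -
    have "(b - a) / (real n + 1) \<le> (b - a) / 1" using ab by (intro divide_left_mono) auto
    then show "a \<le> s n" by (simp add: s_def)
    show "s n < b" using ab by (simp add: s_def)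
  qed
  have "s \<longlonglongrightarrow> b - 0" unfolding s_def
    using LIMSEQ_Suc[OF lim_const_over_n[of "b - a"]] by (intro tendsto_intros) (simp add: add.commute)
  then have slim: "s \<longlonglongrightarrow> b" by simp
  let ?f = "\<lambda>n t. if t \<in> {a..s n} then w t else 0"
  have "w integrable_on {a..b}"
  proof (rule dominated_convergence(1)[where f="?f" and h="\<lambda>_. B"])
    show "?f n integrable_on {a..b}" for n
    proof -
      have "v integrable_on {a..s n}" using int[OF s] by (simp add: absolutely_integrable_on_def)
      then have "w integrable_on {a..s n}"
        by (rule integrable_spike[of _ _ "N \<union> {b}"]) (use N in \<open>auto simp: w_def\<close>)
      moreover have "{a..s n} \<inter> {a..b} = {a..s n}" using s[of n] by auto
      ultimately show ?thesis by (simp only: integrable_restrict_Int)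
    qed
    show "norm (?f n t) \<le> B" if "t \<in> {a..b}" for n t
      using bdd[of t] B that by (auto simp: w_def less_le)
    show "(\<lambda>n. ?f n t) \<longlonglongrightarrow> w t" if t: "t \<in> {a..b}" for t
    proof (cases "t = b")
      case True
      then have "w t = 0" by (simp add: w_def)
      then have "?f n t = w t" for n by simp
      then show ?thesis by simp
    next
      case False
      then have "\<forall>\<^sub>F n in sequentially. t < s n" using t by (intro order_tendstoD(1)[OF slim]) auto
      then have "\<forall>\<^sub>F n in sequentially. ?f n t = w t" by eventually_elim (use t in auto)
      then show ?thesis by (rule tendsto_eventually)
    qed
  qed auto
  then have "w absolutely_integrable_on {a..b}"
    by (intro absolutely_integrable_integrable_bound[where g="\<lambda>_. B"]) (use bdd B in \<open>auto simp: w_def less_le\<close>)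
  then show ?thesis
    by (rule absolutely_integrable_spike[of _ _ "N \<union> {b}"]) (use N in \<open>auto simp: w_def\<close>)
qed

context trajectory
begin

text \<open>
  The velocity is bounded, hence integrable up to \<open>T\<close>. Adding the endpoint may turn an infinite switching
  time into \<open>T\<close> itself, but this leaves the gain at all times before \<open>T\<close> unchanged.
\<close>

lemma extends_to_closure:
  assumes I_eq: "I = {0..<T}" and T: "0 < T"
  obtains z' where "closed_loop_trajectory \<phi> \<gamma> u\<^sub>0 V g k \<eta> {0..T} z'" "\<And>t. t \<in> I \<Longrightarrow> z' t = z t"
proof -
  obtain B where B: "0 \<le> B" "\<And>t. t \<in> I - N \<Longrightarrow> t \<le> T \<Longrightarrow> norm (v t) \<le> B"
    using velocity_bounded[of T] T by auto
  have vT: "v absolutely_integrable_on {0..T}"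
    by (rule absolutely_integrable_up_to_endpoint[OF v_int N _ B(1) T]) (use B(2) I_eq in auto)
  define z' where "z' t = z 0 + integral {0..t} v" for t
  have agree: "z' t = z t" if "t \<in> I" for t using z_eq[OF that] by (simp add: z'_def)
  let ?\<tau> = "switch_time \<eta> V {0..T} z'"
  have before: "ereal t < ?\<tau> \<longleftrightarrow> ereal t < \<tau>" if t: "t \<in> I" for t
  proof (cases rule: switch_time_cases)
    case never
    have "ereal T \<le> ?\<tau>"
    proof -
      have "\<not> V (z 0) \<le> \<eta> 0 / 2" using never by (auto simp: switch_time_def)
      moreover have "T \<le> s" if "s \<in> {0..T}" "V (z' s) = \<eta> s / 2" for s
        using V_above_before_switch[of s] never that agree[of s] I_eq by (cases "s < T") auto
      ultimately show ?thesis
        using agree[OF I(2)] by (auto simp: switch_time_def intro!: Inf_greatest)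
    qed
    moreover have "ereal t < ereal T" using t I_eq by simp
    ultimately have "ereal t < ?\<tau>" by (rule order_less_le_trans[rotated])
    then show ?thesis using never by simp
  next
    case (at t\<^sub>b)
    have "?\<tau> = \<tau>"
      by (rule switch_time_extend) (use I(2) I_eq at agree in auto)
    then show ?thesis by simp
  qed
  have "closed_loop_trajectory \<phi> \<gamma> u\<^sub>0 V g k \<eta> {0..T} z'"
    unfolding closed_loop_trajectory_iff
  proof (intro conjI exI[of _ v] exI[of _ "N \<union> {T}"] ballI)
    show "v absolutely_integrable_on {0..s}" if "s \<in> {0..T}" for s
      by (rule absolutely_integrable_on_subinterval[OF vT]) (use that in auto)
    show "z' s = z' 0 + integral {0..s} v" for s by (simp add: z'_def)
    fix t assume t: "t \<in> {0..T} - (N \<union> {T})"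
    then have tI: "t \<in> I - N" using I_eq by auto
    have "gain \<eta> V ?\<tau> t = gain \<eta> V \<tau> t"
      using before[of t] tI by (auto simp: gain_def fun_eq_iff)
    then show "v t \<in> filippov (loop_field u\<^sub>0 g k (\<phi> t) (\<gamma> t) (gain \<eta> V ?\<tau> t)) (z' t)"
      using inclusion[OF tI] agree[of t] tI by simp
  qed (use T N in auto)
  then show ?thesis using agree by (rule that)
qed

text \<open>
  Either the switch has not occurred, and the gain does not depend on the state; or it has occurred, and
  \<open>V \<le> \<theta> \<eta>\<close> separates \<open>V\<close> from \<open>\<eta>\<close> near the endpoint. In the first case \<open>V\<close> stays above \<open>\<eta> / 2\<close> for a
  while, so the continuation creates no switching time.
\<close>

lemma gain_regular_near_endpoint:
  assumes T: "T \<in> I" "\<And>t. t \<in> I \<Longrightarrow> t \<le> T"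
  obtains \<rho> h \<Gamma> where "0 < \<rho>" "0 < h" "0 \<le> \<Gamma>"
    and "\<And>t x. t \<in> {T..T + h} \<Longrightarrow> x \<in> cball (z T) \<rho> \<Longrightarrow>
      isCont (gain \<eta> V \<tau> t) x \<and> \<bar>gain \<eta> V \<tau> t x\<bar> \<le> \<Gamma> \<and> (\<tau> = \<infinity> \<longrightarrow> \<eta> t / 2 < V x)"
    and "\<And>x. x \<in> cball (z T) \<rho> \<Longrightarrow> continuous_on {T..T + h} (\<lambda>t. gain \<eta> V \<tau> t x)"
proof -
  have T0: "0 \<le> T" using I_nonneg T(1) by simp
  have V_lim: "(V \<longlongrightarrow> V (z T)) (nhds (z T))"
    using V_isCont[of "z T"] tendsto_at_iff_tendsto_nhds[of V "z T"] by (simp add: isCont_def)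
  have cball_of: "\<exists>\<rho>>0. \<forall>x\<in>cball (z T) \<rho>. P x" if P: "\<forall>\<^sub>F x in nhds (z T). P x" for P
  proof -
    obtain r where r: "0 < r" "\<And>x. dist x (z T) < r \<Longrightarrow> P x" using P unfolding eventually_nhds_metric by blast
    then show ?thesis by (intro exI[of _ "r / 2"]) (auto simp: dist_commute)
  qed
  show ?thesis
  proof (cases rule: switch_time_cases)
    case never
    have "\<eta> T / 2 < V (z T)" using V_above_before_switch[OF T(1)] never by simp
    from cball_of[OF order_tendstoD(1)[OF V_lim this]]
    obtain \<rho> where \<rho>: "0 < \<rho>" "\<And>x. x \<in> cball (z T) \<rho> \<Longrightarrow> \<eta> T / 2 < V x" by blast
    have G: "gain \<eta> V \<tau> t = (\<lambda>_. t)" for t by (simp add: gain_def never fun_eq_iff)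
    show ?thesis
    proof (rule that[of \<rho> 1 "T + 1"])
      fix t x assume t: "t \<in> {T..T + 1}" and x: "x \<in> cball (z T) \<rho>"
      have "\<eta> t \<le> \<eta> T" using \<eta>_antimono t T0 by auto
      then show "isCont (gain \<eta> V \<tau> t) x \<and> \<bar>gain \<eta> V \<tau> t x\<bar> \<le> T + 1 \<and> (\<tau> = \<infinity> \<longrightarrow> \<eta> t / 2 < V x)"
        unfolding G using \<rho>(2)[OF x] t T0 by auto
    qed (use \<rho>(1) T0 in \<open>auto simp: G intro: continuous_on_id\<close>)
  next
    case (at t\<^sub>b)
    have tb: "t\<^sub>b \<le> T" using at(1) T(2) by simp
    have "V (z T) \<le> \<theta> * \<eta> T" by (rule V_below_after_switch[OF at T(1) tb])
    also have "\<dots> < \<eta> T" using \<theta>_bounds \<eta>_pos[OF T0] by simp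
    finally have lt: "V (z T) < \<eta> T" .
    \<comment> \<open>two levels between \<open>V (z T)\<close> and \<open>\<eta> T\<close>: near the endpoint \<open>V < q1\<close> and \<open>q2 < \<eta>\<close>\<close>
    define q1 where "q1 = (2 * V (z T) + \<eta> T) / 3"
    define q2 where "q2 = (V (z T) + 2 * \<eta> T) / 3"
    have q: "V (z T) < q1" "q1 < q2" "q2 < \<eta> T" using lt by (auto simp: q1_def q2_def)
    from cball_of[OF order_tendstoD(2)[OF V_lim q(1)]]
    obtain \<rho> where \<rho>: "0 < \<rho>" "\<And>x. x \<in> cball (z T) \<rho> \<Longrightarrow> V x < q1" by blast
    have "(\<eta> \<longlongrightarrow> \<eta> T) (at T within {0..})" using \<eta>_cont T0 by (simp add: continuous_on_def)
    from order_tendstoD(1)[OF this q(3)]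
    obtain r where r: "0 < r" "\<And>t. t \<in> {0..} \<Longrightarrow> t \<noteq> T \<Longrightarrow> dist t T < r \<Longrightarrow> q2 < \<eta> t"
      unfolding eventually_at by blast
    have \<eta>q: "q2 < \<eta> t" if "t \<in> {T..T + r / 2}" for t
      using r(2)[of t] r(1) that T0 q(3) by (cases "t = T") (auto simp: dist_real_def)
    have G: "gain \<eta> V \<tau> t = (\<lambda>y. barrier (\<eta> t) (V y))" if "t \<in> {T..T + r / 2}" for t
      using at(2) tb that by (auto simp: gain_def fun_eq_iff)
    show ?thesis
    proof (rule that[of \<rho> "r / 2" "\<eta> 0 / (q2 - q1)"])
      show "0 \<le> \<eta> 0 / (q2 - q1)" using q \<eta>_pos[of 0] by simp
      show "continuous_on {T..T + r / 2} (\<lambda>t. gain \<eta> V \<tau> t x)" if x: "x \<in> cball (z T) \<rho>" for x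
      proof -
        have "continuous_on {T..T + r / 2} (\<lambda>t. barrier (\<eta> t) (V x))"
          unfolding barrier_def
          by (intro continuous_intros continuous_on_subset[OF \<eta>_cont]) (use T0 \<eta>q \<rho>(2)[OF x] q in force)+
        then show ?thesis by (rule continuous_on_eq) (simp add: G)
      qed
      fix t x assume t: "t \<in> {T..T + r / 2}" and x: "x \<in> cball (z T) \<rho>"
      have d: "q2 - q1 \<le> \<eta> t - V x" using \<eta>q[OF t] \<rho>(2)[OF x] by simp
      have \<eta>: "0 < \<eta> t" "\<eta> t \<le> \<eta> 0" using \<eta>_pos \<eta>_antimono t T0 by auto
      have "\<bar>barrier (\<eta> t) (V x)\<bar> \<le> \<eta> 0 / (q2 - q1)"
        unfolding barrier_def abs_divide using d q \<eta> by (intro frac_le) auto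
      moreover have "isCont (\<lambda>y. barrier (\<eta> t) (V y)) x"
        using d q by (intro isCont_barrier V_isCont) simp
      ultimately show "isCont (gain \<eta> V \<tau> t) x \<and> \<bar>gain \<eta> V \<tau> t x\<bar> \<le> \<eta> 0 / (q2 - q1) \<and> (\<tau> = \<infinity> \<longrightarrow> \<eta> t / 2 < V x)"
        unfolding G[OF t] using at(2) by simp
    qed (use \<rho> r in auto)
  qed
qed

text \<open>
  Solve the inclusion from \<open>z T\<close> with the switching time of the given trajectory, and check afterwards
  that the concatenation has this same switching time.
\<close>

lemma extends_beyond_endpoint:
  assumes I_eq: "I = {0..T}"
  obtains h z' where "0 < h" "closed_loop_trajectory \<phi> \<gamma> u\<^sub>0 V g k \<eta> {0..T + h} z'" "\<And>t. t \<in> I \<Longrightarrow> z' t = z t"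
proof -
  have T: "T \<in> I" "\<And>t. t \<in> I \<Longrightarrow> t \<le> T" "0 \<le> T" using I_eq I(2) by auto
  obtain \<rho> h\<^sub>1 \<Gamma> where \<rho>: "0 < \<rho>" "0 < h\<^sub>1" "0 \<le> \<Gamma>"
    and gain: "\<And>t x. t \<in> {T..T + h\<^sub>1} \<Longrightarrow> x \<in> cball (z T) \<rho> \<Longrightarrow>
      isCont (gain \<eta> V \<tau> t) x \<and> \<bar>gain \<eta> V \<tau> t x\<bar> \<le> \<Gamma> \<and> (\<tau> = \<infinity> \<longrightarrow> \<eta> t / 2 < V x)"
    and gain_cont: "\<And>x. x \<in> cball (z T) \<rho> \<Longrightarrow> continuous_on {T..T + h\<^sub>1} (\<lambda>t. gain \<eta> V \<tau> t x)"
    by (rule gain_regular_near_endpoint[OF T(1,2)]) blast+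
  have \<Gamma>1: "0 \<le> \<Gamma> + 1" using \<rho>(3) by simp
  obtain L where L: "0 \<le> L"
    "\<And>x a b G v. x \<in> cball (z T) \<rho> \<Longrightarrow> \<bar>a\<bar> \<le> \<phi>\<^sub>b \<Longrightarrow> \<bar>b\<bar> \<le> \<gamma>\<^sub>M \<Longrightarrow> \<forall>\<^sub>F y in nhds x. \<bar>G y\<bar> \<le> \<Gamma> + 1 \<Longrightarrow>
      v \<in> filippov (loop_field u\<^sub>0 g k a b G) x \<Longrightarrow> norm v \<le> L"
    by (rule velocity_bound[OF u0_bdd compact_cball[of "z T" \<rho>] less_imp_le[OF \<phi>\<^sub>b_pos] less_imp_le[OF \<gamma>\<^sub>M_pos] \<Gamma>1]) blast
  define h where "h = min h\<^sub>1 (\<rho> / (L + 1))"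
  have h: "0 < h" "h \<le> h\<^sub>1" using \<rho> L(1) by (auto simp: h_def)
  have "L * h \<le> (L + 1) * (\<rho> / (L + 1))" using L(1) h \<rho> by (intro mult_mono) (auto simp: h_def)
  then have Lh: "L * (T + h - T) \<le> \<rho>" using L(1) by simp
  let ?R = "\<lambda>t. loop_field u\<^sub>0 g k (\<phi> t) (\<gamma> t) (gain \<eta> V \<tau> t)"
  have sel: "\<exists>f N. f \<in> borel_measurable (lebesgue_on {T..T + h}) \<and> (\<forall>t. norm (f t) \<le> L) \<and> negligible N \<and>
      (\<forall>t\<in>{T..T + h} - N. f t \<in> filippov (?R t) x)" if x: "x \<in> cball (z T) \<rho>" for x
  proof -
    obtain P s where Ps: "\<And>a b G. isCont G x \<Longrightarrow> chain_field (a + b * (P + k * s * G x)) x \<in> filippov (loop_field u\<^sub>0 g k a b G) x"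
      using filippov_selection[OF u0_bdd] by blast
    \<comment> \<open>outside the times at which the perturbations obey their bounds the selection is set to \<open>0\<close>, so that it is bounded everywhere\<close>
    let ?good = "\<lambda>t. T \<le> t \<and> t \<le> T + h \<and> \<bar>\<phi> t\<bar> \<le> \<phi>\<^sub>b \<and> \<gamma>\<^sub>m \<le> \<gamma> t \<and> \<gamma> t \<le> \<gamma>\<^sub>M"
    define f where "f t = (if ?good t then chain_field (\<phi> t + \<gamma> t * (P + k * s * gain \<eta> V \<tau> t x)) x else 0)" for t
    have f_in: "f t \<in> filippov (?R t) x" if "?good t" for t
      using that gain[OF _ x, of t] h(2) by (auto simp: f_def intro!: Ps)
    have "norm (f t) \<le> L" for t
    proof (cases "?good t")
      case True
      let ?G = "gain \<eta> V \<tau> t"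
      have G: "isCont ?G x" "\<bar>?G x\<bar> \<le> \<Gamma>" using gain[OF _ x, of t] h(2) True by auto
      have "isCont (\<lambda>y. \<bar>?G y\<bar>) x" by (intro continuous_intros G)
      then have "((\<lambda>y. \<bar>?G y\<bar>) \<longlongrightarrow> \<bar>?G x\<bar>) (nhds x)"
        using tendsto_at_iff_tendsto_nhds[of "\<lambda>y. \<bar>?G y\<bar>" x] by (simp add: isCont_def)
      then have "\<forall>\<^sub>F y in nhds x. \<bar>?G y\<bar> < \<Gamma> + 1" by (rule order_tendstoD(2)) (use G in simp)
      then have ev: "\<forall>\<^sub>F y in nhds x. \<bar>?G y\<bar> \<le> \<Gamma> + 1" by eventually_elim simp
      have "\<bar>\<gamma> t\<bar> \<le> \<gamma>\<^sub>M" using True \<gamma>\<^sub>m_pos by simp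
      then show ?thesis using L(2)[OF x _ _ ev f_in[OF True]] True by blast
    next
      case False
      then show ?thesis unfolding f_def if_not_P[OF False] using L(1) by simp
    qed
    moreover have "f \<in> borel_measurable (lebesgue_on {T..T + h})"
    proof -
      have sub: "{T..T + h} \<subseteq> {0..}" using T(3) by auto
      have [measurable]: "\<phi> \<in> borel_measurable (lebesgue_on {T..T + h})" "\<gamma> \<in> borel_measurable (lebesgue_on {T..T + h})"
        by (rule measurable_restrict_mono[OF _ sub], rule \<phi>_measurable \<gamma>_measurable)+
      have [measurable]: "(\<lambda>t. t) \<in> borel_measurable (lebesgue_on {T..T + h})"
        by (intro continuous_imp_measurable_on_sets_lebesgue continuous_on_id) auto
      have [measurable]: "(\<lambda>t. gain \<eta> V \<tau> t x) \<in> borel_measurable (lebesgue_on {T..T + h})"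
        by (intro continuous_imp_measurable_on_sets_lebesgue continuous_on_subset[OF gain_cont[OF x]]) (use h in auto)
      show ?thesis unfolding f_def chain_field_def by measurable
    qed
    moreover have "\<forall>t\<in>{T..T + h} - N. f t \<in> filippov (?R t) x"
    proof
      fix t assume "t \<in> {T..T + h} - N"
      then show "f t \<in> filippov (?R t) x" using bounds_ae[of t] T(3) by (intro f_in) auto
    qed
    ultimately show ?thesis using N by blast
  qed
  obtain v2 N2 where v2: "v2 \<in> borel_measurable (lebesgue_on {T..T + h})" "\<And>t. norm (v2 t) \<le> L" "negligible N2"
    and incl2: "\<And>t. t \<in> {T..T + h} - N2 \<Longrightarrow> v2 t \<in> filippov (?R t) (z T + integral {T..t} v2)"
    by (rule filippov_local_existence[OF _ Lh L(1) sel]) (use h in auto)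
  have v2_int: "v2 absolutely_integrable_on {T..t}" if "t \<le> T + h" for t
    using bounded_measurable_abs_integrable[OF v2(1,2) order_refl that] .
  define v' where "v' t = (if t \<le> T then v t else v2 t)" for t
  define z' where "z' t = z 0 + integral {0..t} v'" for t
  have v'_low: "integral {0..t} v' = integral {0..t} v" if "t \<le> T" for t
    using that by (intro integral_cong) (auto simp: v'_def)
  have v'_int1: "v' absolutely_integrable_on {0..t}" if "t \<in> {0..T}" for t
    by (rule absolutely_integrable_spike[OF v_int, of t "{}"]) (use that I_eq in \<open>auto simp: v'_def\<close>)
  have v'_int2: "v' absolutely_integrable_on {T..t}" if "t \<le> T + h" for t
    by (rule absolutely_integrable_spike[OF v2_int[OF that], of "{T}"]) (auto simp: v'_def)
  have v'_int: "v' absolutely_integrable_on {0..t}" if "t \<in> {0..T + h}" for t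
  proof (cases "t \<le> T")
    case False
    then show ?thesis
      using that T(3) by (intro absolutely_integrable_on_combine[OF v'_int1[of T] v'_int2[of t]]) auto
  qed (use that v'_int1 in auto)
  have agree: "z' t = z t" if "t \<in> I" for t
    using z_eq[OF that] v'_low[of t] T(2)[OF that] by (simp add: z'_def)
  have z'_high: "z' t = z T + integral {T..t} v2" if t: "t \<in> {T..T + h}" for t
  proof -
    have "v' integrable_on {0..t}" using v'_int[of t] t T(3) by (simp add: absolutely_integrable_on_def)
    then have "integral {0..T} v' + integral {T..t} v' = integral {0..t} v'"
      using t T(3) by (intro Henstock_Kurzweil_Integration.integral_combine) auto
    moreover have "integral {T..t} v' = integral {T..t} v2"
      by (rule integral_spike[of "{T}"]) (auto simp: v'_def)
    ultimately show ?thesis using agree[OF T(1)] unfolding z'_def by (metis add.assoc)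
  qed
  have near: "z' t \<in> cball (z T) \<rho>" if t: "t \<in> {T..T + h}" for t
  proof -
    have "norm (integral {T..t} v2) \<le> L * (t - T)"
      using t v2(2) by (intro norm_integral_le_bound v2_int) auto
    also have "\<dots> \<le> L * (T + h - T)" using t L(1) by (intro mult_left_mono) auto
    finally show ?thesis using Lh z'_high[OF t] by (simp add: dist_norm)
  qed
  have sw: "switch_time \<eta> V {0..T + h} z' = \<tau>"
  proof (rule switch_time_extend[OF I(2) _ agree])
    fix t assume t: "t \<in> {0..T + h} - I" and eq: "V (z' t) = \<eta> t / 2"
    have t': "t \<in> {T..T + h}" using t I_eq by auto
    show "\<tau> \<le> ereal t"
    proof (cases rule: switch_time_cases)
      case never
      then show ?thesis using gain[OF _ near[OF t'], of t] t' h(2) eq by auto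
    next
      case (at t\<^sub>b)
      then show ?thesis using T(2)[OF at(1)] t' by simp
    qed
  qed (use I_eq h in auto)
  have "closed_loop_trajectory \<phi> \<gamma> u\<^sub>0 V g k \<eta> {0..T + h} z'"
    unfolding closed_loop_trajectory_iff sw
  proof (intro conjI exI[of _ v'] exI[of _ "N \<union> N2"] ballI)
    show "z' s = z' 0 + integral {0..s} v'" for s by (simp add: z'_def)
    fix t assume t: "t \<in> {0..T + h} - (N \<union> N2)"
    show "v' t \<in> filippov (?R t) (z' t)"
    proof (cases "t \<le> T")
      case True
      then have "t \<in> I - N" using t I_eq by auto
      then show ?thesis using inclusion[of t] agree[of t] True by (simp add: v'_def)
    next
      case False
      then show ?thesis using incl2[of t] z'_high[of t] t by (simp add: v'_def)
    qed
  qed (use T(3) h N v2(3) v'_int in auto)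
  then show ?thesis using that[OF h(1)] agree by blast
qed

lemma global_conclusion:
  assumes "I = {0..}"
  shows "\<exists>t\<^sub>b\<ge>0. \<tau> = ereal t\<^sub>b \<and> V (z t\<^sub>b) \<le> \<eta> t\<^sub>b / 2 \<and>
    (\<forall>t. 0 \<le> t \<and> t < t\<^sub>b \<longrightarrow> \<eta> t / 2 < V (z t)) \<and> (\<forall>t>t\<^sub>b. z t \<in> safe_set \<eta> V t)"
proof (cases rule: switch_time_cases)
  case never
  then show ?thesis using switch_time_finite[OF assms] by simp
next
  case (at t\<^sub>b)
  have t0: "0 \<le> t\<^sub>b" using I_nonneg[OF at(1)] .
  have "\<eta> t / 2 < V (z t)" if "0 \<le> t" "t < t\<^sub>b" for t
    using V_above_before_switch[of t] that at(2) assms by simp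
  moreover have "z t \<in> safe_set \<eta> V t" if t: "t\<^sub>b < t" for t
  proof -
    have "V (z t) \<le> \<theta> * \<eta> t" using t t0 assms by (intro V_below_after_switch[OF at]) auto
    also have "\<dots> \<le> 1 * \<eta> t" using \<theta>_bounds \<eta>_pos[of t] t t0 by (intro mult_right_mono) auto
    finally show ?thesis by (simp add: safe_set_def)
  qed
  ultimately show ?thesis using at t0 by blast
qed

end

section \<open>Conclusion\<close>

text \<open>
  \<open>\<theta>1\<close> and \<open>\<theta>2\<close> solve the two conditions with equality; both are below \<open>1\<close>.
\<close>

lemma envelope_fraction_exists:
  fixes c \<alpha> m K q :: real
  assumes "0 < c" "0 < \<alpha>" "0 \<le> m" "m < c" "0 < K" "0 < q"
  obtains \<theta> where "1 / 2 \<le> \<theta>" "\<theta> < 1" "K \<le> q * (1 / (1 - \<theta>))" "m \<le> c * \<theta> powr \<alpha>"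
proof -
  define \<theta>1 where "\<theta>1 = 1 - q / K"
  define \<theta>2 where "\<theta>2 = (m / c) powr (1 / \<alpha>)"
  define \<theta> where "\<theta> = max (1 / 2) (max \<theta>1 \<theta>2)"
  have t1: "\<theta>1 < 1" using assms by (simp add: \<theta>1_def)
  have "(m / c) powr (1 / \<alpha>) < 1 powr (1 / \<alpha>)" using assms by (intro powr_less_mono2) auto
  then have t2: "\<theta>2 < 1" by (simp add: \<theta>2_def)
  have lt: "\<theta> < 1" using t1 t2 by (simp add: \<theta>_def)
  have "1 - \<theta> \<le> q / K" unfolding \<theta>_def \<theta>1_def by linarith
  then have "K * (1 - \<theta>) \<le> q" using assms by (simp add: field_simps)
  then have K: "K \<le> q * (1 / (1 - \<theta>))" using lt by (simp add: field_simps)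
  have "m = c * \<theta>2 powr \<alpha>" using assms by (simp add: \<theta>2_def powr_powr)
  also have "\<dots> \<le> c * \<theta> powr \<alpha>"
    using assms by (intro mult_left_mono powr_mono2) (auto simp: \<theta>_def \<theta>2_def)
  finally show ?thesis using that[of \<theta>] lt K by (simp add: \<theta>_def)
qed

theorem theorem1:
  fixes u\<^sub>0 V :: "real^'n::{finite,linorder} \<Rightarrow> real"
    and \<phi> \<gamma> g \<eta> :: "real \<Rightarrow> real"
    and p \<kappa> c \<alpha> \<phi>\<^sub>b \<gamma>\<^sub>m \<gamma>\<^sub>M k \<epsilon> M :: real
    and I :: "real set" and z :: "real \<Rightarrow> real^'n::{finite,linorder}" and z\<^sub>0 :: "real^'n::{finite,linorder}"
  assumes "\<kappa> < 0" and "0 < p"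
    and "0 \<le> p + (real CARD('n) + 1) * \<kappa>" and "p + (real CARD('n) + 1) * \<kappa> < 1"
    and "standing_assumption p \<kappa> u\<^sub>0 V c \<alpha>"
    and "\<phi> \<in> borel_measurable (lebesgue_on {0..})"
    and "\<gamma> \<in> borel_measurable (lebesgue_on {0..})"
    and "0 < \<phi>\<^sub>b" and "0 < \<gamma>\<^sub>m" and "0 < \<gamma>\<^sub>M"
    and "AE t in lebesgue_on {0..}. \<bar>\<phi> t\<bar> \<le> \<phi>\<^sub>b"
    and "AE t in lebesgue_on {0..}. \<gamma>\<^sub>m \<le> \<gamma> t \<and> \<gamma> t \<le> \<gamma>\<^sub>M"
    and "amplitude g" and "0 < k"
    and "0 < \<epsilon>" and "0 \<le> M" and "M * \<epsilon> powr (1 - \<alpha>) < c"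
    and "envelope \<epsilon> M \<eta>"
    and "maximal_solution (closed_loop_trajectory \<phi> \<gamma> u\<^sub>0 V g k \<eta>) I z"
    and "z 0 = z\<^sub>0"
  shows "I = {0..} \<and>
    (\<exists>t\<^sub>b\<ge>0. switch_time \<eta> V I z = ereal t\<^sub>b \<and>
       V (z t\<^sub>b) \<le> \<eta> t\<^sub>b / 2 \<and> (\<forall>t. 0 \<le> t \<and> t < t\<^sub>b \<longrightarrow> \<eta> t / 2 < V (z t)) \<and>
       (\<forall>t>t\<^sub>b. z t \<in> safe_set \<eta> V t))"
proof -
  note sa = assms(5)[unfolded standing_assumption_def]
  obtain d where d: "0 < d" "homogeneous_fun p \<kappa> d V" using sa by blast
  interpret homogeneous_lyapunov V p \<kappa> d
    by unfold_locales (use assms(1,3) sa d in blast)+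
  interpret variable_gain g k
    by unfold_locales (use assms(13,14) in \<open>auto simp: amplitude_def\<close>)
  have d_last: "d_last V x = grad x \<bullet> e_last" if "x \<noteq> 0" for x
    unfolding d_last_def by (rule frechet_derivative_V[OF that])
  interpret nominal_lyapunov V p \<kappa> d g k u\<^sub>0 c \<alpha>
  proof unfold_locales
    show "grad x \<bullet> v \<le> - c * V x powr \<alpha>" if "x \<noteq> 0" "v \<in> filippov (\<lambda>y. {nominal_field u\<^sub>0 y}) x" for x v
      using sa that frechet_derivative_V[OF that(1), of v] by metis
    show "u\<^sub>0 x * (grad x \<bullet> e_last) \<le> 0" if "x \<noteq> 0" for x using sa d_last[OF that] that by metis
    show "grad x \<bullet> e_last = 0" if "x \<noteq> 0" "u\<^sub>0 x = 0" for x using sa d_last[OF that(1)] that by metis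
  qed (use sa in blast)+
  obtain C where C: "0 \<le> C" "\<And>x. 0 \<le> x \<Longrightarrow> x - \<gamma>\<^sub>m * (g x * x) \<le> C"
    using domination_constant[OF assms(9)] by blast
  note env = assms(18)[unfolded envelope_def]
  obtain \<eta>' where \<eta>': "continuous_on {0..} \<eta>'"
    "\<And>t. 0 \<le> t \<Longrightarrow> (\<eta> has_real_derivative \<eta>' t) (at t within {0..}) \<and> - \<eta>' t \<le> M * \<eta> t"
    using env by blast
  have \<eta>0: "\<eta> 0 = \<epsilon>" using env by blast
  obtain \<theta> where \<theta>: "1 / 2 \<le> \<theta>" "\<theta> < 1" "C + \<phi>\<^sub>b \<le> \<gamma>\<^sub>m * k * (1 / (1 - \<theta>))"
    "M * \<epsilon> powr (1 - \<alpha>) \<le> c * \<theta> powr \<alpha>"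
    by (rule envelope_fraction_exists[of c \<alpha> "M * \<epsilon> powr (1 - \<alpha>)" "C + \<phi>\<^sub>b" "\<gamma>\<^sub>m * k"])
       (use c_pos \<alpha>_bounds assms(8,9,14,16,17) C(1) in auto)
  have traj: "closed_loop_trajectory \<phi> \<gamma> u\<^sub>0 V g k \<eta> I z"
    and maximal: "\<And>I' z'. closed_loop_trajectory \<phi> \<gamma> u\<^sub>0 V g k \<eta> I' z' \<Longrightarrow> I \<subseteq> I' \<Longrightarrow>
      (\<And>t. t \<in> I \<Longrightarrow> z' t = z t) \<Longrightarrow> I' = I"
    using assms(19) unfolding maximal_solution_def by blast+
  from traj obtain v N\<^sub>1 where I: "is_interval I" "0 \<in> I" "I \<subseteq> {0..}"
    and v: "\<And>T. T \<in> I \<Longrightarrow> v absolutely_integrable_on {0..T} \<and> z T = z 0 + integral {0..T} v"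
    and N1: "negligible N\<^sub>1"
    and incl: "\<And>t. t \<in> I - N\<^sub>1 \<Longrightarrow>
      v t \<in> filippov (loop_field u\<^sub>0 g k (\<phi> t) (\<gamma> t) (gain \<eta> V (switch_time \<eta> V I z) t)) (z t)"
    unfolding closed_loop_trajectory_iff by blast
  have "AE t in lebesgue_on {0..}. \<bar>\<phi> t\<bar> \<le> \<phi>\<^sub>b \<and> \<gamma>\<^sub>m \<le> \<gamma> t \<and> \<gamma> t \<le> \<gamma>\<^sub>M"
    using assms(11,12) by eventually_elim blast
  moreover have "{0::real..} \<in> sets lebesgue" by simp
  ultimately obtain N\<^sub>2 where N2: "negligible N\<^sub>2"
    "\<And>t. t \<in> {0..} - N\<^sub>2 \<Longrightarrow> \<bar>\<phi> t\<bar> \<le> \<phi>\<^sub>b \<and> \<gamma>\<^sub>m \<le> \<gamma> t \<and> \<gamma> t \<le> \<gamma>\<^sub>M"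
    by (simp only: AE_lebesgue_on_iff_negligible) blast
  interpret trajectory V p \<kappa> d g k u\<^sub>0 c \<alpha> \<phi> \<gamma> \<eta> \<eta>' \<phi>\<^sub>b \<gamma>\<^sub>m \<gamma>\<^sub>M M C \<theta> I "N\<^sub>1 \<union> N\<^sub>2" z v
  proof unfold_locales
    show "\<eta> t \<le> \<eta> s" if "0 \<le> s" "s \<le> t" for s t
    proof -
      have "antimono_on {0..} \<eta>" using env by blast
      from monotone_onD[OF this, of s t] show ?thesis using that by simp
    qed
    show "M * \<eta> 0 powr (1 - \<alpha>) \<le> c * \<theta> powr \<alpha>" using \<theta>(4) \<eta>0 by simp
    show "0 < \<eta> t" if "0 \<le> t" for t using env that by blast
    show "(\<eta> has_real_derivative \<eta>' t) (at t within {0..})" "- \<eta>' t \<le> M * \<eta> t" if "0 \<le> t" for t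
      using \<eta>'(2)[OF that] by blast+
    show "x - \<gamma>\<^sub>m * (g x * x) \<le> C" if "0 \<le> x" for x using C(2)[OF that] .
    show "v absolutely_integrable_on {0..T}" "z T = z 0 + integral {0..T} v" if "T \<in> I" for T
      using v[OF that] by blast+
    show "v t \<in> filippov (loop_field u\<^sub>0 g k (\<phi> t) (\<gamma> t) (gain \<eta> V (switch_time \<eta> V I z) t)) (z t)"
      if "t \<in> I - (N\<^sub>1 \<union> N\<^sub>2)" for t using that by (intro incl) blast
    show "\<bar>\<phi> t\<bar> \<le> \<phi>\<^sub>b \<and> \<gamma>\<^sub>m \<le> \<gamma> t \<and> \<gamma> t \<le> \<gamma>\<^sub>M" if "0 \<le> t" "t \<notin> N\<^sub>1 \<union> N\<^sub>2" for t
      using that by (intro N2(2)) simp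
    show "negligible (N\<^sub>1 \<union> N\<^sub>2)" using N1 N2(1) by simp
  qed (fact assms C(1) \<eta>'(1) \<theta>(1-3) I)+
  have "I = {0..}"
  proof (cases rule: nonneg_interval_cases[OF I])
    case (2 T)
    obtain z' where *: "closed_loop_trajectory \<phi> \<gamma> u\<^sub>0 V g k \<eta> {0..T} z'" "\<And>t. t \<in> I \<Longrightarrow> z' t = z t"
      using extends_to_closure[OF 2(2,1)] by blast
    have "I \<subseteq> {0..T}" using 2 by auto
    from maximal[OF *(1) this *(2)] have "{0..T} = I" .
    then have "T \<in> {0..<T}" using 2 by auto
    then show ?thesis by simp
  next
    case (3 T)
    obtain h z' where h: "0 < h" and *: "closed_loop_trajectory \<phi> \<gamma> u\<^sub>0 V g k \<eta> {0..T + h} z'" "\<And>t. t \<in> I \<Longrightarrow> z' t = z t"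
      using extends_beyond_endpoint[OF 3(2)] by blast
    have "I \<subseteq> {0..T + h}" using 3 h by auto
    from maximal[OF *(1) this *(2)] have "{0..T + h} = I" .
    then show ?thesis using 3 h by simp
  qed
  then show ?thesis using global_conclusion by blast
qed

end
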